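(* Let $E$ be a finite dimensional Hopf algebra over a field $k$ which is both semisimple and cosemisimple, let $A$ be an $E$-module algebra, and take $B=A\ast E$. The inclusion $L(B;E)\to L(B)$ is a quasi-isomorphism of dg Lie algebras.
   Context: $k$ is a field, $\otimes=\otimes_k$, Sweedler notation. $B=A\ast E$ is the smash product (elements $aw$, with $wa=(w_1\cdot a)w_2$), an algebra in the category $YD^E_E$ of right Yetter-Drinfeld modules via the right adjoint action $b\cdot w=S(w_1)bw_2$ and coaction $aw\mapsto aw_1\otimes w_2$. $YD^E_E=D\mathrm{mod}$ for $D$ the Drinfeld double, which contains $E^{op}$ and $E^*$ as Hopf subalgebras and has $R$-matrix $r_j\otimes r^j$ (sum suppressed), $\{r_j\}$ a basis of $E$ and $\{r^j\}$ the dual basis; $w\in E^{op}$ acts by $w\cdot m=m\cdot w$ and $\xi\in E^*$ by $\xi\cdot m=m_0\xi(m_1)$. The braided Hochschild complex $C^\bullet_c(B)$ has $C^n_c(B)=\mathrm{Hom}_k(B^{\otimes n},B)$ with $D$-action $(h\cdot f)(x)=h_1\cdot f(S_D(h_2)\cdot x)$ and differential, for $f$ of degree $n$, $(-1)^{n+1}d_c(f)(b_1\otimes\dots\otimes b_{n+1})=(r^j\cdot b_1)(r_j\cdot f)(b_2\otimes\dots\otimes b_{n+1})+\sum_{i=1}^n(-1)^if(\dots\otimes b_ib_{i+1}\otimes\dots)+(-1)^{n+1}f(b_1\otimes\dots\otimes b_n)b_{n+1}$. The normalized complex $\bar C^\bullet_c(B)$ is the subcomplex of maps vanishing on each monomial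 $b_1\otimes\dots\otimes b_n$ with some $b_i=1$. $\bar C^\bullet(B)$ is the usual normalized (non-braided) Hochschild cochain complex of the algebra $B$ (same formula with the first term replaced by $b_1f(b_2\otimes\dots\otimes b_{n+1})$). $L(B):=\Sigma\bar C^\bullet(B)$ is the shifted normalized Hochschild complex with its usual dg Lie structure (Gerstenhaber bracket). $L(B;E):=\Sigma\bar C^\bullet_c(B)^E$, where $(-)^E$ denotes invariants under $E^{op}\subset D$, i.e. $w\cdot f=\epsilon(w)f$; these are exactly the cochains that are $E$-linear for the adjoint action. On invariant cochains $d_c$ agrees with the usual Hochschild differential, and the inclusion $\bar C^\bullet_c(B)^E\to\bar C^\bullet(B)$ induces the dg Lie structure on $L(B;E)$. *)

theory Defs
  imports Complex_Main "HOL-Library.Multiset" "HOL-Library.Function_Algebras"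
begin

section \<open>Tensors\<close>

text \<open>
  An element of \<open>V \<otimes>\<^sub>k W\<close> is represented by a formal sum of pure tensors, i.e. by a multiset of pairs,
  so that Sweedler notation becomes a sum over a multiset. Two formal sums denote the same tensor
  iff they are related by the congruence generated by the defining relations of the tensor product.
  Coefficients are absorbed into the factors. The rule \<open>zero\<close> is needed because multisets
  only form a monoid: it identifies \<open>0 \<otimes> w\<close> with the empty sum.
\<close>

inductive tensor_eq ::
  "('k::field \<Rightarrow> 'v::ab_group_add \<Rightarrow> 'v) \<Rightarrow> ('k \<Rightarrow> 'w::ab_group_add \<Rightarrow> 'w)
    \<Rightarrow> ('v \<times> 'w) multiset \<Rightarrow> ('v \<times> 'w) multiset \<Rightarrow> bool"
  for sV :: "'k::field \<Rightarrow> 'v::ab_group_add \<Rightarrow> 'v" and sW :: "'k \<Rightarrow> 'w::ab_group_add \<Rightarrow> 'w"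
where
  refl: "tensor_eq sV sW M M"
| sym: "tensor_eq sV sW M N \<Longrightarrow> tensor_eq sV sW N M"
| trans: "tensor_eq sV sW M N \<Longrightarrow> tensor_eq sV sW N P \<Longrightarrow> tensor_eq sV sW M P"
| cong: "tensor_eq sV sW M N \<Longrightarrow> tensor_eq sV sW (M + P) (N + P)"
| zero: "tensor_eq sV sW {#(0, w)#} {#}"
| add_left: "tensor_eq sV sW {#(v + v', w)#} {#(v, w), (v', w)#}"
| add_right: "tensor_eq sV sW {#(v, w + w')#} {#(v, w), (v, w')#}"
| scale: "tensor_eq sV sW {#(sV c v, w)#} {#(v, sW c w)#}"

text \<open>The same for \<open>V \<otimes> V \<otimes> V\<close>, where coassociativity lives.\<close>

inductive tensor3_eq ::
  "('k::field \<Rightarrow> 'v::ab_group_add \<Rightarrow> 'v)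
    \<Rightarrow> ('v \<times> 'v \<times> 'v) multiset \<Rightarrow> ('v \<times> 'v \<times> 'v) multiset \<Rightarrow> bool"
  for s :: "'k::field \<Rightarrow> 'v::ab_group_add \<Rightarrow> 'v"
where
  refl: "tensor3_eq s M M"
| sym: "tensor3_eq s M N \<Longrightarrow> tensor3_eq s N M"
| trans: "tensor3_eq s M N \<Longrightarrow> tensor3_eq s N P \<Longrightarrow> tensor3_eq s M P"
| cong: "tensor3_eq s M N \<Longrightarrow> tensor3_eq s (M + P) (N + P)"
| zero: "tensor3_eq s {#(0, v, w)#} {#}"
| add1: "tensor3_eq s {#(u + u', v, w)#} {#(u, v, w), (u', v, w)#}"
| add2: "tensor3_eq s {#(u, v + v', w)#} {#(u, v, w), (u, v', w)#}"
| add3: "tensor3_eq s {#(u, v, w + w')#} {#(u, v, w), (u, v, w')#}"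
| scale12: "tensor3_eq s {#(s c u, v, w)#} {#(u, s c v, w)#}"
| scale23: "tensor3_eq s {#(u, s c v, w)#} {#(u, v, s c w)#}"


section \<open>Algebras, Hopf algebras, module algebras, smash products\<close>

text \<open>
  Associative unital algebras over a field. The unit is a parameter and the type is only
  required to be in class \<open>ring\<close>, because \<open>ring_1\<close> would exclude the zero algebra.
\<close>

locale unital_algebra = vector_space scale
  for scale :: "'k::field \<Rightarrow> 'a::ring \<Rightarrow> 'a" +
  fixes unit :: 'a
  assumes scale_mult_left: "scale c x * y = scale c (x * y)"
    and scale_mult_right: "x * scale c y = scale c (x * y)"
    and unit_left: "unit * x = x"
    and unit_right: "x * unit = x"

definition bilinear_map ::
  "('k::field \<Rightarrow> 'u::ab_group_add \<Rightarrow> 'u) \<Rightarrow> ('k \<Rightarrow> 'v::ab_group_add \<Rightarrow> 'v)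
    \<Rightarrow> ('k \<Rightarrow> 'w::ab_group_add \<Rightarrow> 'w) \<Rightarrow> ('u \<Rightarrow> 'v \<Rightarrow> 'w) \<Rightarrow> bool" where
  "bilinear_map sU sV sW \<beta> \<longleftrightarrow>
     (\<forall>v. Vector_Spaces.linear sU sW (\<lambda>u. \<beta> u v)) \<and> (\<forall>u. Vector_Spaces.linear sV sW (\<beta> u))"

text \<open>\<open>comult H w\<close> is a representative \<open>w\<^sub>1 \<otimes> w\<^sub>2\<close> of the coproduct of \<open>w\<close>; the axioms below
  are equations between tensors, so nothing depends on which representative is chosen.\<close>

record ('k, 'e) hopf =
  hscale :: "'k \<Rightarrow> 'e \<Rightarrow> 'e"
  hunit :: 'e
  comult :: "'e \<Rightarrow> ('e \<times> 'e) multiset"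
  counit :: "'e \<Rightarrow> 'k"
  antipode :: "'e \<Rightarrow> 'e"

locale hopf_algebra = unital_algebra "hscale H" "hunit H"
  for H :: "('k::field, 'e::ring) hopf" +
  assumes comult_add:
      "tensor_eq (hscale H) (hscale H) (comult H (x + y)) (comult H x + comult H y)"
    and comult_scale:
      "tensor_eq (hscale H) (hscale H) (comult H (hscale H c x))
         (image_mset (\<lambda>(u, v). (hscale H c u, v)) (comult H x))"
    and counit_linear: "Vector_Spaces.linear (hscale H) (*) (counit H)"
    and coassoc:
      "tensor3_eq (hscale H)
         (\<Sum>(u, v)\<in>#comult H x. image_mset (\<lambda>(u1, u2). (u1, u2, v)) (comult H u))
         (\<Sum>(u, v)\<in>#comult H x. image_mset (\<lambda>(v1, v2). (u, v1, v2)) (comult H v))"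
    and counit_left: "(\<Sum>(u, v)\<in>#comult H x. hscale H (counit H u) v) = x"
    and counit_right: "(\<Sum>(u, v)\<in>#comult H x. hscale H (counit H v) u) = x"
    and comult_mult:
      "tensor_eq (hscale H) (hscale H) (comult H (x * y))
         (\<Sum>(u, v)\<in>#comult H x. \<Sum>(u', v')\<in>#comult H y. {#(u * u', v * v')#})"
    and comult_unit:
      "tensor_eq (hscale H) (hscale H) (comult H (hunit H)) {#(hunit H, hunit H)#}"
    and counit_mult: "counit H (x * y) = counit H x * counit H y"
    and counit_unit: "counit H (hunit H) = 1"
    and antipode_linear: "Vector_Spaces.linear (hscale H) (hscale H) (antipode H)"
    and antipode_left:
      "(\<Sum>(u, v)\<in>#comult H x. antipode H u * v) = hscale H (counit H x) (hunit H)"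
    and antipode_right:
      "(\<Sum>(u, v)\<in>#comult H x. u * antipode H v) = hscale H (counit H x) (hunit H)"

text \<open>Semisimplicity: the regular left module is completely reducible.\<close>

definition left_ideal :: "('k::field \<Rightarrow> 'e::ring \<Rightarrow> 'e) \<Rightarrow> 'e set \<Rightarrow> bool" where
  "left_ideal s I \<longleftrightarrow> module.subspace s I \<and> (\<forall>x. \<forall>y\<in>I. x * y \<in> I)"

definition semisimple_algebra :: "('k::field \<Rightarrow> 'e::ring \<Rightarrow> 'e) \<Rightarrow> bool" where
  "semisimple_algebra s \<longleftrightarrow>
     (\<forall>I. left_ideal s I \<longrightarrow>
        (\<exists>J. left_ideal s J \<and> I \<inter> J = {0} \<and> (\<forall>x. \<exists>i\<in>I. \<exists>j\<in>J. x = i + j)))"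

text \<open>Cosemisimplicity: the coalgebra is the sum of its simple subcoalgebras.\<close>

definition subcoalgebra :: "('k::field, 'e::ring) hopf \<Rightarrow> 'e set \<Rightarrow> bool" where
  "subcoalgebra H C \<longleftrightarrow> module.subspace (hscale H) C \<and>
     (\<forall>x\<in>C. \<exists>M. set_mset M \<subseteq> C \<times> C \<and> tensor_eq (hscale H) (hscale H) (comult H x) M)"

definition simple_subcoalgebra :: "('k::field, 'e::ring) hopf \<Rightarrow> 'e set \<Rightarrow> bool" where
  "simple_subcoalgebra H C \<longleftrightarrow> subcoalgebra H C \<and> C \<noteq> {0} \<and>
     (\<forall>C'. subcoalgebra H C' \<and> C' \<subseteq> C \<longrightarrow> C' = {0} \<or> C' = C)"

definition cosemisimple_coalgebra :: "('k::field, 'e::ring) hopf \<Rightarrow> bool" where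
  "cosemisimple_coalgebra H \<longleftrightarrow>
     module.span (hscale H) (\<Union>{C. simple_subcoalgebra H C}) = UNIV"

locale module_algebra = H: hopf_algebra H + A: unital_algebra sA uA
  for H :: "('k::field, 'e::ring) hopf" and sA :: "'k \<Rightarrow> 'a::ring \<Rightarrow> 'a" and uA :: 'a +
  fixes act :: "'e \<Rightarrow> 'a \<Rightarrow> 'a"
  assumes act_bilinear: "bilinear_map (hscale H) sA sA act"
    and act_unit: "act (hunit H) a = a"
    and act_mult: "act (w * w') a = act w (act w' a)"
    and act_on_mult: "act w (a * a') = (\<Sum>(u, v)\<in>#comult H w. act u a * act v a')"
    and act_on_unit: "act w uA = sA (counit H w) uA"

text \<open>
  \<open>B\<close> is the smash product \<open>A \<ast> E\<close>: the map \<open>sm a w = aw\<close> induces a linear isomorphism from \<open>A \<otimes> E\<close>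
  onto \<open>B\<close> (bilinear, spanning and injective on tensors), the unit is \<open>1 1\<close> and the
  multiplication is \<open>(aw)(a'w') = a (w\<^sub>1 \<cdot> a') w\<^sub>2 w'\<close>.
\<close>

locale smash_product = module_algebra H sA uA act + B: unital_algebra sB uB
  for H :: "('k::field, 'e::ring) hopf" and sA :: "'k \<Rightarrow> 'a::ring \<Rightarrow> 'a" and uA :: 'a
    and act :: "'e \<Rightarrow> 'a \<Rightarrow> 'a" and sB :: "'k \<Rightarrow> 'b::ring \<Rightarrow> 'b" and uB :: 'b +
  fixes sm :: "'a \<Rightarrow> 'e \<Rightarrow> 'b"
  assumes sm_bilinear: "bilinear_map sA (hscale H) sB sm"
    and sm_surj: "\<exists>M. b = (\<Sum>(a, w)\<in>#M. sm a w)"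
    and sm_inj: "(\<Sum>(a, w)\<in>#M. sm a w) = (\<Sum>(a, w)\<in>#N. sm a w) \<Longrightarrow> tensor_eq sA (hscale H) M N"
    and sm_unit: "sm uA (hunit H) = uB"
    and sm_mult: "sm a w * sm a' w' = (\<Sum>(u, v)\<in>#comult H w. sm (a * act u a') (v * w'))"


section \<open>dg Lie algebras and their quasi-isomorphisms\<close>

definition ksign :: "'i::semiring_parity \<Rightarrow> 'x::ab_group_add \<Rightarrow> 'x" where  \<comment> \<open>\<open>(-1)\<^sup>p x\<close>\<close>
  "ksign p x = (if even p then x else - x)"

text \<open>\<open>\<int>\<close>-graded objects whose components are subspaces of one ambient vector space;
  the operations take the degrees of their arguments as parameters.\<close>

record 'x dgl =
  comp :: "int \<Rightarrow> 'x set"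
  diff :: "int \<Rightarrow> 'x \<Rightarrow> 'x"
  brk :: "int \<Rightarrow> int \<Rightarrow> 'x \<Rightarrow> 'x \<Rightarrow> 'x"

locale dg_lie_algebra = vector_space s
  for s :: "'k::field \<Rightarrow> 'x::ab_group_add \<Rightarrow> 'x" +
  fixes L :: "'x dgl"
  assumes comp_subspace: "subspace (comp L p)"
    and diff_closed: "x \<in> comp L p \<Longrightarrow> diff L p x \<in> comp L (p + 1)"
    and diff_add: "x \<in> comp L p \<Longrightarrow> y \<in> comp L p \<Longrightarrow> diff L p (x + y) = diff L p x + diff L p y"
    and diff_scale: "x \<in> comp L p \<Longrightarrow> diff L p (s c x) = s c (diff L p x)"
    and diff_diff: "x \<in> comp L p \<Longrightarrow> diff L (p + 1) (diff L p x) = 0"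
    and brk_closed: "x \<in> comp L p \<Longrightarrow> y \<in> comp L q \<Longrightarrow> brk L p q x y \<in> comp L (p + q)"
    and brk_add_left: "x \<in> comp L p \<Longrightarrow> x' \<in> comp L p \<Longrightarrow> y \<in> comp L q
      \<Longrightarrow> brk L p q (x + x') y = brk L p q x y + brk L p q x' y"
    and brk_scale_left: "x \<in> comp L p \<Longrightarrow> y \<in> comp L q
      \<Longrightarrow> brk L p q (s c x) y = s c (brk L p q x y)"
    and brk_add_right: "x \<in> comp L p \<Longrightarrow> y \<in> comp L q \<Longrightarrow> y' \<in> comp L q
      \<Longrightarrow> brk L p q x (y + y') = brk L p q x y + brk L p q x y'"
    and brk_scale_right: "x \<in> comp L p \<Longrightarrow> y \<in> comp L q
      \<Longrightarrow> brk L p q x (s c y) = s c (brk L p q x y)"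
    and antisym: "x \<in> comp L p \<Longrightarrow> y \<in> comp L q
      \<Longrightarrow> brk L p q x y = - ksign (p * q) (brk L q p y x)"
    and jacobi: "x \<in> comp L p \<Longrightarrow> y \<in> comp L q \<Longrightarrow> z \<in> comp L r
      \<Longrightarrow> brk L p (q + r) x (brk L q r y z)
        = brk L (p + q) r (brk L p q x y) z + ksign (p * q) (brk L q (p + r) y (brk L p r x z))"
    and leibniz: "x \<in> comp L p \<Longrightarrow> y \<in> comp L q
      \<Longrightarrow> diff L (p + q) (brk L p q x y)
        = brk L (p + 1) q (diff L p x) y + ksign p (brk L p (q + 1) x (diff L q y))"

definition cocycles :: "'x::ab_group_add dgl \<Rightarrow> int \<Rightarrow> 'x set" where
  "cocycles L p = {x \<in> comp L p. diff L p x = 0}"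

definition coboundaries :: "'x::ab_group_add dgl \<Rightarrow> int \<Rightarrow> 'x set" where
  "coboundaries L p = diff L (p - 1) ` comp L (p - 1)"

definition cohomologous :: "'x::ab_group_add dgl \<Rightarrow> int \<Rightarrow> ('x \<times> 'x) set" where
  "cohomologous L p = {(x, y). x \<in> cocycles L p \<and> y \<in> cocycles L p \<and> x - y \<in> coboundaries L p}"

definition cohomology :: "'x::ab_group_add dgl \<Rightarrow> int \<Rightarrow> 'x set set" where
  "cohomology L p = cocycles L p // cohomologous L p"

text \<open>The map \<open>[x] \<mapsto> [\<phi> x]\<close>.\<close>

definition cohomology_map ::
  "'y::ab_group_add dgl \<Rightarrow> int \<Rightarrow> ('x \<Rightarrow> 'y) \<Rightarrow> 'x set \<Rightarrow> 'y set" where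
  "cohomology_map M p \<phi> X = cohomologous M p `` (\<phi> ` X)"

locale dg_lie_hom = L: dg_lie_algebra s L + M: dg_lie_algebra t M
  for s :: "'k::field \<Rightarrow> 'x::ab_group_add \<Rightarrow> 'x" and L :: "'x dgl"
    and t :: "'k \<Rightarrow> 'y::ab_group_add \<Rightarrow> 'y" and M :: "'y dgl" +
  fixes \<phi> :: "int \<Rightarrow> 'x \<Rightarrow> 'y"
  assumes hom_closed: "x \<in> comp L p \<Longrightarrow> \<phi> p x \<in> comp M p"
    and hom_add: "x \<in> comp L p \<Longrightarrow> y \<in> comp L p \<Longrightarrow> \<phi> p (x + y) = \<phi> p x + \<phi> p y"
    and hom_scale: "x \<in> comp L p \<Longrightarrow> \<phi> p (s c x) = t c (\<phi> p x)"
    and hom_diff: "x \<in> comp L p \<Longrightarrow> \<phi> (p + 1) (diff L p x) = diff M p (\<phi> p x)"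
    and hom_brk: "x \<in> comp L p \<Longrightarrow> y \<in> comp L q
      \<Longrightarrow> \<phi> (p + q) (brk L p q x y) = brk M p q (\<phi> p x) (\<phi> q y)"

locale dg_lie_quasi_iso = dg_lie_hom s L t M \<phi>
  for s :: "'k::field \<Rightarrow> 'x::ab_group_add \<Rightarrow> 'x" and L :: "'x dgl"
    and t :: "'k \<Rightarrow> 'y::ab_group_add \<Rightarrow> 'y" and M :: "'y dgl" and \<phi> :: "int \<Rightarrow> 'x \<Rightarrow> 'y" +
  assumes cohomology_iso:
    "bij_betw (cohomology_map M p (\<phi> p)) (cohomology L p) (cohomology M p)"


section \<open>The Hochschild dg Lie algebra\<close>

text \<open>
  \<open>Hom\<^sub>k(B\<^bsup>\<otimes>n\<^esup>, B)\<close> is the space of \<open>n\<close>-ary multilinear maps; such a map is a function on lists which is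
  \<open>0\<close> on lists of length other than \<open>n\<close>. Function spaces carry the pointwise vector space
  structure.
\<close>

definition fscale :: "('k \<Rightarrow> 'b \<Rightarrow> 'b) \<Rightarrow> 'k \<Rightarrow> ('b list \<Rightarrow> 'b) \<Rightarrow> 'b list \<Rightarrow> 'b" where
  "fscale s c f = (\<lambda>bs. s c (f bs))"

definition cochains :: "('k::field \<Rightarrow> 'b::ring \<Rightarrow> 'b) \<Rightarrow> nat \<Rightarrow> ('b list \<Rightarrow> 'b) set" where
  "cochains s n = {f. (\<forall>bs. length bs \<noteq> n \<longrightarrow> f bs = 0) \<and>
     (\<forall>us vs. length us + 1 + length vs = n \<longrightarrow> Vector_Spaces.linear s s (\<lambda>b. f (us @ b # vs)))}"

definition normalized_cochains ::
  "('k::field \<Rightarrow> 'b::ring \<Rightarrow> 'b) \<Rightarrow> 'b \<Rightarrow> nat \<Rightarrow> ('b list \<Rightarrow> 'b) set" where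
  "normalized_cochains s u n = {f \<in> cochains s n. \<forall>bs. u \<in> set bs \<longrightarrow> f bs = 0}"

text \<open>All terms of the differential but the first; this part is common to the usual and
  the braided differential. Entry \<open>b\<^sub>i\<close> of the list \<open>bs\<close> is \<open>bs ! (i - 1)\<close>.\<close>

definition hochschild_tail :: "nat \<Rightarrow> ('b::ring list \<Rightarrow> 'b) \<Rightarrow> 'b list \<Rightarrow> 'b" where
  "hochschild_tail n f bs =
     (\<Sum>i=1..n. ksign i (f (take (i - 1) bs @ (bs ! (i - 1) * bs ! i) # drop (i + 1) bs)))
     + ksign (n + 1) (f (take n bs) * bs ! n)"

definition hochschild_d :: "nat \<Rightarrow> ('b::ring list \<Rightarrow> 'b) \<Rightarrow> 'b list \<Rightarrow> 'b" where
  "hochschild_d n f = (\<lambda>bs. if length bs = n + 1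
     then ksign (n + 1) (hd bs * f (tl bs) + hochschild_tail n f bs) else 0)"

text \<open>Gerstenhaber's circle product
  \<open>f \<circ> g = \<Sum>\<^sub>i (-1)\<^bsup>i(n-1)\<^esup> f(b\<^sub>1, \<dots>, b\<^sub>i, g(b\<^bsub>i+1\<^esub>, \<dots>, b\<^bsub>i+n\<^esub>), \<dots>)\<close> (\<open>0 \<le> i < m\<close>) and bracket,
  for \<open>f\<close> of arity \<open>m\<close> and \<open>g\<close> of arity \<open>n\<close>. The overall sign of the differential is the
  one for which it equals \<open>[\<mu>, -]\<close>, where \<open>\<mu>\<close> is the multiplication.\<close>

definition circle :: "nat \<Rightarrow> nat \<Rightarrow> ('b::ring list \<Rightarrow> 'b) \<Rightarrow> ('b list \<Rightarrow> 'b) \<Rightarrow> 'b list \<Rightarrow> 'b" where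
  "circle m n f g = (\<lambda>bs. if length bs + 1 = m + n
     then (\<Sum>i<m. ksign (int i * (int n - 1))
             (f (take i bs @ g (take n (drop i bs)) # drop (i + n) bs)))
     else 0)"

definition gerstenhaber_bracket ::
  "nat \<Rightarrow> nat \<Rightarrow> ('b::ring list \<Rightarrow> 'b) \<Rightarrow> ('b list \<Rightarrow> 'b) \<Rightarrow> 'b list \<Rightarrow> 'b" where
  "gerstenhaber_bracket m n f g =
     circle m n f g - ksign ((int m - 1) * (int n - 1)) (circle n m g f)"

text \<open>The shift: the component of degree \<open>p\<close> of \<open>\<Sigma>C\<close> is \<open>C\<^bsup>p+1\<^esup>\<close>, which is zero for \<open>p < -1\<close>.\<close>

definition shifted_dgl ::
  "(nat \<Rightarrow> ('b::ring list \<Rightarrow> 'b) set) \<Rightarrow> (nat \<Rightarrow> ('b list \<Rightarrow> 'b) \<Rightarrow> 'b list \<Rightarrow> 'b)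
    \<Rightarrow> ('b list \<Rightarrow> 'b) dgl" where
  "shifted_dgl C d =
     \<lparr> comp = (\<lambda>p. if p < -1 then {0} else C (nat (p + 1))),
       diff = (\<lambda>p. d (nat (p + 1))),
       brk = (\<lambda>p q. gerstenhaber_bracket (nat (p + 1)) (nat (q + 1))) \<rparr>"

definition L_Hochschild :: "('k::field \<Rightarrow> 'b::ring \<Rightarrow> 'b) \<Rightarrow> 'b \<Rightarrow> ('b list \<Rightarrow> 'b) dgl" where
  "L_Hochschild sB uB = shifted_dgl (normalized_cochains sB uB) hochschild_d"


section \<open>The braided Hochschild complex and its invariants\<close>

text \<open>Throughout, \<open>sm uA w\<close> is the element \<open>1w\<close> of \<open>B = A \<ast> E\<close>. The right adjoint action
  \<open>b \<cdot> w = S(w\<^sub>1) b w\<^sub>2\<close> is the action \<open>w \<cdot> b\<close> of \<open>w \<in> E\<^bsup>op\<^esup> \<subseteq> D\<close>.\<close>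

definition adj ::
  "('k::field, 'e::ring) hopf \<Rightarrow> 'a \<Rightarrow> ('a \<Rightarrow> 'e \<Rightarrow> 'b::ring) \<Rightarrow> 'b \<Rightarrow> 'e \<Rightarrow> 'b" where
  "adj H uA sm b w = (\<Sum>(u, v)\<in>#comult H w. sm uA (antipode H u) * b * sm uA v)"

text \<open>The coaction \<open>aw \<mapsto> aw\<^sub>1 \<otimes> w\<^sub>2\<close>, computed on an arbitrary expression of \<open>b\<close> as a sum of
  elements \<open>aw\<close>; its class in \<open>B \<otimes> E\<close> does not depend on that expression.\<close>

definition coaction ::
  "('k::field, 'e::ring) hopf \<Rightarrow> ('a \<Rightarrow> 'e \<Rightarrow> 'b::ring) \<Rightarrow> 'b \<Rightarrow> ('b \<times> 'e) multiset" where
  "coaction H sm b =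
     (\<Sum>(a, w)\<in>#(SOME M. b = (\<Sum>(a, w)\<in>#M. sm a w)).
        image_mset (\<lambda>(u, v). (sm a u, v)) (comult H w))"

definition dual_act ::
  "('k::field, 'e::ring) hopf \<Rightarrow> ('k \<Rightarrow> 'b::ring \<Rightarrow> 'b) \<Rightarrow> ('a \<Rightarrow> 'e \<Rightarrow> 'b) \<Rightarrow> ('e \<Rightarrow> 'k) \<Rightarrow> 'b \<Rightarrow> 'b"
  where  \<comment> \<open>\<open>\<xi> \<cdot> b = b\<^sub>0 \<xi>(b\<^sub>1)\<close>\<close>
  "dual_act H sB sm \<xi> b = (\<Sum>(x, v)\<in>#coaction H sm b. sB (\<xi> v) x)"

text \<open>
  The value \<open>f(w \<cdot> (b\<^sub>1 \<otimes> \<dots> \<otimes> b\<^sub>n)) = f((b\<^sub>1 \<cdot> w\<^sub>1) \<otimes> \<dots> \<otimes> (b\<^sub>n \<cdot> w\<^sub>n))\<close> of a multilinear map on the diagonal action of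
  \<open>w \<in> E\<^bsup>op\<^esup>\<close>; on \<open>B\<^bsup>\<otimes>0\<^esup> = k\<close> it is the action through the counit. (\<open>E\<^bsup>op\<^esup>\<close> has the coproduct of \<open>E\<close>.)
\<close>

primrec eval_diag ::
  "('k::field, 'e::ring) hopf \<Rightarrow> 'a \<Rightarrow> ('k \<Rightarrow> 'b::ring \<Rightarrow> 'b) \<Rightarrow> ('a \<Rightarrow> 'e \<Rightarrow> 'b)
    \<Rightarrow> 'b list \<Rightarrow> ('b list \<Rightarrow> 'b) \<Rightarrow> 'e \<Rightarrow> 'b" where
  "eval_diag H uA sB sm [] f w = sB (counit H w) (f [])"
| "eval_diag H uA sB sm (b # bs) f w =
     (\<Sum>(u, v)\<in>#comult H w. eval_diag H uA sB sm bs (\<lambda>cs. f (adj H uA sm b u # cs)) v)"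

text \<open>The action \<open>(w \<cdot> f)(x) = w\<^sub>1 \<cdot> f(S\<^sub>D(w\<^sub>2) \<cdot> x)\<close> of \<open>w \<in> E\<^bsup>op\<^esup>\<close>. On \<open>E\<^bsup>op\<^esup>\<close> the antipode \<open>S\<^sub>D\<close> of \<open>D\<close> is
  the inverse of the antipode of \<open>E\<close> (which is bijective as \<open>E\<close> is finite dimensional).\<close>

definition cochain_act ::
  "('k::field, 'e::ring) hopf \<Rightarrow> 'a \<Rightarrow> ('k \<Rightarrow> 'b::ring \<Rightarrow> 'b) \<Rightarrow> ('a \<Rightarrow> 'e \<Rightarrow> 'b)
    \<Rightarrow> 'e \<Rightarrow> ('b list \<Rightarrow> 'b) \<Rightarrow> 'b list \<Rightarrow> 'b" where
  "cochain_act H uA sB sm w f = (\<lambda>bs.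
     \<Sum>(u, v)\<in>#comult H w. adj H uA sm (eval_diag H uA sB sm bs f (inv (antipode H) v)) u)"

text \<open>The braided differential; \<open>R\<close> is the basis \<open>{r\<^sub>j}\<close> of \<open>E\<close>, with dual basis the coordinate
  functions.\<close>

definition braided_d ::
  "('k::field, 'e::ring) hopf \<Rightarrow> 'e set \<Rightarrow> 'a \<Rightarrow> ('k \<Rightarrow> 'b::ring \<Rightarrow> 'b) \<Rightarrow> ('a \<Rightarrow> 'e \<Rightarrow> 'b)
    \<Rightarrow> nat \<Rightarrow> ('b list \<Rightarrow> 'b) \<Rightarrow> 'b list \<Rightarrow> 'b" where
  "braided_d H R uA sB sm n f = (\<lambda>bs. if length bs = n + 1
     then ksign (n + 1)
       ((\<Sum>r\<in>R. dual_act H sB sm (\<lambda>x. module.representation (hscale H) R x r) (hd bs)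
                 * cochain_act H uA sB sm r f (tl bs))
        + hochschild_tail n f bs)
     else 0)"

definition invariant_cochains ::
  "('k::field, 'e::ring) hopf \<Rightarrow> 'a \<Rightarrow> ('k \<Rightarrow> 'b::ring \<Rightarrow> 'b) \<Rightarrow> 'b \<Rightarrow> ('a \<Rightarrow> 'e \<Rightarrow> 'b)
    \<Rightarrow> nat \<Rightarrow> ('b list \<Rightarrow> 'b) set" where
  "invariant_cochains H uA sB uB sm n =
     {f \<in> normalized_cochains sB uB n.
        \<forall>w. cochain_act H uA sB sm w f = fscale sB (counit H w) f}"

text \<open>\<open>L(B; E)\<close>: the braided differential on invariant cochains, with the bracket
  of \<open>L(B)\<close>.\<close>

definition L_invariant ::
  "('k::field, 'e::ring) hopf \<Rightarrow> 'e set \<Rightarrow> 'a \<Rightarrow> ('k \<Rightarrow> 'b::ring \<Rightarrow> 'b) \<Rightarrow> 'b \<Rightarrow> ('a \<Rightarrow> 'e \<Rightarrow> 'b)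
    \<Rightarrow> ('b list \<Rightarrow> 'b) dgl" where
  "L_invariant H R uA sB uB sm =
     shifted_dgl (invariant_cochains H uA sB uB sm) (braided_d H R uA sB sm)"

end

theory Submission
  imports Defs
begin

text \<open>
  Let \<open>t\<close> be a two-sided integral of \<open>E\<close> with \<open>\<epsilon>(t) = 1\<close>, so that \<open>S(t\<^sub>1) \<otimes> t\<^sub>2\<close> is a separability idempotent of \<open>E\<close>.
  Inserting it into the arguments of a cochain, one slot after the other, deforms the normalized Hochschild
  complex of \<open>B\<close> onto the subcomplex of \<open>E\<close>-relative cochains. Relative cochains are linear for the adjoint action, so the
  deformation takes place inside the invariant complex as soon as the idempotent is itself invariant under the adjoint action.
  This follows from \<open>S\<^sup>4 = 1\<close>, which holds because \<open>E\<close> and its dual have normalized two-sided integrals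
  (for the dual, by cosemisimplicity).
\<close>

section \<open>Multiadditive maps and insertion\<close>

text \<open>The relative cochains lie in both complexes, and one homotopy serves both. The
  projection makes any cochain relative, hence invariant, which gives surjectivity on cohomology;
  injectivity also uses that the homotopy preserves invariance. Why the fourth power: the
  two-sidedness of \<open>t\<close> gives \<open>w S(t\<^sub>1) \<otimes> t\<^sub>2 = S(t\<^sub>1)
  \<otimes> t\<^sub>2 w\<close> and \<open>S(t\<^sub>1) S\<^sup>2(w) \<otimes> t\<^sub>2 =
  S(t\<^sub>1) \<otimes> w t\<^sub>2\<close>. The adjoint action puts \<open>w\<^sub>1\<close> and
  \<open>S(w\<^sub>2)\<close> between the two factors, where they meet as
  \<open>S(w\<^sub>2)\<close> times the inverse of \<open>S\<^sup>2\<close> at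
  \<open>w\<^sub>1\<close>. This collapses if \<open>S\<^sup>2\<close> is its own inverse. The
  identity is the unimodular case of Radford's formula, obtained here from the Frobenius form
  \<open>l(x y)\<close> of a cointegral \<open>l\<close>. Cochains are functions on lists of all
  lengths and the differential is used without its overall sign, which keeps arities out of the
  homotopy formulas. The price is truncated subtraction near arity 0, the source of most degenerate
  cases below.\<close>

lemma ksign_simps [simp]:
  "ksign p (0::'x::ab_group_add) = 0"
  "ksign p (x + y) = ksign p x + ksign p (y::'x)"
  "ksign p (- x) = - ksign p (x::'x)"
  "ksign p (x - y) = ksign p x - ksign p (y::'x)"
  by (auto simp: ksign_def)

lemma ksign_sum: "ksign p (sum f A) = (\<Sum>x\<in>A. ksign p (f x))"
  by (auto simp: ksign_def sum_negf)

lemma ksign_ksign [simp]: "ksign p (ksign q x) = ksign (p + q) x"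
  by (auto simp: ksign_def)

lemma ksign_cong: "even p = even q \<Longrightarrow> ksign p x = ksign q x"
  by (auto simp: ksign_def)

lemma ksign_fun: "ksign p f x = ksign p (f x)"
  by (auto simp: ksign_def)

text \<open>No bound on lengths: for a cochain both sides are 0 off its arity, so the property
  survives fixing leading entries. Scalars are split off into \<open>mscale\<close> because the sign
  calculus needs additivity only.\<close>

definition madd :: "('b::ab_group_add list \<Rightarrow> 'c::ab_group_add) \<Rightarrow> bool" where
  "madd f \<longleftrightarrow> (\<forall>us vs x y. f (us @ (x + y) # vs) = f (us @ x # vs) + f (us @ y # vs))"

definition arity :: "nat \<Rightarrow> ('b list \<Rightarrow> 'c::zero) \<Rightarrow> bool" where
  "arity n f \<longleftrightarrow> (\<forall>bs. length bs \<noteq> n \<longrightarrow> f bs = 0)"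

lemma madd_add: "madd f \<Longrightarrow> f (us @ (x + y) # vs) = f (us @ x # vs) + f (us @ y # vs)"
  by (simp add: madd_def)

lemma madd_zero: "madd f \<Longrightarrow> f (us @ 0 # vs) = 0"
  using madd_add[of f us 0 0 vs] by simp

lemma madd_minus: "madd f \<Longrightarrow> f (us @ (- x) # vs) = - f (us @ x # vs)"
  using madd_add[of f us x "- x" vs] by (simp add: madd_zero eq_neg_iff_add_eq_0 add.commute)

lemma madd_diff: "madd f \<Longrightarrow> f (us @ (x - y) # vs) = f (us @ x # vs) - f (us @ y # vs)"
  using madd_add[of f us x "- y" vs] by (simp add: madd_minus)

lemma madd_ksign: "madd f \<Longrightarrow> f (us @ ksign p x # vs) = ksign p (f (us @ x # vs))"
  by (simp add: ksign_def madd_minus)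

lemmas madd_hd = madd_add[where us = "[]", simplified] madd_zero[where us = "[]", simplified]
  madd_minus[where us = "[]", simplified] madd_diff[where us = "[]", simplified]
  madd_ksign[where us = "[]", simplified]

lemma madd_append: "madd f \<Longrightarrow> madd (\<lambda>cs. f (us @ cs))"
  unfolding madd_def by (metis append_assoc)

lemma madd_Cons: "madd f \<Longrightarrow> madd (\<lambda>cs. f (b # cs))"
  using madd_append[of f "[b]"] by simp

lemma arity_Cons: "arity (Suc n) f \<Longrightarrow> arity n (\<lambda>cs. f (b # cs))"
  by (simp add: arity_def)

lemma arity_eq_0: "arity n f \<Longrightarrow> length bs \<noteq> n \<Longrightarrow> f bs = 0"
  by (simp add: arity_def)

text \<open>The sum of the terms \<open>(-1)\<^bsup>i(n-1)\<^esup> f(b\<^sub>1, \<dots>, b\<^sub>i, g(b\<^bsub>i+1\<^esub>, \<dots>, b\<^bsub>i+n\<^esub>), \<dots>)\<close>. It is the action on \<open>f\<close> of the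
  coderivation of the bar construction that \<open>g\<close> defines. If \<open>g\<close> has arity \<open>n\<close> and \<open>f\<close> is multiadditive,
  the terms in which fewer than \<open>n\<close> entries are left for \<open>g\<close> vanish.\<close>

primrec ins :: "nat \<Rightarrow> ('b list \<Rightarrow> 'b) \<Rightarrow> ('b list \<Rightarrow> 'c::ab_group_add) \<Rightarrow> 'b list \<Rightarrow> 'c" where
  "ins n g f [] = f [g []]"
| "ins n g f (b # bs) =
     f (g (take n (b # bs)) # drop n (b # bs)) + ksign (n + 1) (ins n g (\<lambda>cs. f (b # cs)) bs)"

lemma ins_sum:
  "ins n g f bs = (\<Sum>i\<le>length bs. ksign (i * (n + 1)) (f (take i bs @ g (take n (drop i bs)) # drop (i + n) bs)))"
proof (induction bs arbitrary: f)
  case Nil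
  then show ?case by (simp add: ksign_def)
next
  case (Cons b bs)
  show ?case
    unfolding ins.simps Cons.IH list.size add_0_right add_Suc_right sum.atMost_Suc_shift ksign_sum
    by (intro arg_cong2[where f = "(+)"] sum.cong refl) (auto simp: ksign_def)
qed

lemma ins_add: "ins n g (\<lambda>cs. f cs + f' cs) bs = ins n g f bs + ins n g f' bs"
  by (induction bs arbitrary: f f') auto

lemma ins_zero: "ins n g (\<lambda>cs. 0) bs = 0"
  by (induction bs) auto

lemma ins_ksign: "ins n g (\<lambda>cs. ksign (p::nat) (f cs)) bs = ksign p (ins n g f bs)"
  by (induction bs arbitrary: f) (auto simp: add.commute)

lemma ins_diff: "ins n g (\<lambda>cs. f cs - f' cs) bs = ins n g f bs - ins n g f' bs"
  by (induction bs arbitrary: f f') auto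

lemma ins_add_left: "madd f \<Longrightarrow> ins n (\<lambda>cs. g cs + g' cs) f bs = ins n g f bs + ins n g' f bs"
  by (induction bs arbitrary: f) (auto simp: madd_hd madd_Cons)

lemma ins_zero_left: "madd f \<Longrightarrow> ins n (\<lambda>cs. 0) f bs = 0"
  by (induction bs arbitrary: f) (auto simp: madd_hd madd_Cons)

lemma ins_minus_left: "madd f \<Longrightarrow> ins n (\<lambda>cs. - g cs) f bs = - ins n g f bs"
  by (induction bs arbitrary: f) (auto simp: madd_hd madd_Cons)

lemma ins_diff_left: "madd f \<Longrightarrow> ins n (\<lambda>cs. g cs - g' cs) f bs = ins n g f bs - ins n g' f bs"
  by (induction bs arbitrary: f) (auto simp: madd_hd madd_Cons)

lemma ins_ksign_left: "madd f \<Longrightarrow> ins n (\<lambda>cs. ksign p (g cs)) f bs = ksign p (ins n g f bs)"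
  by (simp add: ksign_def ins_minus_left)

lemma arity_0_ins: "arity 0 f \<Longrightarrow> ins n g f bs = 0"
  by (simp add: ins_sum arity_def)

lemma arity_ins:
  assumes "arity m f" "arity n g" "madd f"
  shows "arity (m + n - 1) (ins n g f)"
  unfolding arity_def
proof (intro allI impI)
  fix bs :: "'a list" assume l: "length bs \<noteq> m + n - 1"
  have "f (take i bs @ g (take n (drop i bs)) # drop (i + n) bs) = 0" if "i \<le> length bs" for i
  proof (cases "i + n \<le> length bs")
    case True
    then have "length (take i bs @ g (take n (drop i bs)) # drop (i + n) bs) \<noteq> m"
      using l by simp
    then show ?thesis using assms(1) by (rule_tac arity_eq_0)
  next
    case False
    then have "g (take n (drop i bs)) = 0"
      using that by (intro arity_eq_0[OF assms(2)]) auto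
    then show ?thesis using assms(3) by (simp add: madd_zero)
  qed
  then show "ins n g f bs = 0" by (simp add: ins_sum)
qed

text \<open>A slot is either among the first \<open>n\<close>, where additivity of \<open>g\<close>
  and then of the first slot of \<open>f\<close> applies, or it survives \<open>drop n\<close> as a
  slot of \<open>f\<close> itself.\<close>

lemma madd_ins_arg:
  assumes "madd f" "madd g"
  shows "f (g (take n (us @ (x + y) # vs)) # drop n (us @ (x + y) # vs))
    = f (g (take n (us @ x # vs)) # drop n (us @ x # vs))
      + f (g (take n (us @ y # vs)) # drop n (us @ y # vs))"
proof (cases "n \<le> length us")
  case True
  then show ?thesis
    using madd_add[OF assms(1), of "g (take n us) # drop n us"] by simp
next
  case False
  then obtain k where "n - length us = Suc k" by (cases "n - length us") auto
  then show ?thesis using False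
    by (simp add: madd_add[OF assms(2)] madd_hd[OF assms(1)])
qed

lemma madd_ins:
  assumes "madd f" "madd g"
  shows "madd (ins n g f)"
proof -
  have "ins n g f (us @ (x + y) # vs) = ins n g f (us @ x # vs) + ins n g f (us @ y # vs)" for us x y vs
    using assms(1)
  proof (induction us arbitrary: f)
    case Nil
    have "ins n g (\<lambda>cs. f ((x + y) # cs)) vs
        = ins n g (\<lambda>cs. f (x # cs)) vs + ins n g (\<lambda>cs. f (y # cs)) vs"
      unfolding ins_add[symmetric] by (simp add: madd_hd[OF Nil])
    then show ?case
      using madd_ins_arg[OF Nil assms(2), of n "[]" x y vs] by (simp add: algebra_simps)
  next
    case (Cons a us)
    show ?case
      using madd_ins_arg[OF Cons.prems assms(2), of n "a # us" x y vs]
        Cons.IH[OF madd_Cons[OF Cons.prems], of a]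
      by (simp add: algebra_simps)
  qed
  then show ?thesis by (simp add: madd_def)
qed

text \<open>\<open>h\<close> may land inside the block that feeds \<open>g\<close>, which assembles
  to an insertion into \<open>g\<close> with a block of \<open>m + l - 1\<close> entries, or behind
  it, which costs the sign of passing \<open>m\<close> entries. For \<open>m = 0\<close> the
  truncation does no harm: nothing can be inserted into \<open>g\<close>.\<close>

lemma ins_split:
  assumes "madd f" "arity m g"
  shows "ins l h (\<lambda>cs. f (g (take m cs) # drop m cs)) bs
    = f (ins l h g (take (m + l - 1) bs) # drop (m + l - 1) bs)
      + ksign (m * (l + 1)) (ins l h (\<lambda>cs. f (g (take m bs) # cs)) (drop m bs))"
  using assms(2)
proof (induction m arbitrary: g bs)
  case 0
  then show ?case by (simp add: arity_0_ins madd_hd[OF assms(1)] ksign_def)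
next
  case (Suc m)
  show ?case
  proof (cases bs)
    case Nil
    then show ?thesis using Suc.prems by (simp add: arity_eq_0 madd_hd[OF assms(1)])
  next
    case bs: (Cons b bs')
    note IH = Suc.IH[OF arity_Cons[OF Suc.prems, of b], of bs']
    show ?thesis
    proof (cases "m + l")
      \<comment> \<open>Here \<open>m = l = 0\<close>. The block length of the induction hypothesis
        is truncated, so the vanishing of insertions into a map of arity 0 takes its place.\<close>
      case 0
      then have "arity 0 (\<lambda>cs. g (b # cs))" using arity_Cons[OF Suc.prems] by simp
      then show ?thesis using IH 0 bs
        by (simp add: arity_0_ins madd_hd[OF assms(1)] ksign_def)
    next
      case (Suc N)
      have 1: "take l (b # take N bs') = take l (b # bs')"
        using Suc by (metis le_add2 min.absorb1 take_Suc_Cons take_take)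
      have 2: "drop l (b # take N bs') = take m (drop l (b # bs'))"
        using Suc by (metis add.commute drop_take add_diff_cancel_right' take_Suc_Cons)
      have 3: "drop m (drop l (b # bs')) = drop N bs'"
        using Suc by (simp add: add.commute)
      show ?thesis unfolding bs using IH Suc 1 2 3
        by (simp add: madd_hd[OF assms(1)] drop_drop[symmetric] add_ac del: drop_drop)
    qed
  qed
qed

text \<open>Sorts the placements by what occupies the front: \<open>g\<close> with \<open>h\<close>
  inside it, \<open>g\<close> with \<open>h\<close> behind it, \<open>h\<close> with
  \<open>g\<close> behind it, or the entry \<open>b\<close> alone. The middle two are exchanged, up
  to sign, when \<open>g\<close> and \<open>h\<close> swap roles.\<close>

lemma ins_ins_Cons:
  assumes "madd f" "arity n g"
  shows "ins l h (ins n g f) (b # bs)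
    = f (ins l h g (take (n + l - 1) (b # bs)) # drop (n + l - 1) (b # bs))
      + ksign (n * (l + 1)) (ins l h (\<lambda>cs. f (g (take n (b # bs)) # cs)) (drop n (b # bs)))
      + ksign (n + 1) (ins n g (\<lambda>cs. f (h (take l (b # bs)) # cs)) (drop l (b # bs)))
      + ksign (n + l) (ins l h (ins n g (\<lambda>cs. f (b # cs))) bs)"
proof -
  have "ins l h (ins n g f) (b # bs)
    = ins l h (\<lambda>cs. f (g (take n cs) # drop n cs)) (b # bs)
      + ksign (n + 1) (ins n g (\<lambda>cs. f (h (take l (b # bs)) # cs)) (drop l (b # bs)))
      + ksign (n + l) (ins l h (ins n g (\<lambda>cs. f (b # cs))) bs)"
    by (simp add: ins_add ins_ksign) (simp add: ksign_def)
  then show ?thesis by (simp only: ins_split[OF assms])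
qed

lemma ins_ins_Nil:
  assumes "madd f" "arity n g"
  shows "ins l h (ins n g f) []
    = f [ins l h g []]
      + ksign (n * (l + 1)) (ins l h (\<lambda>cs. f (g [] # cs)) [])
      + ksign (n + 1) (ins n g (\<lambda>cs. f (h [] # cs)) [])"
  using ins_split[OF assms, of l h "[]"] by simp

text \<open>The pre-Lie identity: both sides are the sum of the terms in which \<open>g\<close> and \<open>h\<close> are inserted into
  \<open>f\<close> side by side.\<close>

lemma ins_prelie:
  assumes "madd f" "madd g" "madd h" "arity n g" "arity l h"
  shows "ins l h (ins n g f) bs - ins (n + l - 1) (ins l h g) f bs
    = ksign ((n + 1) * (l + 1)) (ins n g (ins l h f) bs - ins (n + l - 1) (ins n g h) f bs)"
  using assms(1)
proof (induction bs arbitrary: f)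
  case Nil
  show ?case unfolding ins_ins_Nil[OF Nil assms(4)] ins_ins_Nil[OF Nil assms(5)]
    by (cases "even n"; cases "even l") (simp_all add: ksign_def algebra_simps)
next
  case (Cons b bs)
  have zero: "ins l h g = (\<lambda>_. 0)" "ins n g h = (\<lambda>_. 0)" if "n + l = 0"
    using that assms(4,5) by (auto simp: fun_eq_iff arity_0_ins)
  \<comment> \<open>Truncation: \<open>n + l - 1 + 1\<close> differs from \<open>n + l\<close> only
    for \<open>n = l = 0\<close>, and then both insertions are identically 0.\<close>
  have sgn: "ins (n + l - 1) k f (b # bs)
      = f (k (take (n + l - 1) (b # bs)) # drop (n + l - 1) (b # bs))
        + ksign (n + l) (ins (n + l - 1) k (\<lambda>cs. f (b # cs)) bs)"
    if "k \<in> {ins l h g, ins n g h}" for k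
    using that zero by (cases "n + l") (auto simp: ins_zero_left madd_Cons[OF Cons.prems])
  note s1 = sgn[of "ins l h g", OF insertI1] and s2 = sgn[of "ins n g h", OF insertI2[OF insertI1]]
  note IH = Cons.IH[OF madd_Cons[OF Cons.prems], of b]
  show ?case
    unfolding ins_ins_Cons[OF Cons.prems assms(4)] ins_ins_Cons[OF Cons.prems assms(5)]
      add.commute[of l n] s1 s2
    using IH unfolding ksign_def by (cases "even n"; cases "even l") (simp_all add: algebra_simps del: ins.simps)
qed

section \<open>The Gerstenhaber bracket and its Jacobi identity\<close>

lemma circle_eq_ins:
  assumes "arity m f" "arity n g" "madd f"
  shows "circle m n f g = ins n g f"
proof
  fix bs :: "'a list"
  show "circle m n f g bs = ins n g f bs"
  proof (cases "length bs + 1 = m + n")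
    case False
    have "ins n g f bs = 0"
    proof (cases "m + n")
      case 0
      then show ?thesis using assms by (simp add: arity_0_ins)
    next
      case (Suc k)
      then show ?thesis using False by (intro arity_eq_0[OF arity_ins[OF assms]]) auto
    qed
    then show ?thesis using False by (simp add: circle_def)
  next
    case True
    let ?t = "\<lambda>i. f (take i bs @ g (take n (drop i bs)) # drop (i + n) bs)"
    \<comment> \<open>From position \<open>m\<close> on fewer than \<open>n\<close> entries remain
      for \<open>g\<close>, so the longer sum of \<open>ins\<close> adds only zeros.\<close>
    have 0: "?t i = 0" if "m \<le> i" "i \<le> length bs" for i
    proof -
      have "g (take n (drop i bs)) = 0"
        using that True by (intro arity_eq_0[OF assms(2)]) auto
      then show ?thesis using assms(3) by (simp add: madd_zero)
    qed
    have 1: "?t i = 0" if "i < m" "\<not> i \<le> length bs" for i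
      using that True by (intro arity_eq_0[OF assms(1)]) auto
    have "circle m n f g bs = (\<Sum>i<m. ksign (i * (n + 1)) (?t i))"
      using True by (auto simp: circle_def intro!: sum.cong ksign_cong)
    also have "\<dots> = (\<Sum>i\<le>length bs. ksign (i * (n + 1)) (?t i))"
      using 0 1 by (intro sum.mono_neutral_cong) auto
    finally show ?thesis by (simp add: ins_sum)
  qed
qed

lemma gerstenhaber_bracket_eq_ins:
  assumes "arity m f" "arity n g" "madd f" "madd g"
  shows "gerstenhaber_bracket m n f g
    = (\<lambda>bs. ins n g f bs - ksign ((m + 1) * (n + 1)) (ins m f g bs))"
  unfolding gerstenhaber_bracket_def circle_eq_ins[OF assms(1,2,3)] circle_eq_ins[OF assms(2,1,4)]
  by (auto simp: fun_eq_iff ksign_fun intro!: ksign_cong)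

text \<open>The three double brackets expand into twelve nested insertions, which cancel by the
  pre-Lie identity taken once with each of \<open>f\<close>, \<open>g\<close>, \<open>h\<close> as
  the outermost map.\<close>

lemma gerstenhaber_jacobi:
  fixes f g h :: "'b::ring list \<Rightarrow> 'b"
  assumes f: "arity m f" "madd f" and g: "arity n g" "madd g" and h: "arity l h" "madd h"
  defines "br \<equiv> \<lambda>m n f g bs. ins n g f bs - ksign ((m + 1) * (n + 1)) (ins m f g bs)"
  shows "br m (n + l - 1) f (br n l g h) bs
    = br (m + n - 1) l (br m n f g) h bs + ksign ((m + 1) * (n + 1)) (br n (m + l - 1) g (br m l f h) bs)"
proof -
  have br: "br m n f g bs = ins n g f bs - ksign ((m + 1) * (n + 1)) (ins m f g bs)" for m n f g bs
    by (simp add: br_def)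
  have br': "br m n f g = (\<lambda>bs. ins n g f bs - ksign ((m + 1) * (n + 1)) (ins m f g bs))" for m n f g
    by (simp add: br_def)
  \<comment> \<open>The arity of an inner bracket is truncated at 0; the sign rule can fail only for
    two maps of arity 0, whose bracket is 0.\<close>
  have sgn: "ksign (a * (b + c - 1 + 1)) x = ksign (a * (b + c)) x"
    "ksign ((b + c - 1 + 1) * a) x = ksign (a * (b + c)) x" if "b + c = 0 \<Longrightarrow> x = 0"
    for a b c :: nat and x :: 'b
    using that by (cases "b + c"; auto simp: mult.commute)+
  have br0: "br m n f g = (\<lambda>bs. 0)" if "arity m f" "arity n g" "m + n = 0" for m n and f g :: "'b list \<Rightarrow> 'b"
    using that by (auto simp: br_def fun_eq_iff arity_0_ins)
  have e1: "br m (n + l - 1) f (br n l g h) bs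
      = ins (n + l - 1) (ins l h g) f bs - ksign ((n + 1) * (l + 1)) (ins (n + l - 1) (ins n g h) f bs)
      - ksign ((m + 1) * (n + l)) (ins m f (ins l h g) bs - ksign ((n + 1) * (l + 1)) (ins m f (ins n g h) bs))"
    if f: "arity m f" "madd f" and g: "arity n g" "madd g" and h: "arity l h" "madd h"
    for m n l and f g h :: "'b list \<Rightarrow> 'b"
  proof -
    have "br m (n + l - 1) f (br n l g h) bs
      = ins (n + l - 1) (br n l g h) f bs - ksign ((m + 1) * (n + l)) (ins m f (br n l g h) bs)"
      unfolding br[of m "n + l - 1"] using br0[OF g(1) h(1)]
      by (subst sgn) (auto simp: ins_zero)
    then show ?thesis
      unfolding br'[of n l] ins_diff_left[OF f(2)] ins_ksign_left[OF f(2)] ins_diff ins_ksign .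
  qed
  have e2: "br (m + n - 1) l (br m n f g) h bs
      = ins l h (ins n g f) bs - ksign ((m + 1) * (n + 1)) (ins l h (ins m f g) bs)
      - ksign ((m + n) * (l + 1)) (ins (m + n - 1) (ins n g f) h bs
          - ksign ((m + 1) * (n + 1)) (ins (m + n - 1) (ins m f g) h bs))"
  proof -
    have "br (m + n - 1) l (br m n f g) h bs
      = ins l h (br m n f g) bs - ksign ((m + n) * (l + 1)) (ins (m + n - 1) (br m n f g) h bs)"
      unfolding br[of "m + n - 1" l] using br0[OF f(1) g(1)]
      by (subst sgn) (auto simp: ins_zero_left h mult.commute)
    then show ?thesis
      unfolding br'[of m n] ins_diff_left[OF h(2)] ins_ksign_left[OF h(2)] ins_diff ins_ksign .
  qed
  note p1 = ins_prelie[OF f(2) g(2) h(2) g(1) h(1), of bs]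
  note p2 = ins_prelie[OF g(2) f(2) h(2) f(1) h(1), of bs]
  note p3 = ins_prelie[OF h(2) f(2) g(2) f(1) g(1), of bs]
  show ?thesis
    unfolding e1[OF f g h] e1[OF g f h] e2 p1[unfolded diff_eq_eq] p2[unfolded diff_eq_eq] p3[unfolded diff_eq_eq]
    unfolding ksign_def
    by (cases "even m"; cases "even n"; cases "even l") (simp_all add: algebra_simps)
qed

lemma bracket_closed:
  assumes "arity m f" "arity n g" "madd f" "madd g"
  shows "arity (m + n - 1) (gerstenhaber_bracket m n f g)" "madd (gerstenhaber_bracket m n f g)"
proof -
  have "arity (m + n - 1) (ins n g f)" "arity (m + n - 1) (ins m f g)"
    using arity_ins[OF assms(1,2,3)] arity_ins[OF assms(2,1,4)] by (simp_all add: add.commute)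
  then show "arity (m + n - 1) (gerstenhaber_bracket m n f g)"
    unfolding gerstenhaber_bracket_eq_ins[OF assms] by (simp add: arity_def)
  show "madd (gerstenhaber_bracket m n f g)"
    using madd_ins[OF assms(3,4), of n] madd_ins[OF assms(4,3), of m]
    unfolding gerstenhaber_bracket_eq_ins[OF assms] by (simp add: madd_def)
qed

lemma bracket_jacobi:
  assumes f: "arity m f" "madd f" and g: "arity n g" "madd g" and h: "arity l h" "madd h"
  shows "gerstenhaber_bracket m (n + l - 1) f (gerstenhaber_bracket n l g h)
    = gerstenhaber_bracket (m + n - 1) l (gerstenhaber_bracket m n f g) h
      + ksign ((m + 1) * (n + 1)) (gerstenhaber_bracket n (m + l - 1) g (gerstenhaber_bracket m l f h))"
proof -
  note eq = gerstenhaber_bracket_eq_ins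
  note fg = bracket_closed[OF f(1) g(1) f(2) g(2)] and gh = bracket_closed[OF g(1) h(1) g(2) h(2)]
    and fh = bracket_closed[OF f(1) h(1) f(2) h(2)]
  show ?thesis
    using gerstenhaber_jacobi[OF assms]
    unfolding eq[OF f(1) gh(1) f(2) gh(2)] eq[OF fg(1) h(1) fg(2) h(2)] eq[OF g(1) fh(1) g(2) fh(2)]
    unfolding eq[OF f(1) g(1) f(2) g(2)] eq[OF g(1) h(1) g(2) h(2)] eq[OF f(1) h(1) f(2) h(2)]
    by (simp only: fun_eq_iff plus_fun_apply ksign_fun) simp
qed

section \<open>The Hochschild differential\<close>

text \<open>The recursion flips the sign at each passed entry, so neither positions nor arities
  occur; on lists of the right length it gives \<open>hochschild_tail\<close>.\<close>

fun d_tail :: "('b::ring list \<Rightarrow> 'b) \<Rightarrow> 'b list \<Rightarrow> 'b" where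
  "d_tail f [] = 0"
| "d_tail f [b] = - (f [] * b)"
| "d_tail f (b # c # bs) = - f ((b * c) # bs) - d_tail (\<lambda>cs. f (b # cs)) (c # bs)"

text \<open>The Hochschild differential without the overall sign \<open>(-1)\<^bsup>n+1\<^esup>\<close>, on cochains of all arities at once.\<close>

fun delta :: "('b::ring list \<Rightarrow> 'b) \<Rightarrow> 'b list \<Rightarrow> 'b" where
  "delta f [] = 0"
| "delta f (b # bs) = b * f bs + d_tail f (b # bs)"

lemma d_tail_add: "d_tail (\<lambda>cs. f cs + g cs) bs = d_tail f bs + d_tail g bs"
proof (induction f bs arbitrary: g rule: d_tail.induct)
  case (3 f b c bs)
  show ?case using 3[of "\<lambda>cs. g (b # cs)"] by simp
qed (simp_all add: algebra_simps)

lemma d_tail_minus: "d_tail (\<lambda>cs. - f cs) bs = - d_tail f bs"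
proof (induction f bs rule: d_tail.induct)
  case (3 f b c bs)
  show ?case using 3 by simp
qed (simp_all add: algebra_simps)

lemma d_tail_zero: "d_tail (\<lambda>cs. 0) bs = 0"
  using d_tail_minus[of "\<lambda>cs. 0" bs] d_tail_add[of "\<lambda>cs. 0" "\<lambda>cs. 0" bs] by simp

lemma delta_add: "delta (\<lambda>cs. f cs + g cs) bs = delta f bs + delta g bs"
  by (cases bs) (simp_all add: d_tail_add algebra_simps)

lemma delta_minus: "delta (\<lambda>cs. - f cs) bs = - delta f bs"
  by (cases bs) (simp_all add: d_tail_minus algebra_simps)

lemma delta_diff: "delta (\<lambda>cs. f cs - g cs) bs = delta f bs - delta g bs"
  using delta_add[of f "\<lambda>cs. - g cs" bs] by (simp add: delta_minus)

lemma delta_zero: "delta (\<lambda>cs. 0) bs = 0"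
  by (cases bs) (simp_all add: d_tail_zero)

lemma delta_ksign: "delta (\<lambda>cs. ksign p (f cs)) bs = ksign p (delta f bs)"
  by (simp add: ksign_def delta_minus)

lemma d_tail_lmult: "d_tail (\<lambda>cs. a * f cs) bs = a * d_tail f bs"
proof (induction f bs rule: d_tail.induct)
  case (3 f b c bs)
  show ?case using 3 by (simp add: algebra_simps)
qed (simp_all add: algebra_simps)

lemma d_tail_left_action:
  "d_tail (\<lambda>cs. case cs of [] \<Rightarrow> 0 | b # cs' \<Rightarrow> b * f cs') (b # bs) = - (b * delta f bs)"
  by (cases bs) (simp_all add: d_tail_lmult algebra_simps)

lemma d_tail_merge:
  "d_tail (\<lambda>cs. case cs of [] \<Rightarrow> f [] * b | c # cs' \<Rightarrow> f ((b * c) # cs')) (c # bs)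
    = d_tail f ((b * c) # bs)"
  by (cases bs) (simp_all add: mult.assoc)

text \<open>Induction on the first entry \<open>b\<close>: with \<open>b\<close> fixed, the tail
  splits into multiplying \<open>b\<close> into the next entry and the tail of the fixed map. The
  former contributes a tail at \<open>b * c\<close>, which cancels; the latter is covered by the
  induction hypothesis.\<close>

lemma d_tail_d_tail: "d_tail (d_tail f) bs = 0"
proof (induction f bs rule: d_tail.induct)
  case (3 f b c bs)
  let ?K = "\<lambda>cs. case cs of [] \<Rightarrow> f [] * b | c # cs' \<Rightarrow> f ((b * c) # cs')"
  have eq: "(\<lambda>cs. d_tail f (b # cs)) = (\<lambda>cs. - (?K cs + d_tail (\<lambda>cs. f (b # cs)) cs))"
    by (auto simp: fun_eq_iff split: list.split)
  show ?case
    unfolding d_tail.simps(3) eq d_tail_minus d_tail_add d_tail_merge 3 by simp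
qed simp_all

text \<open>Shown directly: the Jacobi identity for the multiplication yields only that twice the
  square is 0, which is empty in characteristic 2.\<close>

lemma delta_delta: "delta (delta f) bs = 0"
proof (cases bs)
  case (Cons b cs)
  have eq: "delta f = (\<lambda>cs. (case cs of [] \<Rightarrow> 0 | b # cs' \<Rightarrow> b * f cs') + d_tail f cs)"
    by (auto simp: fun_eq_iff split: list.split)
  have "d_tail (delta f) (b # cs) = - (b * delta f cs)"
    by (subst eq) (simp only: d_tail_add d_tail_left_action d_tail_d_tail add_0_right)
  then show ?thesis by (simp add: Cons)
qed simp

definition mult_cochain :: "'b::ring list \<Rightarrow> 'b" where
  "mult_cochain bs = (case bs of [a, b] \<Rightarrow> a * b | _ \<Rightarrow> 0)"

lemma mult_cochain_simps [simp]:
  "mult_cochain [] = 0" "mult_cochain [a] = 0" "mult_cochain [a, b] = a * b"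
  "mult_cochain (a # b # c # bs) = 0"
  by (simp_all add: mult_cochain_def)

lemma arity_mult_cochain: "arity 2 mult_cochain"
  by (auto simp: arity_def mult_cochain_def split: list.split)

lemma madd_mult_cochain: "madd mult_cochain"
  unfolding madd_def
proof (intro allI)
  fix us vs :: "'a list" and x y :: 'a
  show "mult_cochain (us @ (x + y) # vs) = mult_cochain (us @ x # vs) + mult_cochain (us @ y # vs)"
    by (auto simp: mult_cochain_def algebra_simps split: list.split)
      (auto simp: append_eq_Cons_conv algebra_simps)
qed

lemma ins_mult_cochain_Cons:
  "ins 2 mult_cochain f (b # c # bs) = f ((b * c) # bs) - ins 2 mult_cochain (\<lambda>cs. f (b # cs)) (c # bs)"
  unfolding ins.simps(2)[of _ _ _ b] by (simp add: ksign_def del: ins.simps)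

text \<open>Compares the tail with an insertion of the multiplication, so that properties of the
  differential come from those of \<open>ins\<close>. At the last entry \<open>mult_cochain\<close>
  sees one argument and gives 0; right multiplication by that entry is what remains.\<close>

lemma d_tail_eq_ins:
  assumes "madd f" "bs \<noteq> []"
  shows "d_tail f bs = ksign (length bs) (f (butlast bs) * last bs) - ins 2 mult_cochain f bs"
  using assms
proof (induction f bs rule: d_tail.induct)
  case (2 f b)
  then show ?case using madd_zero[OF 2(1), of "[b]" "[]"] by (simp add: madd_hd ksign_def)
next
  case (3 f b c bs)
  show ?case
    unfolding ins_mult_cochain_Cons d_tail.simps(3) 3(1)[OF madd_Cons[OF 3(2)] list.distinct(2)]
    by (cases "bs = []") (simp_all add: ksign_def algebra_simps del: ins.simps)
qed simp

lemma hochschild_tail_eq_d_tail: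
  assumes "arity n f" "madd f" "length bs = n + 1"
  shows "hochschild_tail n f bs = d_tail f bs"
proof -
  have bs: "bs \<noteq> []" "take n bs = butlast bs" "bs ! n = last bs"
    using assms(3) last_conv_nth[of bs] by (cases bs; simp add: butlast_conv_take)+
  have "(\<Sum>i=1..n. ksign i (f (take (i - 1) bs @ (bs ! (i - 1) * bs ! i) # drop (i + 1) bs)))
    = (\<Sum>i<n. ksign (Suc i) (f (take i bs @ (bs ! i * bs ! Suc i) # drop (i + 2) bs)))"
    by (rule sum.reindex_bij_witness[of _ Suc "\<lambda>i. i - 1"]) auto
  also have "\<dots> = - (\<Sum>i<n. ksign (int i * (int 2 - 1))
      (f (take i bs @ mult_cochain (take 2 (drop i bs)) # drop (i + 2) bs)))"
    unfolding sum_negf[symmetric]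
  proof (rule sum.cong[OF HOL.refl])
    fix i assume "i \<in> {..<n}"
    then have "take 2 (drop i bs) = [bs ! i, bs ! Suc i]"
      using assms(3) by (intro nth_equalityI) (auto simp: nth_Cons' less_2_cases_iff)
    then show "ksign (Suc i) (f (take i bs @ (bs ! i * bs ! Suc i) # drop (i + 2) bs))
      = - ksign (int i * (int 2 - 1)) (f (take i bs @ mult_cochain (take 2 (drop i bs)) # drop (i + 2) bs))"
      by (simp add: ksign_def)
  qed
  also have "\<dots> = - circle n 2 f mult_cochain bs"
    using assms(3) by (simp add: circle_def)
  finally show ?thesis
    unfolding hochschild_tail_def d_tail_eq_ins[OF assms(2) bs(1)]
      circle_eq_ins[OF assms(1) arity_mult_cochain assms(2)] bs(2,3) assms(3)
    by simp
qed

lemma arity_delta: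
  assumes "arity n f" "madd f"
  shows "arity (n + 1) (delta f)"
  unfolding arity_def
proof (intro allI impI)
  fix bs :: "'a list" assume l: "length bs \<noteq> n + 1"
  show "delta f bs = 0"
  proof (cases bs)
    case (Cons b cs)
    have "ins 2 mult_cochain f bs = 0"
      using l Cons by (intro arity_eq_0[OF arity_ins[OF assms(1) arity_mult_cochain assms(2)]]) auto
    moreover have "f (butlast bs) = 0"
      using l Cons by (intro arity_eq_0[OF assms(1)]) auto
    ultimately have "d_tail f bs = 0"
      using Cons by (simp add: d_tail_eq_ins[OF assms(2)] del: d_tail.simps ins.simps butlast.simps)
    then show ?thesis
      using l Cons arity_eq_0[OF assms(1), of cs] by simp
  qed simp
qed

lemma hochschild_d_eq_delta:
  assumes "arity n f" "madd f"
  shows "hochschild_d n f = (\<lambda>bs. ksign (n + 1) (delta f bs))"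
proof
  fix bs :: "'a list"
  show "hochschild_d n f bs = ksign (n + 1) (delta f bs)"
  proof (cases "length bs = n + 1")
    case True
    then obtain b cs where "bs = b # cs" by (cases bs) auto
    then show ?thesis
      using True hochschild_tail_eq_d_tail[OF assms True] by (simp add: hochschild_d_def)
  next
    case False
    then show ?thesis
      using arity_eq_0[OF arity_delta[OF assms]] by (auto simp: hochschild_d_def)
  qed
qed

text \<open>Through this identity the Leibniz rule becomes an instance of the Jacobi identity, and
  linearity and equivariance of the differential follow from those of the bracket.\<close>

lemma hochschild_d_eq_bracket:
  assumes "arity n f" "madd f"
  shows "hochschild_d n f = gerstenhaber_bracket 2 n mult_cochain f"
proof
  fix bs :: "'a list"
  note br = gerstenhaber_bracket_def circle_eq_ins[OF assms(1) arity_mult_cochain assms(2)]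
  show "hochschild_d n f bs = gerstenhaber_bracket 2 n mult_cochain f bs"
  proof (cases "length bs = n + 1")
    case True
    then obtain b cs where bs: "bs = b # cs" "length cs = n" by (cases bs) auto
    then have ne: "bs \<noteq> []" by simp
    have dr: "drop n (b # cs) = [last (b # cs)]" "take n (b # cs) = butlast (b # cs)"
      using bs(2) by (auto simp: butlast_conv_take last_conv_nth Cons_nth_drop_Suc[symmetric] simp del: drop_Suc_Cons)
    have "circle 2 n mult_cochain f bs = f (butlast bs) * last bs + ksign (n + 1) (b * f cs)"
      using bs by (simp add: circle_def lessThan_Suc numeral_2_eq_2[symmetric] lessThan_nat_numeral ksign_def dr)
    then show ?thesis
      unfolding hochschild_d_eq_delta[OF assms] br
      using bs True d_tail_eq_ins[OF assms(2) ne]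
      by (simp add: ksign_fun del: d_tail.simps) (simp add: ksign_def)
  next
    case False
    then show ?thesis
      unfolding hochschild_d_def gerstenhaber_bracket_def circle_def
      by (simp add: ksign_fun)
  qed
qed

section \<open>Linear cochains and the dg Lie axioms\<close>

definition mscale :: "('k \<Rightarrow> 'b \<Rightarrow> 'b) \<Rightarrow> ('b::ab_group_add list \<Rightarrow> 'b) \<Rightarrow> bool" where
  "mscale s f \<longleftrightarrow> (\<forall>us vs c x. f (us @ s c x # vs) = s c (f (us @ x # vs)))"

lemma (in vector_space) ksign_scale: "scale c (ksign p x) = ksign p (scale c x)"
  by (simp add: ksign_def)

lemma mem_cochains_iff:
  assumes "vector_space s"
  shows "f \<in> cochains s n \<longleftrightarrow> arity n f \<and> madd f \<and> mscale s f"
proof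
  interpret vector_space s by fact
  assume f: "f \<in> cochains s n"
  have ar: "arity n f" using f by (simp add: cochains_def arity_def)
  have lin: "f (us @ (x + y) # vs) = f (us @ x # vs) + f (us @ y # vs)
      \<and> f (us @ s c x # vs) = s c (f (us @ x # vs))" for us vs x y c
  proof (cases "length us + 1 + length vs = n")
    case True
    then show ?thesis using f by (simp add: cochains_def Vector_Spaces.linear_iff)
  next
    case False
    then show ?thesis
      by (simp add: arity_eq_0[OF ar])
  qed
  then show "arity n f \<and> madd f \<and> mscale s f"
    using ar by (simp add: madd_def mscale_def)
next
  assume "arity n f \<and> madd f \<and> mscale s f"
  then show "f \<in> cochains s n"
    using assms by (simp add: cochains_def arity_def madd_def mscale_def Vector_Spaces.linear_iff)
qed

context vector_space
begin

lemma ins_scale: "ins n g (\<lambda>cs. scale c (f cs)) bs = scale c (ins n g f bs)"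
  by (induction bs arbitrary: f) (simp_all add: scale_right_distrib ksign_scale)

lemma ins_scale_left:
  assumes "madd f" "mscale scale f"
  shows "ins n (\<lambda>cs. scale c (g cs)) f bs = scale c (ins n g f bs)"
proof -
  have hd: "f (scale c x # cs) = scale c (f (x # cs))" if "mscale scale f" for f :: "'b list \<Rightarrow> 'b" and x cs
    using that by (metis mscale_def append_Nil)
  have tl: "mscale scale (\<lambda>cs. f (b # cs))" if "mscale scale f" for f :: "'b list \<Rightarrow> 'b" and b
    using that unfolding mscale_def by (metis append_Cons)
  show ?thesis using assms(2)
    by (induction bs arbitrary: f) (simp_all add: hd tl scale_right_distrib ksign_scale)
qed

lemma mscale_ins:
  assumes "mscale scale f" "mscale scale g"
  shows "mscale scale (ins n g f)"
proof -
  have hd: "f (scale c x # cs) = scale c (f (x # cs))" if "mscale scale f" for f :: "'b list \<Rightarrow> 'b" and x c cs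
    using that by (metis mscale_def append_Nil)
  have tl: "mscale scale (\<lambda>cs. f (b # cs))" if "mscale scale f" for f :: "'b list \<Rightarrow> 'b" and b
    using that unfolding mscale_def by (metis append_Cons)
  have arg: "f (g (take n (us @ scale c x # vs)) # drop n (us @ scale c x # vs))
      = scale c (f (g (take n (us @ x # vs)) # drop n (us @ x # vs)))"
    if f: "mscale scale f" for f :: "'b list \<Rightarrow> 'b" and us vs c x
  proof (cases "n \<le> length us")
    case True
    then show ?thesis
      using f[unfolded mscale_def, rule_format, of "g (take n us) # drop n us"] by simp
  next
    case False
    then obtain k where "n - length us = Suc k" by (cases "n - length us") auto
    then show ?thesis using False assms(2)
      by (simp add: mscale_def hd[OF f])
  qed
  have "ins n g f (us @ scale c x # vs) = scale c (ins n g f (us @ x # vs))" for us x c vs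
    using assms(1)
  proof (induction us arbitrary: f)
    case Nil
    have "ins n g (\<lambda>cs. f (scale c x # cs)) vs = scale c (ins n g (\<lambda>cs. f (x # cs)) vs)"
      unfolding ins_scale[symmetric] by (simp add: hd[OF Nil])
    then show ?case
      using arg[OF Nil, of "[]" c x vs] by (simp add: scale_right_distrib ksign_scale)
  next
    case (Cons a us)
    show ?case
      using arg[OF Cons.prems, of "a # us" c x vs] Cons.IH[OF tl[OF Cons.prems], of a]
      by (simp add: scale_right_distrib ksign_scale)
  qed
  then show ?thesis by (simp add: mscale_def)
qed

end

lemma vector_space_fscale: "vector_space s \<Longrightarrow> vector_space (fscale s)"
  by (simp add: vector_space_def fscale_def fun_eq_iff)

lemma madd_lincomb:
  assumes "madd f" "madd g"
  shows "madd (\<lambda>bs. f bs + g bs)" "madd (\<lambda>bs. f bs - g bs)" "madd (\<lambda>bs. ksign p (f bs))"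
  using assms by (simp_all add: madd_def ksign_def)

context unital_algebra
begin

lemma cochainsD:
  assumes "f \<in> cochains scale n"
  shows "arity n f" "madd f" "mscale scale f"
  using assms by (simp_all add: mem_cochains_iff[OF vector_space_axioms])

lemma cochainsI: "arity n f \<Longrightarrow> madd f \<Longrightarrow> mscale scale f \<Longrightarrow> f \<in> cochains scale n"
  by (simp add: mem_cochains_iff[OF vector_space_axioms])

lemma bracket_eq_ins:
  assumes "f \<in> cochains scale m" "g \<in> cochains scale n"
  shows "gerstenhaber_bracket m n f g
    = (\<lambda>bs. ins n g f bs - ksign ((m + 1) * (n + 1)) (ins m f g bs))"
  using assms by (intro gerstenhaber_bracket_eq_ins cochainsD)

lemma ins_mem_cochains:
  assumes "f \<in> cochains scale m" "g \<in> cochains scale n"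
  shows "ins n g f \<in> cochains scale (m + n - 1)"
  by (intro cochainsI arity_ins madd_ins mscale_ins cochainsD[OF assms(1)] cochainsD[OF assms(2)])

lemma lincomb_mem_cochains:
  assumes "f \<in> cochains scale n" "g \<in> cochains scale n"
  shows "(\<lambda>bs. f bs + g bs) \<in> cochains scale n" "(\<lambda>bs. f bs - g bs) \<in> cochains scale n"
    "(\<lambda>bs. ksign p (f bs)) \<in> cochains scale n" "(\<lambda>bs. scale c (f bs)) \<in> cochains scale n"
    "(\<lambda>bs. 0) \<in> cochains scale n"
  using cochainsD[OF assms(1)] cochainsD[OF assms(2)]
  by (auto intro!: cochainsI madd_lincomb
      simp: arity_def mscale_def madd_def scale_right_distrib scale_right_diff_distrib ksign_scale mult.commute)

lemma bracket_mem_cochains: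
  assumes "f \<in> cochains scale m" "g \<in> cochains scale n"
  shows "gerstenhaber_bracket m n f g \<in> cochains scale (m + n - 1)"
  unfolding bracket_eq_ins[OF assms]
  using ins_mem_cochains[OF assms] ins_mem_cochains[OF assms(2,1)]
  by (intro lincomb_mem_cochains) (simp_all add: add.commute)

lemma mult_cochain_mem: "mult_cochain \<in> cochains scale 2"
proof (intro cochainsI arity_mult_cochain madd_mult_cochain)
  have "mult_cochain (us @ scale c x # vs) = scale c (mult_cochain (us @ x # vs))" for us c x vs
    by (auto simp: mult_cochain_def scale_mult_left scale_mult_right split: list.split)
      (auto simp: append_eq_Cons_conv scale_mult_left scale_mult_right)
  then show "mscale scale mult_cochain" by (simp add: mscale_def)
qed

lemma hochschild_d_mem_cochains:
  assumes "f \<in> cochains scale n"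
  shows "hochschild_d n f \<in> cochains scale (n + 1)"
  using bracket_mem_cochains[OF mult_cochain_mem assms]
  by (simp add: hochschild_d_eq_bracket cochainsD[OF assms])

lemma delta_mem_cochains:
  assumes "f \<in> cochains scale n"
  shows "delta f \<in> cochains scale (n + 1)"
proof -
  have "delta f = (\<lambda>bs. ksign (n + 1) (hochschild_d n f bs))"
    by (simp add: hochschild_d_eq_delta cochainsD[OF assms]) (simp add: ksign_def)
  then show ?thesis
    using lincomb_mem_cochains(3)[OF hochschild_d_mem_cochains[OF assms] hochschild_d_mem_cochains[OF assms]]
    by simp
qed

text \<open>Treats L(B) and L(B;E) at once: \<open>C\<close> is any family of subspaces closed under
  differential and bracket, and \<open>d\<close> only has to agree with the Hochschild differential
  on it, as the braided one does on invariants.\<close>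

lemma shifted_dgl_dg_lie:
  assumes sub: "\<And>n. module.subspace (fscale scale) (C n)" "\<And>n. C n \<subseteq> cochains scale n"
    and d: "\<And>n f. f \<in> C n \<Longrightarrow> d n f = hochschild_d n f"
      "\<And>n f. f \<in> C n \<Longrightarrow> hochschild_d n f \<in> C (n + 1)"
    and br: "\<And>m n f g. f \<in> C m \<Longrightarrow> g \<in> C n \<Longrightarrow> gerstenhaber_bracket m n f g \<in> C (m + n - 1)"
  shows "dg_lie_algebra (fscale scale) (shifted_dgl C d)"
proof -
  interpret F: vector_space "fscale scale"
    by (rule vector_space_fscale[OF vector_space_axioms])
  have fs: "fscale scale c f = (\<lambda>bs. scale c (f bs))" for c and f :: "'a list \<Rightarrow> 'a"
    by (simp add: fscale_def)
  have z: "0 = (\<lambda>bs. 0 :: 'a)" and p: "f + g = (\<lambda>bs. f bs + g bs)" for f g :: "'a list \<Rightarrow> 'a"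
    by (auto simp: fun_eq_iff)
  have 0: "0 \<in> C n" for n using sub(1)[of n] by (simp add: F.subspace_0)
  note cl = subsetD[OF sub(2)]
  let ?L = "shifted_dgl C d"
  have C: "f \<in> C (nat (p + 1))" "p < - 1 \<Longrightarrow> f = 0" if "f \<in> comp ?L p" for f p
    using that 0 by (auto simp: shifted_dgl_def split: if_splits)
  have I: "f \<in> comp ?L p" if "f \<in> C (nat (p + 1))" "p < - 1 \<Longrightarrow> f = 0" for f p
    using that by (auto simp: shifted_dgl_def)
  have D: "diff ?L p f = (\<lambda>bs. ksign (nat (p + 1) + 1) (delta f bs))" if "f \<in> comp ?L p" for p f
    using C(1)[OF that] cochainsD[OF cl[OF C(1)[OF that]]]
    by (simp add: shifted_dgl_def d(1) hochschild_d_eq_delta)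
  have D': "diff ?L p f = gerstenhaber_bracket 2 (nat (p + 1)) mult_cochain f" if "f \<in> comp ?L p" for p f
    using C(1)[OF that] cochainsD[OF cl[OF C(1)[OF that]]]
    by (simp add: shifted_dgl_def d(1) hochschild_d_eq_bracket)
  have bk: "brk ?L p q = gerstenhaber_bracket (nat (p + 1)) (nat (q + 1))" for p q
    by (simp add: shifted_dgl_def)
  have B: "brk ?L p q f g = (\<lambda>bs. ins (nat (q + 1)) g f bs
      - ksign ((nat (p + 1) + 1) * (nat (q + 1) + 1)) (ins (nat (p + 1)) f g bs))"
    if "f \<in> comp ?L p" "g \<in> comp ?L q" for p q f g
    using bracket_eq_ins[OF cl[OF C(1)[OF that(1)]] cl[OF C(1)[OF that(2)]]]
    by (simp add: shifted_dgl_def)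
  have M: "madd f" "mscale scale f" "arity (nat (p + 1)) f" if "f \<in> comp ?L p" for p f
    using cochainsD[OF cl[OF C(1)[OF that]]] by auto
  \<comment> \<open>\<open>nat\<close> sends every degree below -1 to arity 0. The only nonzero
    candidates of total degree below -1 are two elements of degree -1, and nothing can be inserted
    into a map of arity 0.\<close>
  have B0: "brk ?L p q f g = 0" if "f \<in> comp ?L p" "g \<in> comp ?L q" "p + q < - 1" for p q f g
  proof -
    have "p < - 1 \<or> q < - 1 \<or> p = - 1 \<and> q = - 1" using that(3) by linarith
    then have "f = 0 \<or> g = 0 \<or> p = - 1 \<and> q = - 1"
      using C(2)[OF that(1)] C(2)[OF that(2)] by auto
    then consider "f = 0" | "g = 0" | "p = - 1" "q = - 1" by auto
    then show ?thesis
    proof cases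
      case 3
      then show ?thesis using M(3)[OF that(1)] M(3)[OF that(2)]
        unfolding B[OF that(1,2)] by (auto simp: fun_eq_iff arity_0_ins)
    qed (use that M in \<open>auto simp: B z ins_zero ins_zero_left\<close>)
  qed
  have Bc: "brk ?L p q f g \<in> comp ?L (p + q)" if "f \<in> comp ?L p" "g \<in> comp ?L q" for p q f g
  proof (cases "p + q < - 1")
    case True
    then show ?thesis using B0[OF that True] 0 by (intro I) simp_all
  next
    case False
    show ?thesis
    proof (cases "p < - 1 \<or> q < - 1")
      case True
      then have "f = 0 \<or> g = 0" using C(2) that by blast
      then have "brk ?L p q f g = 0"
        using that M by (auto simp: B z ins_zero ins_zero_left)
      then show ?thesis using 0 by (intro I) simp_all
    next
      case F: False
      then have "nat (p + q + 1) = nat (p + 1) + nat (q + 1) - 1" using False by linarith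
      then show ?thesis
        using br[OF C(1)[OF that(1)] C(1)[OF that(2)]] False
        by (intro I) (simp_all add: shifted_dgl_def)
    qed
  qed
  have BZ: "brk ?L p q f g = 0" if "f \<in> comp ?L p" "g \<in> comp ?L q" "f = 0 \<or> g = 0" for p q f g
    using that M by (auto simp: B z ins_zero ins_zero_left)
  have DZ: "diff ?L p 0 = 0" for p
    using D[of 0 p] I[of 0 p] 0 by (simp add: z delta_zero)
  have DC: "diff ?L p f \<in> comp ?L (p + 1)" if f: "f \<in> comp ?L p" for p f
  proof (cases "p < - 1")
    case True
    then show ?thesis using C(2)[OF f] DZ I[of 0] 0 by auto
  next
    case False
    then have "nat (p + 1 + 1) = nat (p + 1) + 1" by linarith
    then show ?thesis
      using C(1)[OF f] False d by (intro I) (simp_all add: shifted_dgl_def)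
  qed
  have sgn: "ksign (p * q) x = ksign ((nat (p + 1) + 1) * (nat (q + 1) + 1)) x"
    if "p \<ge> - 1" "q \<ge> - 1" for p q and x :: "'a list \<Rightarrow> 'a"
    using that by (intro ksign_cong) (simp add: even_nat_iff; blast)
  have J: "brk ?L p (q + r) x (brk ?L q r y z)
        = brk ?L (p + q) r (brk ?L p q x y) z + ksign (p * q) (brk ?L q (p + r) y (brk ?L p r x z))"
    if x: "x \<in> comp ?L p" and y: "y \<in> comp ?L q" and z: "z \<in> comp ?L r" for x y z p q r
  proof (cases "p \<ge> - 1 \<and> q \<ge> - 1 \<and> r \<ge> - 1")
    case True
    then have n: "nat (q + r + 1) = nat (q + 1) + nat (r + 1) - 1"
      "nat (p + r + 1) = nat (p + 1) + nat (r + 1) - 1"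
      "nat (p + q + 1) = nat (p + 1) + nat (q + 1) - 1" by linarith+
    have "ksign (p * q) (brk ?L q (p + r) y (brk ?L p r x z))
        = ksign ((nat (p + 1) + 1) * (nat (q + 1) + 1)) (brk ?L q (p + r) y (brk ?L p r x z))"
      using True by (intro sgn) auto
    then show ?thesis
      using bracket_jacobi[OF M(3,1)[OF x] M(3,1)[OF y] M(3,1)[OF z]]
      by (simp only: bk n)
  next
    case False
    then have "x = 0 \<or> y = 0 \<or> z = 0" using C(2) x y z by fastforce
    then show ?thesis
      using BZ[OF x Bc[OF y z]] BZ[OF Bc[OF x y] z] BZ[OF y Bc[OF x z]] BZ[OF x y] BZ[OF y z] BZ[OF x z]
      by auto
  qed
  \<comment> \<open>Jacobi identity with the multiplication as first entry. It holds for all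
    cochains, hence also for the multiplication, which in general is not normalized and so lies
    outside a normalized complex.\<close>
  have Lb: "diff ?L (p + q) (brk ?L p q x y)
        = brk ?L (p + 1) q (diff ?L p x) y + ksign p (brk ?L p (q + 1) x (diff ?L q y))"
    if x: "x \<in> comp ?L p" and y: "y \<in> comp ?L q" for x y p q
  proof (cases "p \<ge> - 1 \<and> q \<ge> - 1")
    case True
    then have n: "nat (p + q + 1) = nat (p + 1) + nat (q + 1) - 1"
      "nat (p + 1 + 1) = 2 + nat (p + 1) - 1" "nat (q + 1 + 1) = 2 + nat (q + 1) - 1" by linarith+
    have s: "ksign p f = ksign ((2 + 1) * (nat (p + 1) + 1)) f" for f :: "'a list \<Rightarrow> 'a"
      using True by (intro ksign_cong) (simp add: even_nat_iff)
    have "gerstenhaber_bracket 2 (nat (p + 1) + nat (q + 1) - 1) mult_cochain (brk ?L p q x y)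
      = brk ?L (p + 1) q (gerstenhaber_bracket 2 (nat (p + 1)) mult_cochain x) y
        + ksign ((2 + 1) * (nat (p + 1) + 1)) (brk ?L p (q + 1) x (gerstenhaber_bracket 2 (nat (q + 1)) mult_cochain y))"
      using bracket_jacobi[OF arity_mult_cochain madd_mult_cochain M(3,1)[OF x] M(3,1)[OF y]]
      by (simp only: bk n)
    then show ?thesis
      by (simp only: D'[OF Bc[OF x y]] D'[OF x] D'[OF y] n s)
  next
    case False
    then have "x = 0 \<or> y = 0" using C(2) x y by fastforce
    then show ?thesis
      using BZ[OF x y] BZ[OF DC[OF x] y] BZ[OF x DC[OF y]] by (auto simp: DZ)
  qed
  have as: "brk ?L p q x y = - ksign (p * q) (brk ?L q p y x)"
    if x: "x \<in> comp ?L p" and y: "y \<in> comp ?L q" for x y p q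
  proof (cases "p \<ge> - 1 \<and> q \<ge> - 1")
    case True
    then show ?thesis
      unfolding B[OF x y] B[OF y x] by (simp add: fun_eq_iff sgn ksign_fun mult.commute) (simp add: ksign_def)
  next
    case False
    then have "x = 0 \<or> y = 0" using C(2) x y by fastforce
    then show ?thesis
      using BZ[OF x y] BZ[OF y x] by auto
  qed
  have Ccl: "f + g \<in> comp ?L p" "fscale scale c f \<in> comp ?L p"
    if "f \<in> comp ?L p" "g \<in> comp ?L p" for f g p c
    using that sub(1) F.subspace_add F.subspace_scale
    by (auto simp: shifted_dgl_def split: if_splits)
  show ?thesis
  proof (unfold_locales)
    show "F.subspace (comp ?L p)" for p
      using sub(1) by (simp add: shifted_dgl_def)
    show "diff ?L p x \<in> comp ?L (p + 1)" if "x \<in> comp ?L p" for x p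
      by (rule DC[OF that])
    show "diff ?L p (x + y) = diff ?L p x + diff ?L p y" if "x \<in> comp ?L p" "y \<in> comp ?L p" for p x y
      using D[OF Ccl(1)[OF that]] D[OF that(1)] D[OF that(2)]
      by (simp add: fun_eq_iff p delta_add)
    show "diff ?L p (fscale scale c x) = fscale scale c (diff ?L p x)" if "x \<in> comp ?L p" for p x c
      using Ccl(2)[OF that that, of c] D'[OF that] D'[OF Ccl(2)[OF that that]] M[OF that]
        bracket_eq_ins[OF mult_cochain_mem cl[OF C(1)[OF that]]]
        bracket_eq_ins[OF mult_cochain_mem cl[OF C(1)[OF Ccl(2)[OF that that, of c]]]]
        cochainsD[OF mult_cochain_mem]
      by (simp add: fun_eq_iff fs ins_scale ins_scale_left scale_right_diff_distrib ksign_scale)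
    show "diff ?L (p + 1) (diff ?L p x) = 0" if "x \<in> comp ?L p" for p x
      by (subst D[OF DC[OF that]]) (simp add: D[OF that] fun_eq_iff delta_ksign delta_delta)
    show "brk ?L p q x y \<in> comp ?L (p + q)" if "x \<in> comp ?L p" "y \<in> comp ?L q" for p q x y
      by (rule Bc[OF that])
    show "brk ?L p q (x + x') y = brk ?L p q x y + brk ?L p q x' y"
      if "x \<in> comp ?L p" "x' \<in> comp ?L p" "y \<in> comp ?L q" for p q x x' y
      unfolding B[OF Ccl(1)[OF that(1,2)] that(3)] B[OF that(1,3)] B[OF that(2,3)]
      by (simp add: fun_eq_iff p ins_add ins_add_left M(1)[OF that(3)])
    show "brk ?L p q x (y + y') = brk ?L p q x y + brk ?L p q x y'"
      if "x \<in> comp ?L p" "y \<in> comp ?L q" "y' \<in> comp ?L q" for p q x y y'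
      unfolding B[OF that(1) Ccl(1)[OF that(2,3)]] B[OF that(1,2)] B[OF that(1,3)]
      by (simp add: fun_eq_iff p ins_add ins_add_left M(1)[OF that(1)])
    show "brk ?L p q (fscale scale c x) y = fscale scale c (brk ?L p q x y)"
      if "x \<in> comp ?L p" "y \<in> comp ?L q" for p q x y c
      unfolding B[OF Ccl(2)[OF that(1,1)] that(2)] B[OF that]
      by (simp add: fun_eq_iff fs ins_scale ins_scale_left M[OF that(2)] scale_right_diff_distrib ksign_scale)
    show "brk ?L p q x (fscale scale c y) = fscale scale c (brk ?L p q x y)"
      if "x \<in> comp ?L p" "y \<in> comp ?L q" for p q x y c
      unfolding B[OF that(1) Ccl(2)[OF that(2,2)]] B[OF that]
      by (simp add: fun_eq_iff fs ins_scale ins_scale_left M[OF that(1)] scale_right_diff_distrib ksign_scale)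
  qed (fact as J Lb)+
qed

end

section \<open>Sweedler sums\<close>

lemma sum_mset_sum_mset: "(\<Sum>z\<in>#(\<Sum>y\<in>#M. f y). g z) = (\<Sum>y\<in>#M. \<Sum>z\<in>#f y. g z)"
  by (induction M) auto

lemma linearD:
  assumes "Vector_Spaces.linear s t f"
  shows "f (x + y) = f x + f y" "f (s c x) = t c (f x)" "f 0 = 0" "f (- x) = - f x"
    "f (x - y) = f x - f y" "vector_space s" "vector_space t"
proof -
  interpret Vector_Spaces.linear s t f by fact
  show "f (x + y) = f x + f y" "f (s c x) = t c (f x)" "f 0 = 0" "f (- x) = - f x"
    "f (x - y) = f x - f y" "vector_space s" "vector_space t"
    by (simp_all add: add scale neg diff vs1.vector_space_axioms vs2.vector_space_axioms)
qed

lemma linear_comp: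
  "Vector_Spaces.linear s t f \<Longrightarrow> Vector_Spaces.linear t r g \<Longrightarrow> Vector_Spaces.linear s r (\<lambda>x. g (f x))"
  by (auto simp: Vector_Spaces.linear_iff)

lemma linear_sum_mset_aux:
  assumes "Vector_Spaces.linear s t f"
  shows "f (\<Sum>x\<in>#M. g x) = (\<Sum>x\<in>#M. f (g x))"
  by (induction M) (simp_all add: linearD[OF assms])

lemma sum_mset_linear:
  assumes "vector_space s" "vector_space t" "\<And>x. x \<in># M \<Longrightarrow> Vector_Spaces.linear s t (\<lambda>y. g y x)"
  shows "Vector_Spaces.linear s t (\<lambda>y. \<Sum>x\<in>#M. g y x)"
proof -
  interpret t: vector_space t by fact
  show ?thesis
    using assms(3)
    by (induction M) (auto simp: Vector_Spaces.linear_iff assms(1,2) t.scale_right_distrib add_ac)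
qed

text \<open>Sweedler's \<open>\<beta>(x\<^sub>1, x\<^sub>2)\<close>. Since \<open>comult\<close> is
  merely a representative, axioms that equate tensors can be used only after evaluation on
  multilinear maps; this is the origin of the linearity side conditions below.\<close>

definition sw :: "('k, 'e) hopf \<Rightarrow> 'e \<Rightarrow> ('e \<Rightarrow> 'e \<Rightarrow> 'x::comm_monoid_add) \<Rightarrow> 'x" where
  "sw H x \<beta> = (\<Sum>(u, v)\<in>#comult H x. \<beta> u v)"

lemma sw_cong [fundef_cong]: "x = y \<Longrightarrow> (\<And>u v. \<beta> u v = \<gamma> u v) \<Longrightarrow> sw H x \<beta> = sw H y \<gamma>"
  by (simp add: sw_def)

lemma sw_swap: "sw H x (\<lambda>u v. sw K y (\<lambda>a b. \<gamma> u v a b)) = sw K y (\<lambda>a b. sw H x (\<lambda>u v. \<gamma> u v a b))"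
  unfolding sw_def case_prod_unfold by (rule sum_mset.swap)

lemma linear_sw:
  assumes "Vector_Spaces.linear s t f"
  shows "f (sw H x \<beta>) = sw H x (\<lambda>u v. f (\<beta> u v))"
  unfolding sw_def linear_sum_mset_aux[OF assms] case_prod_unfold ..

lemma sw_add: "sw H x (\<lambda>u v. \<beta> u v + \<gamma> u v) = sw H x \<beta> + sw H x \<gamma>"
  by (simp add: sw_def case_prod_unfold sum_mset.distrib)

lemma sw_zero: "sw H x (\<lambda>u v. 0) = 0"
  by (simp add: sw_def case_prod_unfold)

lemma sw_minus: "sw H x (\<lambda>u v. - \<beta> u v) = - sw H x \<beta>" for \<beta> :: "'e \<Rightarrow> 'e \<Rightarrow> 'x::ab_group_add"
  using sw_add[of H x "\<lambda>u v. - \<beta> u v" \<beta>] by (simp add: sw_zero eq_neg_iff_add_eq_0)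

lemma sw_diff: "sw H x (\<lambda>u v. \<beta> u v - \<gamma> u v) = sw H x \<beta> - sw H x \<gamma>"
  for \<beta> :: "'e \<Rightarrow> 'e \<Rightarrow> 'x::ab_group_add"
  using sw_add[of H x "\<lambda>u v. \<beta> u v - \<gamma> u v" \<gamma>] by simp

lemma sw_ksign: "sw H x (\<lambda>u v. ksign p (\<beta> u v)) = ksign p (sw H x \<beta>)"
  by (simp add: ksign_def sw_minus)

lemma sw_sum: "sw H x (\<lambda>u v. \<Sum>b\<in>A. \<beta> b u v) = (\<Sum>b\<in>A. sw H x (\<beta> b))"
  by (induction A rule: infinite_finite_induct) (simp_all add: sw_zero sw_add)

lemma sw_mult_left: "sw H x (\<lambda>u v. a * \<beta> u v) = a * sw H x \<beta>" for a :: "'b::ring"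
  by (simp add: sw_def case_prod_unfold sum_mset_distrib_left)

lemma sw_mult_right: "sw H x (\<lambda>u v. \<beta> u v * a) = sw H x \<beta> * a" for a :: "'b::ring"
  by (simp add: sw_def case_prod_unfold sum_mset_distrib_right)

lemma sum_tensor_eq:
  assumes "tensor_eq sV sW M N" "bilinear_map sV sW sX \<beta>"
  shows "(\<Sum>(u, v)\<in>#M. \<beta> u v) = (\<Sum>(u, v)\<in>#N. \<beta> u v)"
proof -
  have l: "Vector_Spaces.linear sV sX (\<lambda>u. \<beta> u v)" "Vector_Spaces.linear sW sX (\<beta> u)" for u v
    using assms(2) by (auto simp: bilinear_map_def)
  show ?thesis using assms(1)
    by induction (simp_all add: linearD[OF l(1)] linearD[OF l(2)])
qed

lemma sum_tensor3_eq:
  assumes "tensor3_eq s M N"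
    "\<And>v w. Vector_Spaces.linear s t (\<lambda>u. \<gamma> u v w)"
    "\<And>u w. Vector_Spaces.linear s t (\<lambda>v. \<gamma> u v w)"
    "\<And>u v. Vector_Spaces.linear s t (\<lambda>w. \<gamma> u v w)"
  shows "(\<Sum>(u, v, w)\<in>#M. \<gamma> u v w) = (\<Sum>(u, v, w)\<in>#N. \<gamma> u v w)"
  using assms(1)
  by induction (simp_all add: linearD[OF assms(2)] linearD[OF assms(3)] linearD[OF assms(4)])

context hopf_algebra
begin

abbreviation lin where "lin t f \<equiv> Vector_Spaces.linear (hscale H) t f"
abbreviation S where "S \<equiv> antipode H"
abbreviation ep where "ep \<equiv> counit H"
abbreviation one where "one \<equiv> hunit H"
abbreviation sc where "sc \<equiv> hscale H"

lemma sw_add_arg: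
  assumes "\<And>v. lin t (\<lambda>u. \<beta> u v)" "\<And>u. lin t (\<lambda>v. \<beta> u v)"
  shows "sw H (x + y) \<beta> = sw H x \<beta> + sw H y \<beta>"
  using sum_tensor_eq[OF comult_add, of t \<beta> x y] assms by (simp add: bilinear_map_def sw_def)

lemma sw_scale_arg:
  assumes "\<And>v. lin t (\<lambda>u. \<beta> u v)" "\<And>u. lin t (\<lambda>v. \<beta> u v)"
  shows "sw H (sc c x) \<beta> = t c (sw H x \<beta>)"
proof -
  interpret Vector_Spaces.linear sc t "\<lambda>u. \<beta> u 0" by fact
  have "sw H (sc c x) \<beta> = sw H x (\<lambda>u v. \<beta> (sc c u) v)"
    using sum_tensor_eq[OF comult_scale, of t \<beta> c x] assms
    by (simp add: bilinear_map_def sw_def image_mset.compositionality o_def case_prod_unfold)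
  also have "\<dots> = t c (sw H x \<beta>)"
    unfolding linear_sw[OF vs2.linear_scale_self] using linearD(2)[OF assms(1)] by simp
  finally show ?thesis .
qed

lemma lin_sw:
  assumes "\<And>v. lin t (\<lambda>u. \<beta> u v)" "\<And>u. lin t (\<lambda>v. \<beta> u v)"
  shows "lin t (\<lambda>x. sw H x \<beta>)"
  using sw_add_arg[OF assms] sw_scale_arg[OF assms] linearD(6,7)[OF assms(1)]
  by (simp add: Vector_Spaces.linear_iff)

lemma linear_sw_param:
  assumes "\<And>u v. Vector_Spaces.linear s t (\<lambda>y. \<beta> y u v)"
  shows "Vector_Spaces.linear s t (\<lambda>y. sw H x (\<lambda>u v. \<beta> y u v))"
  unfolding sw_def case_prod_unfold
  by (rule sum_mset_linear) (use assms linearD(6,7)[OF assms] in auto)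

lemma sw_coassoc:
  assumes "\<And>v w. lin t (\<lambda>u. \<gamma> u v w)" "\<And>u w. lin t (\<lambda>v. \<gamma> u v w)" "\<And>u v. lin t (\<lambda>w. \<gamma> u v w)"
  shows "sw H x (\<lambda>u w. sw H u (\<lambda>a b. \<gamma> a b w)) = sw H x (\<lambda>u w. sw H w (\<lambda>a b. \<gamma> u a b))"
proof -
  show ?thesis
    using sum_tensor3_eq[OF coassoc assms, of x]
    by (simp add: sw_def sum_mset_sum_mset case_prod_unfold image_mset.compositionality o_def)
qed

lemma sw_counit_left: "lin t f \<Longrightarrow> sw H x (\<lambda>u v. f (sc (ep u) v)) = f x"
  using counit_left[of x] by (simp add: linear_sw[of sc t f, symmetric]) (simp add: sw_def)

lemma sw_counit_right: "lin t f \<Longrightarrow> sw H x (\<lambda>u v. f (sc (ep v) u)) = f x"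
  using counit_right[of x] by (simp add: linear_sw[of sc t f, symmetric]) (simp add: sw_def)

lemma sw_counit_left': "lin t f \<Longrightarrow> sw H x (\<lambda>u v. t (ep u) (f v)) = f x"
  using sw_counit_left[of t f x] by (simp add: linearD(2))

lemma sw_counit_right': "lin t f \<Longrightarrow> sw H x (\<lambda>u v. t (ep v) (f u)) = f x"
  using sw_counit_right[of t f x] by (simp add: linearD(2))

lemma sw_mult:
  assumes "\<And>v. lin t (\<lambda>u. \<beta> u v)" "\<And>u. lin t (\<lambda>v. \<beta> u v)"
  shows "sw H (x * y) \<beta> = sw H x (\<lambda>u v. sw H y (\<lambda>u' v'. \<beta> (u * u') (v * v')))"
proof -
  show ?thesis
    using sum_tensor_eq[OF comult_mult, of t \<beta> x y] assms
    by (simp add: bilinear_map_def sw_def sum_mset_sum_mset case_prod_unfold image_mset.compositionality o_def)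
qed

lemma sw_one:
  assumes "\<And>v. lin t (\<lambda>u. \<beta> u v)" "\<And>u. lin t (\<lambda>v. \<beta> u v)"
  shows "sw H one \<beta> = \<beta> one one"
  using sum_tensor_eq[OF comult_unit, of t \<beta>] assms by (simp add: bilinear_map_def sw_def)

lemma sw_antipode_left: "lin t f \<Longrightarrow> sw H x (\<lambda>u v. f (S u * v)) = t (ep x) (f one)"
  using antipode_left[of x] by (simp add: linear_sw[of sc t f, symmetric] linearD(2)[of sc t f, symmetric]) (simp add: sw_def)

lemma sw_antipode_right: "lin t f \<Longrightarrow> sw H x (\<lambda>u v. f (u * S v)) = t (ep x) (f one)"
  using antipode_right[of x] by (simp add: linear_sw[of sc t f, symmetric] linearD(2)[of sc t f, symmetric]) (simp add: sw_def)

lemma linear_mult_left: "Vector_Spaces.linear s sc f \<Longrightarrow> Vector_Spaces.linear s sc (\<lambda>x. f x * c)"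
  by (auto simp: Vector_Spaces.linear_iff distrib_right scale_mult_left)

lemma linear_mult_right: "Vector_Spaces.linear s sc f \<Longrightarrow> Vector_Spaces.linear s sc (\<lambda>x. c * f x)"
  by (auto simp: Vector_Spaces.linear_iff distrib_left scale_mult_right)

lemma linear_S: "Vector_Spaces.linear s sc f \<Longrightarrow> Vector_Spaces.linear s sc (\<lambda>x. S (f x))"
  by (rule linear_comp[OF _ antipode_linear])

lemma linear_ep: "Vector_Spaces.linear s sc f \<Longrightarrow> Vector_Spaces.linear s (*) (\<lambda>x. ep (f x))"
  by (rule linear_comp[OF _ counit_linear])

lemma linear_sc: "Vector_Spaces.linear s sc f \<Longrightarrow> Vector_Spaces.linear s sc (\<lambda>x. sc c (f x))"
  by (rule linear_comp[OF _ linear_scale_self])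

lemma linear_sc_left: "Vector_Spaces.linear s (*) f \<Longrightarrow> Vector_Spaces.linear s sc (\<lambda>x. sc (f x) c)"
  by (auto simp: Vector_Spaces.linear_iff scale_left_distrib vector_space_axioms)

lemma linear_sw_arg:
  assumes "Vector_Spaces.linear s sc f" "\<And>v. lin t (\<lambda>u. \<beta> u v)" "\<And>u. lin t (\<lambda>v. \<beta> u v)"
  shows "Vector_Spaces.linear s t (\<lambda>x. sw H (f x) \<beta>)"
  by (rule linear_comp[OF assms(1) lin_sw[OF assms(2,3)]])

lemmas lin_intros = linear_ident linear_mult_left linear_mult_right linear_S linear_ep linear_sc
  linear_sc_left linear_sw_param linear_sw_arg

section \<open>The antipode\<close>

lemma S_one: "S one = one"
proof -
  have "sw H one (\<lambda>u v. S u * v) = S one * one"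
    by (rule sw_one[where t = sc]) (intro lin_intros)+
  then show ?thesis
    using sw_antipode_left[OF linear_ident, of one] by (simp add: counit_unit unit_right)
qed

text \<open>\<open>S(xy)\<close> and \<open>S(y) S(x)\<close> are a left and a right convolution inverse of the multiplication.\<close>

lemma S_mult: "S (x * y) = S y * S x"
proof -
  have 1: "sw H x (\<lambda>a b. sw H y (\<lambda>c d. S (a * c) * (b * d) * z)) = sc (ep x * ep y) z" for x y z
  proof -
    have "sw H (x * y) (\<lambda>u v. S u * v * z) = sw H x (\<lambda>a b. sw H y (\<lambda>c d. S (a * c) * (b * d) * z))"
      by (rule sw_mult[where t = sc]) (intro lin_intros)+
    moreover have "sw H (x * y) (\<lambda>u v. S u * v * z) = sc (ep (x * y)) (one * z)"
      by (rule sw_antipode_left[where t = sc]) (intro lin_intros)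
    ultimately show ?thesis by (simp add: counit_mult unit_left)
  qed
  \<comment> \<open>Creates \<open>S(x\<^sub>1 y\<^sub>1) (x\<^sub>2 y\<^sub>2) (S(y\<^sub>3)
    S(x\<^sub>3))\<close> from counits; coassociativity then lets its first two factors collapse
    instead of its last two.\<close>
  have "S (x * y) = sw H x (\<lambda>a b. sc (ep b) (S (a * y)))"
    by (rule sw_counit_right'[where t = sc, symmetric]) (intro lin_intros)
  also have "\<dots> = sw H x (\<lambda>a b. sw H b (\<lambda>b1 b2. S (a * y) * (b1 * S b2)))"
    by (intro sw_cong HOL.refl, subst sw_antipode_right[where t = sc]) (intro lin_intros, simp add: unit_right)
  also have "\<dots> = sw H x (\<lambda>a b. sw H b (\<lambda>b1 b2. sw H y (\<lambda>c d. sc (ep d) (S (a * c) * (b1 * S b2)))))"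
    by (intro sw_cong HOL.refl sw_counit_right'[where t = sc, symmetric]) (intro lin_intros)
  also have "\<dots> = sw H x (\<lambda>a b. sw H b (\<lambda>b1 b2. sw H y (\<lambda>c d. sw H d (\<lambda>d1 d2. S (a * c) * (b1 * (d1 * S d2) * S b2)))))"
    by (intro sw_cong HOL.refl, subst sw_antipode_right[where t = sc])
      (intro lin_intros, simp add: unit_right scale_mult_left scale_mult_right)
  also have "\<dots> = sw H x (\<lambda>a b. sw H a (\<lambda>a1 a2. sw H y (\<lambda>c d. sw H d (\<lambda>d1 d2. S (a1 * c) * (a2 * (d1 * S d2) * S b)))))"
    by (rule sw_coassoc[where t = sc, symmetric]) (intro lin_intros)+
  also have "\<dots> = sw H x (\<lambda>a b. sw H a (\<lambda>a1 a2. sw H y (\<lambda>c d. sw H c (\<lambda>c1 c2. S (a1 * c1) * (a2 * (c2 * S d) * S b)))))"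
    by (intro sw_cong HOL.refl sw_coassoc[where t = sc, symmetric]) (intro lin_intros)+
  also have "\<dots> = sw H x (\<lambda>a b. sw H y (\<lambda>c d. sw H a (\<lambda>a1 a2. sw H c (\<lambda>c1 c2. S (a1 * c1) * (a2 * c2) * (S d * S b)))))"
    by (simp only: sw_swap[of H _ H y] mult.assoc)
  also have "\<dots> = sw H x (\<lambda>a b. sw H y (\<lambda>c d. sc (ep a) (sc (ep c) (S d * S b))))"
    by (simp only: 1 scale_scale)
  also have "\<dots> = sw H x (\<lambda>a b. sc (ep a) (S y * S b))"
    unfolding linear_sw[OF linear_scale_self, symmetric]
    by (subst sw_counit_left'[where t = sc]) (intro lin_intros, simp)
  also have "\<dots> = S y * S x"
    by (rule sw_counit_left'[where t = sc]) (intro lin_intros)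
  finally show ?thesis .
qed

section \<open>Integrals and the fourth power of the antipode\<close>

definition integral :: "'e \<Rightarrow> bool" where
  "integral t \<longleftrightarrow> (\<forall>x. x * t = sc (ep x) t) \<and> (\<forall>x. t * x = sc (ep x) t)"

text \<open>A two-sided integral of the dual algebra, written without dualizing: pairing either
  identity with a functional gives the convolution product of \<open>l\<close> with that functional.
  The normalization \<open>l one = 1\<close> is stated separately.\<close>

definition cointegral :: "('e \<Rightarrow> 'k) \<Rightarrow> bool" where
  "cointegral l \<longleftrightarrow> lin (*) l \<and> (\<forall>x. sw H x (\<lambda>u v. sc (l u) v) = sc (l x) one)
     \<and> (\<forall>x. sw H x (\<lambda>u v. sc (l v) u) = sc (l x) one)"

lemma integralD: "integral t \<Longrightarrow> x * t = sc (ep x) t" "integral t \<Longrightarrow> t * x = sc (ep x) t"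
  by (auto simp: integral_def)

text \<open>Maschke's argument: the component of 1 in a complement of the augmentation ideal is a
  left integral. Semisimplicity enters a second time to make it two-sided.\<close>

lemma semisimple_integral:
  assumes "semisimple_algebra sc"
  shows "\<exists>t. integral t \<and> ep t = 1"
proof -
  have ep: "ep (x + y) = ep x + ep y" "ep (sc c x) = c * ep x" "ep 0 = 0" "ep (x - y) = ep x - ep y" for x y c
    using linearD[OF counit_linear] by auto
  have "left_ideal sc {x. ep x = 0}"
    by (auto simp: left_ideal_def subspace_def ep counit_mult)
  from assms[unfolded semisimple_algebra_def, THEN spec, THEN mp, OF this] obtain J where J: "left_ideal sc J" "{x. ep x = 0} \<inter> J = {0}" "\<forall>x. \<exists>i\<in>{x. ep x = 0}. \<exists>j\<in>J. x = i + j"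
    by (elim exE conjE)
  from J(3) obtain i t where t: "ep i = 0" "t \<in> J" "one = i + t" by blast
  have ept: "ep t = 1" using t(1) arg_cong[OF t(3), of ep] by (simp add: ep counit_unit)
  have left: "x * t = sc (ep x) t" for x
  proof -
    have "x * t - sc (ep x) t \<in> J"
      using J(1) t(2) by (simp add: left_ideal_def subspace_diff subspace_scale)
    moreover have "ep (x * t - sc (ep x) t) = 0" by (simp add: ep counit_mult)
    ultimately have "x * t - sc (ep x) t \<in> {0}" unfolding J(2)[symmetric] by simp
    then show ?thesis by simp
  qed
  \<comment> \<open>The defect \<open>n\<close> is a left integral with counit 0, so it spans a left
    ideal of square 0. A complement \<open>K\<close> of that ideal contains \<open>n = n 1\<close>,
    which forces \<open>n = 0\<close>.\<close>
  have right: "t * x = sc (ep x) t" for x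
  proof -
    define n where "n = t * x - sc (ep x) t"
    have n: "y * n = sc (ep y) n" for y
      unfolding n_def by (simp add: right_diff_distrib mult.assoc[symmetric] left scale_mult_left
        scale_mult_right scale_right_diff_distrib scale_left_commute)
    have epn: "ep n = 0" by (simp add: n_def ep counit_mult ept)
    have "left_ideal sc (range (\<lambda>c. sc c n))"
      unfolding left_ideal_def
    proof (intro conjI allI ballI)
      show "subspace (range (\<lambda>c. sc c n))"
        by (auto simp: subspace_def scale_left_distrib[symmetric] intro: rangeI image_eqI[of _ _ 0])
    qed (auto simp: scale_mult_right n)
    from assms[unfolded semisimple_algebra_def, THEN spec, THEN mp, OF this] obtain K where K: "left_ideal sc K" "range (\<lambda>c. sc c n) \<inter> K = {0}"
      "\<forall>x. \<exists>i\<in>range (\<lambda>c. sc c n). \<exists>j\<in>K. x = i + j"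
      by (elim exE conjE)
    from K(3) obtain c k where k: "k \<in> K" "one = sc c n + k" by blast
    have "n = n * one" by (simp add: unit_right)
    also have "\<dots> = n * k" by (simp add: k(2) distrib_left scale_mult_right n epn)
    finally have "n \<in> K" using K(1) k(1) by (simp add: left_ideal_def) metis
    moreover have "n \<in> range (\<lambda>c. sc c n)" by (rule range_eqI[of _ _ 1]) simp
    ultimately have "n = 0" using K(2) by blast
    then show ?thesis by (simp add: n_def)
  qed
  show ?thesis using left right ept by (auto simp: integral_def)
qed

lemma subcoalgebra_sw:
  assumes "subcoalgebra H C" "x \<in> C" "\<And>v. lin t (\<lambda>u. \<beta> u v)" "\<And>u. lin t (\<lambda>v. \<beta> u v)"
  obtains M where "set_mset M \<subseteq> C \<times> C" "sw H x \<beta> = (\<Sum>(u, v)\<in>#M. \<beta> u v)"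
proof -
  obtain M where M: "set_mset M \<subseteq> C \<times> C" "tensor_eq sc sc (comult H x) M"
    using assms(1,2) by (auto simp: subcoalgebra_def)
  then show thesis
    using sum_tensor_eq[OF M(2), of t \<beta>] assms(3,4) by (intro that) (auto simp: bilinear_map_def sw_def)
qed

lemma subspace_sum_mset: "subspace C \<Longrightarrow> (\<And>x. x \<in># M \<Longrightarrow> f x \<in> C) \<Longrightarrow> (\<Sum>x\<in>#M. f x) \<in> C"
  by (induction M) (auto simp: subspace_0 subspace_add)

lemma subcoalgebra_contract:
  assumes "subcoalgebra H C" "x \<in> C" "lin (*) l"
  shows "sw H x (\<lambda>u v. sc (l u) v) \<in> C" "sw H x (\<lambda>u v. sc (l v) u) \<in> C"
    "(\<And>y. y \<in> C \<Longrightarrow> l y = 0) \<Longrightarrow> sw H x (\<lambda>u v. sc (l u) v) = 0"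
    "(\<And>y. y \<in> C \<Longrightarrow> l y = 0) \<Longrightarrow> sw H x (\<lambda>u v. sc (l v) u) = 0"
proof -
  have C: "subspace C" using assms(1) by (simp add: subcoalgebra_def)
  obtain M where M: "set_mset M \<subseteq> C \<times> C" "sw H x (\<lambda>u v. sc (l u) v) = (\<Sum>(u, v)\<in>#M. sc (l u) v)"
    by (rule subcoalgebra_sw[OF assms(1,2), of sc "\<lambda>u v. sc (l u) v"]) (intro linear_sc_left assms(3) linear_scale_self | assumption)+
  show "sw H x (\<lambda>u v. sc (l u) v) \<in> C" unfolding M(2) case_prod_unfold
    using M(1) by (intro subspace_sum_mset[OF C]) (auto intro!: subspace_scale[OF C])
  show "sw H x (\<lambda>u v. sc (l u) v) = 0" if "\<And>y. y \<in> C \<Longrightarrow> l y = 0" unfolding M(2) case_prod_unfold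
    using M(1) that by (intro sum_mset.neutral) auto
  obtain M where M: "set_mset M \<subseteq> C \<times> C" "sw H x (\<lambda>u v. sc (l v) u) = (\<Sum>(u, v)\<in>#M. sc (l v) u)"
    by (rule subcoalgebra_sw[OF assms(1,2), of sc "\<lambda>u v. sc (l v) u"]) (intro linear_sc_left assms(3) linear_scale_self | assumption)+
  show "sw H x (\<lambda>u v. sc (l v) u) \<in> C" unfolding M(2) case_prod_unfold
    using M(1) by (intro subspace_sum_mset[OF C]) (auto intro!: subspace_scale[OF C])
  show "sw H x (\<lambda>u v. sc (l v) u) = 0" if "\<And>y. y \<in> C \<Longrightarrow> l y = 0" unfolding M(2) case_prod_unfold
    using M(1) that by (intro sum_mset.neutral) auto
qed

lemma extend_functional:
  assumes "subspace U" "a \<notin> U"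
  obtains l where "lin (*) l" "\<And>x. x \<in> U \<Longrightarrow> l x = 0" "l a = 1"
proof -
  interpret k: vector_space "(*) :: 'k \<Rightarrow> 'k \<Rightarrow> 'k" by unfold_locales (simp_all add: algebra_simps)
  interpret p: vector_space_pair sc "(*) :: 'k \<Rightarrow> 'k \<Rightarrow> 'k" ..
  obtain B where B: "B \<subseteq> U" "independent B" "U = span B"
    using basis_exists[of U] assms(1) span_subspace by metis
  have i: "independent (insert a B)" using B assms(2) by (simp add: independent_insert)
  obtain l where l: "lin (*) l" "\<forall>x\<in>insert a B. l x = (if x = a then 1 else 0)"
    using p.linear_independent_extend[OF i, of "\<lambda>x. if x = a then 1 else 0"] by auto
  interpret l: Vector_Spaces.linear sc "(*)" l by fact
  have "l x = 0" if "x \<in> U" for x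
    using that l(2) B assms(2) by (intro l.eq_0_on_span[of B x]) auto
  then show thesis using that[OF l(1)] l(2) by simp
qed

text \<open>Peel off one of the subcoalgebras \<open>C\<close> at a time, contracting with a functional that vanishes on \<open>C\<close> but not
  at the unit.\<close>

lemma unit_notin_span_subcoalgebras:
  assumes "finite F" "\<And>C. C \<in> F \<Longrightarrow> subcoalgebra H C \<and> one \<notin> C"
  shows "one \<notin> span (\<Union>F)"
  using assms
proof (induction F rule: finite_induct)
  case empty
  have "one \<noteq> 0" using counit_unit linearD(3)[OF counit_linear] by force
  then show ?case by simp
next
  case (insert C F)
  show ?case
  proof
    assume "one \<in> span (\<Union>(insert C F))"
    then have "one \<in> span (C \<union> \<Union>F)" by simp
    moreover have C: "subcoalgebra H C" "one \<notin> C" "subspace C" using insert.prems by (auto simp: subcoalgebra_def)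
    ultimately obtain c y where cy: "one = c + y" "c \<in> C" "y \<in> span (\<Union>F)"
      unfolding span_Un span_eq_iff[THEN iffD2, OF C(3)] by blast
    obtain l where l: "lin (*) l" "\<And>x. x \<in> C \<Longrightarrow> l x = 0" "l one = 1"
      using extend_functional[OF C(3,2)] by blast
    have bl: "lin sc (\<lambda>x. sw H x (\<lambda>u v. sc (l u) v))"
      by (intro lin_sw linear_sc_left l(1) linear_scale_self)
    \<comment> \<open>Contracting the coproduct of 1 gives 1 back, and \<open>c\<close> contributes
      0; the contraction of \<open>y\<close> stays in the span because contraction maps each
      subcoalgebra to itself.\<close>
    have "one = sw H one (\<lambda>u v. sc (l u) v)"
      by (subst sw_one[where t = sc]) (intro linear_sc_left l(1) linear_scale_self | simp add: l)+
    also have "\<dots> = sw H y (\<lambda>u v. sc (l u) v)"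
      unfolding cy(1) linearD(1)[OF bl] using subcoalgebra_contract(3)[OF C(1) cy(2) l(1,2)] by simp
    also have "\<dots> \<in> span (\<Union>F)"
      using cy(3)
    proof (rule span_induct)
      show "subspace {y. sw H y (\<lambda>u v. sc (l u) v) \<in> span (\<Union>F)}"
        by (auto simp: subspace_def linearD[OF bl] span_zero span_add span_scale)
      show "sw H x (\<lambda>u v. sc (l u) v) \<in> span (\<Union>F)" if "x \<in> \<Union>F" for x
        using that subcoalgebra_contract(1)[OF _ _ l(1)] insert.prems by (blast intro: span_base)
    qed
    finally show False using insert by auto
  qed
qed

text \<open>\<open>l\<close> is the projection onto the line of 1 along the simple subcoalgebras
  that avoid 1. On those both sides of the identities vanish, and a simple subcoalgebra containing 1
  is that line.\<close>

lemma cosemisimple_cointegral: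
  assumes "cosemisimple_coalgebra H"
  shows "\<exists>l. cointegral l \<and> l one = 1"
proof -
  let ?W = "{C. simple_subcoalgebra H C \<and> one \<notin> C}"
  have one: "one \<notin> span (\<Union>?W)"
  proof
    assume "one \<in> span (\<Union>?W)"
    then obtain T where T: "finite T" "T \<subseteq> \<Union>?W" "one \<in> span T"
      unfolding span_explicit by (auto simp: span_explicit)
    then obtain F where F: "finite F" "F \<subseteq> ?W" "T \<subseteq> \<Union>F"
      using finite_subset_Union[OF T(1), of ?W] by blast
    have "one \<notin> span (\<Union>F)"
      using F(2) by (intro unit_notin_span_subcoalgebras[OF F(1)]) (auto simp: simple_subcoalgebra_def)
    then show False using T(3) span_mono[OF F(3)] by blast
  qed
  obtain l where l: "lin (*) l" "\<And>x. x \<in> span (\<Union>?W) \<Longrightarrow> l x = 0" "l one = 1"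
    using extend_functional[OF subspace_span one] by blast
  have bl: "lin sc (\<lambda>x. sw H x (\<lambda>u v. sc (l u) v))" "lin sc (\<lambda>x. sw H x (\<lambda>u v. sc (l v) u))"
    by (intro lin_sw linear_sc_left l(1) linear_scale_self)+
  have sone: "subcoalgebra H (span {one})"
    unfolding subcoalgebra_def
  proof (intro conjI ballI subspace_span)
    fix x assume "x \<in> span {one}"
    then obtain c where x: "x = sc c one" by (auto simp: span_singleton)
    have "tensor_eq sc sc (comult H x) (image_mset (\<lambda>(u, v). (sc c u, v)) (comult H one))"
      unfolding x by (rule comult_scale)
    moreover have "tensor_eq sc sc (image_mset (\<lambda>(u, v). (sc c u, v)) M) (image_mset (\<lambda>(u, v). (sc c u, v)) N)"
      if "tensor_eq sc sc M N" for M N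
      using that
    proof induction
      case (scale d v w)
      then show ?case by (simp add: scale_left_commute[of c] tensor_eq.scale del: scale_scale)
    qed (simp_all add: tensor_eq.refl tensor_eq.sym tensor_eq.cong tensor_eq.zero tensor_eq.add_left
      tensor_eq.add_right scale_right_distrib, rule tensor_eq.trans)
    from tensor_eq.trans[OF calculation this[OF comult_unit]]
    have "tensor_eq sc sc (comult H x) {#(sc c one, one)#}" by simp
    then show "\<exists>M. set_mset M \<subseteq> span {one} \<times> span {one} \<and> tensor_eq sc sc (comult H x) M"
      by (intro exI[of _ "{#(sc c one, one)#}"]) (auto intro: span_base span_scale)
  qed
  have "sw H x (\<lambda>u v. sc (l u) v) = sc (l x) one \<and> sw H x (\<lambda>u v. sc (l v) u) = sc (l x) one" for x
  proof -
    have "x \<in> span (\<Union>{C. simple_subcoalgebra H C})"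
      using assms by (simp add: cosemisimple_coalgebra_def)
    then show ?thesis
    proof (rule span_induct)
      show "subspace {x. sw H x (\<lambda>u v. sc (l u) v) = sc (l x) one \<and> sw H x (\<lambda>u v. sc (l v) u) = sc (l x) one}"
        by (auto simp: subspace_def linearD[OF bl(1)] linearD[OF bl(2)] linearD[OF l(1)] scale_left_distrib)
    next
      fix x assume "x \<in> \<Union>{C. simple_subcoalgebra H C}"
      then obtain C where C: "simple_subcoalgebra H C" "x \<in> C" by blast
      then have sC: "subcoalgebra H C" by (simp add: simple_subcoalgebra_def)
      show "sw H x (\<lambda>u v. sc (l u) v) = sc (l x) one \<and> sw H x (\<lambda>u v. sc (l v) u) = sc (l x) one"
      proof (cases "one \<in> C")
        case True
        then have "span {one} \<subseteq> C" using sC by (intro span_minimal) (auto simp: subcoalgebra_def)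
        moreover have "span {one} \<noteq> {0}"
          using l(3) linearD(3)[OF l(1)] span_base[of one "{one}"] by force
        ultimately have "C = span {one}" using C(1) sone by (auto simp: simple_subcoalgebra_def)
        then obtain c where "x = sc c one" using C(2) by (auto simp: span_singleton)
        moreover have "sw H one (\<lambda>u v. sc (l u) v) = one" "sw H one (\<lambda>u v. sc (l v) u) = one"
          using sw_one[where t = sc and \<beta> = "\<lambda>u v. sc (l u) v", OF linear_sc_left[OF l(1)] linear_scale_self]
            sw_one[where t = sc and \<beta> = "\<lambda>u v. sc (l v) u", OF linear_scale_self linear_sc_left[OF l(1)]]
          by (simp_all add: l(3))
        ultimately show ?thesis by (simp add: linearD[OF bl(1)] linearD[OF bl(2)] linearD[OF l(1)] l(3))
      next
        case False
        then have 0: "l y = 0" if "y \<in> C" for y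
          using C(1) that by (intro l(2) span_base UnionI[of C]) simp_all
        show ?thesis
          using subcoalgebra_contract(3,4)[OF sC C(2) l(1) 0] 0[OF C(2)] by simp
      qed
    qed
  qed
  then show ?thesis using l by (auto simp: cointegral_def)
qed

section \<open>The Frobenius form of a cointegral and Radford's formula\<close>

lemma cointegralD:
  assumes "cointegral l"
  shows "lin (*) l" "sw H x (\<lambda>u v. sc (l u) v) = sc (l x) one" "sw H x (\<lambda>u v. sc (l v) u) = sc (l x) one"
  using assms by (auto simp: cointegral_def)

lemma linear_functional: "lin (*) l \<Longrightarrow> Vector_Spaces.linear s sc f \<Longrightarrow> Vector_Spaces.linear s (*) (\<lambda>x. l (f x))"
  by (rule linear_comp)

text \<open>The cointegral property expands \<open>l(x y\<^sub>1) S(y\<^sub>2)\<close> to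
  \<open>l(x\<^sub>1 y\<^sub>1) x\<^sub>2 y\<^sub>2 S(y\<^sub>3)\<close>, where the last two factors
  cancel.\<close>

lemma cointegral_shift_right:
  assumes "cointegral l"
  shows "sw H x (\<lambda>u v. sc (l (u * y)) v) = sw H y (\<lambda>u v. sc (l (x * u)) (S v))"
proof -
  note l = cointegralD[OF assms]
  note li = lin_intros linear_functional[OF l(1)]
  have 1: "sc (l (x * p)) (S q) = sw H x (\<lambda>x1 x2. sw H p (\<lambda>p1 p2. sc (l (x1 * p1)) (x2 * (p2 * S q))))" for p q
  proof -
    have "sc (l (x * p)) (S q) = sw H (x * p) (\<lambda>a b. sc (l a) b) * S q"
      by (simp add: l(2) scale_mult_left unit_left)
    also have "sw H (x * p) (\<lambda>a b. sc (l a) b) = sw H x (\<lambda>x1 x2. sw H p (\<lambda>p1 p2. sc (l (x1 * p1)) (x2 * p2)))"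
      by (rule sw_mult[where t = sc]) (intro li)+
    finally show ?thesis by (simp add: sw_mult_right[symmetric] scale_mult_left mult.assoc)
  qed
  have "sw H y (\<lambda>u v. sc (l (x * u)) (S v))
    = sw H x (\<lambda>x1 x2. sw H y (\<lambda>p q. sw H p (\<lambda>p1 p2. sc (l (x1 * p1)) (x2 * (p2 * S q)))))"
    unfolding 1 by (rule sw_swap)
  also have "\<dots> = sw H x (\<lambda>x1 x2. sw H y (\<lambda>p r. sw H r (\<lambda>p2 q. sc (l (x1 * p)) (x2 * (p2 * S q)))))"
    by (intro sw_cong HOL.refl sw_coassoc[where t = sc]) (intro li)+
  also have "\<dots> = sw H x (\<lambda>x1 x2. sw H y (\<lambda>p r. sc (ep r) (sc (l (x1 * p)) x2)))"
    by (intro sw_cong HOL.refl, subst sw_antipode_right[where t = sc]) (intro li, simp add: unit_right)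
  also have "\<dots> = sw H x (\<lambda>x1 x2. sc (l (x1 * y)) x2)"
    by (intro sw_cong HOL.refl sw_counit_right'[where t = sc]) (intro li)
  finally show ?thesis ..
qed

text \<open>Mirror image: \<open>S(x\<^sub>1) x\<^sub>2 y\<^sub>1 l(x\<^sub>3 y\<^sub>2)\<close> is
  evaluated from both ends.\<close>

lemma cointegral_shift_left:
  assumes "cointegral l"
  shows "sw H y (\<lambda>u v. sc (l (x * v)) u) = sw H x (\<lambda>u v. sc (l (v * y)) (S u))"
proof -
  note l = cointegralD[OF assms]
  note li = lin_intros linear_functional[OF l(1)]
  have 1: "sc (l (v * y)) (S u) = sw H y (\<lambda>y1 y2. sw H v (\<lambda>v1 v2. sc (l (v2 * y2)) (S u * v1 * y1)))" for u v
  proof -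
    have "sc (l (v * y)) (S u) = S u * sw H (v * y) (\<lambda>a b. sc (l b) a)"
      by (simp add: l(3) scale_mult_right unit_right)
    also have "sw H (v * y) (\<lambda>a b. sc (l b) a) = sw H v (\<lambda>v1 v2. sw H y (\<lambda>y1 y2. sc (l (v2 * y2)) (v1 * y1)))"
      by (rule sw_mult[where t = sc]) (intro li)+
    finally show ?thesis
      unfolding sw_swap[of H v H y] by (simp add: sw_mult_left[symmetric] scale_mult_right mult.assoc)
  qed
  have "sw H x (\<lambda>u v. sc (l (v * y)) (S u))
    = sw H y (\<lambda>y1 y2. sw H x (\<lambda>u v. sw H v (\<lambda>v1 v2. sc (l (v2 * y2)) (S u * v1 * y1))))"
    unfolding 1 by (rule sw_swap)
  also have "\<dots> = sw H y (\<lambda>y1 y2. sw H x (\<lambda>r v. sw H r (\<lambda>u v1. sc (l (v * y2)) (S u * v1 * y1))))"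
    by (intro sw_cong HOL.refl sw_coassoc[where t = sc, symmetric]) (intro li)+
  also have "\<dots> = sw H y (\<lambda>y1 y2. sw H x (\<lambda>r v. sc (ep r) (sc (l (v * y2)) y1)))"
    by (intro sw_cong HOL.refl, subst sw_antipode_left[where t = sc]) (intro li, simp add: unit_left)
  also have "\<dots> = sw H y (\<lambda>y1 y2. sc (l (x * y2)) y1)"
    by (intro sw_cong HOL.refl sw_counit_left'[where t = sc]) (intro li)
  finally show ?thesis ..
qed

context
  fixes l t
  assumes l: "cointegral l" "l one = 1" and t: "integral t" "ep t = 1"
begin

lemmas l_lin = cointegralD(1)[OF l(1)]
lemmas l_intros = lin_intros linear_functional[OF l_lin]

text \<open>In the shift formula \<open>x\<^sub>2 t = \<epsilon>(x\<^sub>2) t\<close> removes the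
  coproduct of \<open>x\<close>. Up to the antipode and the constant \<open>l t\<close>, the
  coproduct of \<open>t\<close> thus provides dual bases for the form \<open>l(x y)\<close>.\<close>

lemma integral_dual_left: "sw H t (\<lambda>u v. sc (l (x * v)) u) = sc (l t) (S x)"
proof -
  have "sw H t (\<lambda>u v. sc (l (x * v)) u) = sw H x (\<lambda>u v. sc (ep v) (sc (l t) (S u)))"
    by (simp add: cointegral_shift_left[OF l(1)] integralD[OF t(1)] linearD(2)[OF l_lin] mult.commute)
  also have "\<dots> = sc (l t) (S x)"
    by (rule sw_counit_right'[where t = sc]) (intro lin_intros)
  finally show ?thesis .
qed

lemma integral_dual_right: "sw H t (\<lambda>u v. sc (l (u * y)) v) = sc (l t) (S y)"
proof -
  have "sw H t (\<lambda>u v. sc (l (u * y)) v) = sw H y (\<lambda>u v. sc (ep u) (sc (l t) (S v)))"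
    by (simp add: cointegral_shift_right[OF l(1)] integralD[OF t(1)] linearD(2)[OF l_lin] mult.commute)
  also have "\<dots> = sc (l t) (S y)"
    by (rule sw_counit_left'[where t = sc]) (intro lin_intros)
  finally show ?thesis .
qed

lemma integral_dual_mult: "sw H t (\<lambda>u v. sc (l (x * u)) (S v)) = sc (l t) x"
proof -
  have "sw H t (\<lambda>u v. sc (l (x * u)) (S v)) = sw H x (\<lambda>u v. sc (ep u) (sc (l t) v))"
    by (simp add: cointegral_shift_right[OF l(1), symmetric] integralD[OF t(1)] linearD(2)[OF l_lin] mult.commute)
  also have "\<dots> = sc (l t) x"
    by (rule sw_counit_left'[where t = sc]) (intro lin_intros)
  finally show ?thesis .
qed

text \<open>If \<open>l t\<close> were zero, \<open>t\<^sub>1 l(x t\<^sub>2)\<close> would vanish for all \<open>x\<close>, hence so would \<open>l(S(t\<^sub>1) t\<^sub>2) = \<epsilon>(t) l(1) = 1\<close>.\<close>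

lemma cointegral_integral_nonzero:
  assumes "finite_dimensional_vector_space sc R"
  shows "l t \<noteq> 0"
proof
  assume lt: "l t = 0"
  interpret R: finite_dimensional_vector_space sc R by fact
  let ?r = "representation R"
  have rl: "lin (*) (\<lambda>v. ?r v b)" for b
    by (rule linear_representation[OF R.independent_Basis R.span_Basis])
  have r: "(\<Sum>b\<in>R. sc (?r x b) b) = x" for x
    by (rule sum_representation_eq[OF R.independent_Basis]) (auto simp: R.span_Basis R.finite_Basis)
  have "1 = sw H t (\<lambda>u v. l (S u * v))"
    by (subst sw_antipode_left[OF l_lin]) (simp add: t l)
  \<comment> \<open>The first argument of the form must be a constant for the vanishing to apply;
    expanding \<open>u\<close> in the basis puts the constants \<open>S b\<close> there.\<close>
  also have "\<dots> = sw H t (\<lambda>u v. \<Sum>b\<in>R. ?r (sc (l (S b * v)) u) b)"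
  proof (intro sw_cong HOL.refl)
    fix u v
    have "lin (*) (\<lambda>x. l (S x * v))" by (intro l_intros)
    then interpret f: Vector_Spaces.linear sc "(*)" "\<lambda>x. l (S x * v)" .
    have "l (S u * v) = l (S (\<Sum>b\<in>R. sc (?r u b) b) * v)" by (simp only: r)
    also have "\<dots> = (\<Sum>b\<in>R. ?r u b * l (S b * v))" by (simp only: f.sum f.scale)
    finally show "l (S u * v) = (\<Sum>b\<in>R. ?r (sc (l (S b * v)) u) b)"
      by (simp add: linearD(2)[OF rl] mult.commute)
  qed
  also have "\<dots> = (\<Sum>b\<in>R. sw H t (\<lambda>u v. ?r (sc (l (S b * v)) u) b))"
    by (rule sw_sum)
  also have "\<dots> = 0"
    by (simp add: linear_sw[OF rl, symmetric] integral_dual_left lt linearD(3)[OF rl])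
  finally show False by simp
qed

context
  fixes R
  assumes R: "finite_dimensional_vector_space sc R"
begin

lemmas l_nz = cointegral_integral_nonzero[OF R]

lemma cointegral_nondegenerate:
  assumes "\<And>y. l (x * y) = l (x' * y)"
  shows "x = x'"
proof -
  have "sc (l t) x = sc (l t) x'" unfolding integral_dual_mult[symmetric] by (simp add: assms)
  then show ?thesis using l_nz by (simp add: scale_left_imp_eq)
qed

text \<open>Applies \<open>l\<close> to \<open>t\<^sub>1 l(x t\<^sub>2) = l(t) S(x)\<close> and uses
  \<open>l(t\<^sub>1) t\<^sub>2 = l(t) 1\<close>; the nonzero factor \<open>l t\<close> is then
  cancelled.\<close>

lemma cointegral_S: "l (S x) = l x"
proof -
  have "l t * l (S x) = l (sw H t (\<lambda>u v. sc (l (x * v)) u))"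
    by (simp add: integral_dual_left linearD(2)[OF l_lin])
  also have "\<dots> = sw H t (\<lambda>u v. l (x * sc (l u) v))"
    by (simp add: linear_sw[OF l_lin] linearD(2)[OF l_lin] scale_mult_right mult.commute)
  also have "\<dots> = l (x * sw H t (\<lambda>u v. sc (l u) v))"
    by (simp add: sw_mult_left[symmetric] linear_sw[OF l_lin])
  also have "\<dots> = l t * l x"
    by (simp add: cointegralD(2)[OF l(1)] scale_mult_right unit_right linearD(2)[OF l_lin])
  finally show ?thesis using l_nz by simp
qed

text \<open>Both sides times \<open>l t\<close> equal \<open>l(t\<^sub>1 y) l(z t\<^sub>2)\<close>,
  computed by the two dual basis formulas.\<close>

lemma cointegral_mult_S: "l (z * S y) = l (S z * y)"
proof -
  have "l t * l (z * S y) = l (z * sw H t (\<lambda>u v. sc (l (u * y)) v))"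
    by (simp add: integral_dual_right scale_mult_right linearD(2)[OF l_lin])
  also have "\<dots> = sw H t (\<lambda>u v. l (u * y) * l (z * v))"
    by (simp add: sw_mult_left[symmetric] linear_sw[OF l_lin] scale_mult_right linearD(2)[OF l_lin])
  also have "\<dots> = l (sw H t (\<lambda>u v. sc (l (z * v)) u) * y)"
    by (simp add: sw_mult_right[symmetric] linear_sw[OF l_lin] scale_mult_left linearD(2)[OF l_lin] mult.commute)
  also have "\<dots> = l t * l (S z * y)"
    by (simp add: integral_dual_left scale_mult_left linearD(2)[OF l_lin])
  finally show ?thesis using l_nz by simp
qed

text \<open>Removing \<open>S\<^sup>2\<close> from either argument of the form \<open>l(x y)\<close>
  exchanges the arguments, so \<open>S\<^sup>2\<close> is both the Nakayama automorphism and its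
  inverse; nondegeneracy concludes.\<close>

lemma S4_aux: "S (S (S (S z))) = z"
proof (rule cointegral_nondegenerate)
  fix y
  have 1: "l (z * S (S y)) = l (y * z)" for z y
    by (simp add: cointegral_mult_S S_mult[symmetric] cointegral_S)
  have 2: "l (S (S z) * y) = l (y * z)" for z y
    by (simp add: cointegral_mult_S[symmetric] S_mult[symmetric] cointegral_S)
  show "l (S (S (S (S z))) * y) = l (z * y)" by (simp only: 1 2)
qed

end

end

lemma S4:
  assumes "finite_dimensional_vector_space sc R" "semisimple_algebra sc" "cosemisimple_coalgebra H"
  shows "S (S (S (S z))) = z"
  using cosemisimple_cointegral[OF assms(3)] semisimple_integral[OF assms(2)] S4_aux[OF _ _ _ _ assms(1)]
  by blast

section \<open>The separability idempotent\<close>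

definition sep :: "'e \<Rightarrow> ('e \<Rightarrow> 'e \<Rightarrow> 'x::comm_monoid_add) \<Rightarrow> 'x" where
  "sep t \<beta> = sw H t (\<lambda>x y. \<beta> (S x) y)"

context
  fixes t
  assumes t: "integral t" "ep t = 1"
begin

lemma sep_mult: "lin s f \<Longrightarrow> sep t (\<lambda>x y. f (x * y)) = f one"
  unfolding sep_def by (subst sw_antipode_left[where t = s]) (simp_all add: t linearD(7) vector_space.vector_space_assms(4))

context
  fixes s :: "'k \<Rightarrow> 'x::ab_group_add \<Rightarrow> 'x" and \<beta> :: "'e \<Rightarrow> 'e \<Rightarrow> 'x"
  assumes b: "\<And>v. lin s (\<lambda>u. \<beta> u v)" "\<And>u. lin s (\<lambda>v. \<beta> u v)"
begin

lemma lin_b1: "Vector_Spaces.linear r sc f \<Longrightarrow> Vector_Spaces.linear r s (\<lambda>x. \<beta> (f x) v)"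
  by (rule linear_comp[OF _ b(1)])

lemma lin_b2: "Vector_Spaces.linear r sc f \<Longrightarrow> Vector_Spaces.linear r s (\<lambda>x. \<beta> u (f x))"
  by (rule linear_comp[OF _ b(2)])

lemma lin_scale_s: "Vector_Spaces.linear r s f \<Longrightarrow> Vector_Spaces.linear r s (\<lambda>x. s c (f x))"
  by (rule linear_comp[OF _ vector_space.linear_scale_self[OF linearD(7)[OF b(1)]]])

lemmas b_intros = lin_intros lin_b1 lin_b2 lin_scale_s

lemma lin_sep: "(\<And>u v. Vector_Spaces.linear r s (\<lambda>y. f y u v)) \<Longrightarrow> Vector_Spaces.linear r s (\<lambda>y. sep t (f y))"
  unfolding sep_def by (rule linear_sw_param)

text \<open>Right invariance of \<open>t\<close> creates \<open>w\<^sub>1 S(t\<^sub>1 w\<^sub>2)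
  \<otimes> t\<^sub>2 w\<^sub>3\<close>, in which \<open>w\<^sub>1 S(w\<^sub>2)\<close>
  collapses.\<close>

lemma sep_central: "sep t (\<lambda>x y. \<beta> (w * x) y) = sep t (\<lambda>x y. \<beta> x (y * w))"
proof -
  have t1: "sw H t (\<lambda>a b. sw H p (\<lambda>p1 p2. \<beta> (z * S (a * p1)) (b * p2))) = s (ep p) (sep t (\<lambda>x y. \<beta> (z * x) y))" for p z
  proof -
    have "sw H (t * p) (\<lambda>a b. \<beta> (z * S a) b) = sw H t (\<lambda>a b. sw H p (\<lambda>p1 p2. \<beta> (z * S (a * p1)) (b * p2)))"
      by (rule sw_mult[where t = s]) (intro b_intros)+
    moreover have "sw H (sc (ep p) t) (\<lambda>a b. \<beta> (z * S a) b) = s (ep p) (sw H t (\<lambda>a b. \<beta> (z * S a) b))"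
      by (rule sw_scale_arg) (intro b_intros)+
    ultimately show ?thesis by (simp add: integralD[OF t(1)] sep_def)
  qed
  have "sep t (\<lambda>x y. \<beta> (w * x) y) = sw H w (\<lambda>p q. s (ep q) (sep t (\<lambda>x y. \<beta> (p * x) y)))"
    by (rule sw_counit_right'[where t = s, symmetric]) (intro lin_sep b_intros)
  also have "\<dots> = sw H w (\<lambda>p q. sw H q (\<lambda>q1 q2. sw H t (\<lambda>a b. \<beta> (p * S (a * q1)) (b * q2))))"
    by (simp only: t1[symmetric] sw_swap[of H t])
  also have "\<dots> = sw H w (\<lambda>p q. sw H p (\<lambda>p1 p2. sw H t (\<lambda>a b. \<beta> (p1 * S (a * p2)) (b * q))))"
    by (rule sw_coassoc[where t = s, symmetric]) (intro b_intros)+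
  also have "\<dots> = sw H t (\<lambda>a b. sw H w (\<lambda>p q. sw H p (\<lambda>p1 p2. \<beta> (p1 * S p2 * S a) (b * q))))"
    by (simp only: sw_swap[of H _ H t] S_mult mult.assoc)
  also have "\<dots> = sw H t (\<lambda>a b. sw H w (\<lambda>p q. s (ep p) (\<beta> (S a) (b * q))))"
    by (intro sw_cong HOL.refl, subst sw_antipode_right[where t = s]) (intro b_intros, simp add: unit_left)
  also have "\<dots> = sep t (\<lambda>x y. \<beta> x (y * w))"
    unfolding sep_def by (intro sw_cong HOL.refl sw_counit_left'[where t = s]) (intro b_intros)
  finally show ?thesis .
qed

text \<open>Left invariance of \<open>t\<close> this time: in \<open>S(w\<^sub>2 t\<^sub>1)
  S\<^sup>2(w\<^sub>1) \<otimes> w\<^sub>3 t\<^sub>2\<close> the factors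
  \<open>S(w\<^sub>2) S\<^sup>2(w\<^sub>1)\<close> collapse. Unlike centrality, this rule is twisted
  by \<open>S\<^sup>2\<close>.\<close>

lemma sep_inner: "sep t (\<lambda>x y. \<beta> (x * S (S w)) y) = sep t (\<lambda>x y. \<beta> x (w * y))"
proof -
  have t1: "sw H p (\<lambda>p1 p2. sw H t (\<lambda>a b. \<beta> (S (p1 * a) * z) (p2 * b))) = s (ep p) (sep t (\<lambda>x y. \<beta> (x * z) y))" for p z
  proof -
    have "sw H (p * t) (\<lambda>a b. \<beta> (S a * z) b) = sw H p (\<lambda>p1 p2. sw H t (\<lambda>a b. \<beta> (S (p1 * a) * z) (p2 * b)))"
      by (rule sw_mult[where t = s]) (intro b_intros)+
    moreover have "sw H (sc (ep p) t) (\<lambda>a b. \<beta> (S a * z) b) = s (ep p) (sw H t (\<lambda>a b. \<beta> (S a * z) b))"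
      by (rule sw_scale_arg) (intro b_intros)+
    ultimately show ?thesis by (simp add: integralD[OF t(1)] sep_def)
  qed
  have "sep t (\<lambda>x y. \<beta> (x * S (S w)) y) = sw H w (\<lambda>p q. s (ep q) (sep t (\<lambda>x y. \<beta> (x * S (S p)) y)))"
    by (rule sw_counit_right'[where t = s, symmetric]) (intro lin_sep b_intros)
  also have "\<dots> = sw H w (\<lambda>p q. sw H q (\<lambda>q1 q2. sw H t (\<lambda>a b. \<beta> (S (q1 * a) * S (S p)) (q2 * b))))"
    by (simp only: t1)
  also have "\<dots> = sw H w (\<lambda>p q. sw H p (\<lambda>p1 p2. sw H t (\<lambda>a b. \<beta> (S (p2 * a) * S (S p1)) (q * b))))"
    by (rule sw_coassoc[where t = s, symmetric]) (intro b_intros)+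
  also have "\<dots> = sw H t (\<lambda>a b. sw H w (\<lambda>p q. sw H p (\<lambda>p1 p2. \<beta> (S a * S (S p1 * p2)) (q * b))))"
    by (simp only: sw_swap[of H _ H t] S_mult mult.assoc)
  also have "\<dots> = sw H t (\<lambda>a b. sw H w (\<lambda>p q. s (ep p) (\<beta> (S a) (q * b))))"
    by (intro sw_cong HOL.refl, subst sw_antipode_left[where t = s]) (intro b_intros, simp add: S_one unit_right)
  also have "\<dots> = sep t (\<lambda>x y. \<beta> x (w * y))"
    unfolding sep_def by (intro sw_cong HOL.refl sw_counit_left'[where t = s]) (intro b_intros)
  finally show ?thesis .
qed

end

text \<open>Since \<open>S\<^sup>4 = 1\<close>, the previous lemma moves \<open>w\<^sub>1\<close> across as \<open>S\<^sup>2(w\<^sub>1)\<close>, and \<open>S(w\<^sub>2) S\<^sup>2(w\<^sub>1) = S(S(w\<^sub>1) w\<^sub>2)\<close>.\<close>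

lemma sep_inner_invariant:
  assumes S4: "\<And>z. S (S (S (S z))) = z"
    and b: "\<And>v. lin s (\<lambda>u. \<beta> u v)" "\<And>u. lin s (\<lambda>v. \<beta> u v)"
  shows "sw H w (\<lambda>p q. sep t (\<lambda>x y. \<beta> (x * p) (S q * y))) = s (ep w) (sep t \<beta>)"
proof -
  note li = b_intros[of s \<beta>, OF b]
  have "sep t (\<lambda>x y. \<beta> (x * S (S (S (S p)))) (S q * y)) = sep t (\<lambda>x y. \<beta> x (S q * (S (S p) * y)))" for p q
    by (rule sep_inner[where s = s]) (intro li)+
  then have "sw H w (\<lambda>p q. sep t (\<lambda>x y. \<beta> (x * p) (S q * y))) = sw H w (\<lambda>p q. sep t (\<lambda>x y. \<beta> x (S (S p * q) * y)))"
    by (simp add: S4 S_mult mult.assoc)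
  also have "\<dots> = s (ep w) (sep t (\<lambda>x y. \<beta> x (S one * y)))"
    by (rule sw_antipode_left) (intro lin_sep[where s = s and \<beta> = \<beta>, OF b] li)
  finally show ?thesis by (simp add: S_one unit_left)
qed

end

end

context smash_product
begin

abbreviation io :: "'e \<Rightarrow> 'b" where "io \<equiv> sm uA"
abbreviation adjB :: "'b \<Rightarrow> 'e \<Rightarrow> 'b" where "adjB \<equiv> adj H uA sm"
abbreviation ev where "ev \<equiv> eval_diag H uA sB sm"

lemma lin_io: "H.lin sB io"
  using sm_bilinear by (simp add: bilinear_map_def)

lemma io_mult: "io w * io w' = io (w * w')"
proof -
  have l: "Vector_Spaces.linear sA sB (\<lambda>a. sm a v)" for v
    using sm_bilinear by (simp add: bilinear_map_def)
  have "io w * io w' = sw H w (\<lambda>u v. sB (H.ep u) (io (v * w')))"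
    by (simp add: sm_mult act_on_unit A.unit_left linearD(2)[OF l] sw_def)
  also have "\<dots> = io (w * w')"
    by (rule H.sw_counit_left'[where t = sB]) (intro linear_comp[OF _ lin_io] H.lin_intros)
  finally show ?thesis .
qed

lemma adj_eq: "adjB b w = sw H w (\<lambda>u v. io (H.S u) * b * io v)"
  by (simp add: adj_def sw_def)

lemma linear_io: "Vector_Spaces.linear s H.sc f \<Longrightarrow> Vector_Spaces.linear s sB (\<lambda>x. io (f x))"
  by (rule linear_comp[OF _ lin_io])

lemma linear_multB_left: "Vector_Spaces.linear s sB f \<Longrightarrow> Vector_Spaces.linear s sB (\<lambda>x. f x * c)"
  by (auto simp: Vector_Spaces.linear_iff distrib_right B.scale_mult_left)

lemma linear_multB_right: "Vector_Spaces.linear s sB f \<Longrightarrow> Vector_Spaces.linear s sB (\<lambda>x. c * f x)"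
  by (auto simp: Vector_Spaces.linear_iff distrib_left B.scale_mult_right)

lemma linear_scB: "Vector_Spaces.linear s sB f \<Longrightarrow> Vector_Spaces.linear s sB (\<lambda>x. sB c (f x))"
  by (rule linear_comp[OF _ B.linear_scale_self])

lemma linear_scB_left: "Vector_Spaces.linear s (*) f \<Longrightarrow> Vector_Spaces.linear s sB (\<lambda>x. sB (f x) c)"
  by (auto simp: Vector_Spaces.linear_iff B.scale_left_distrib B.vector_space_axioms)

lemmas B_intros0 = linear_io linear_multB_left linear_multB_right linear_scB linear_scB_left
  B.linear_ident H.lin_intros

lemma lin_adj_w: "H.lin sB (\<lambda>w. adjB b w)"
  unfolding adj_eq by (intro B_intros0)

lemma lin_adj_b: "Vector_Spaces.linear sB sB (\<lambda>b. adjB b w)"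
  unfolding adj_eq by (intro B_intros0)

lemma linear_adj_w: "Vector_Spaces.linear s H.sc f \<Longrightarrow> Vector_Spaces.linear s sB (\<lambda>x. adjB b (f x))"
  by (rule linear_comp[OF _ lin_adj_w])

lemma linear_adj_b: "Vector_Spaces.linear s sB f \<Longrightarrow> Vector_Spaces.linear s sB (\<lambda>x. adjB (f x) w)"
  by (rule linear_comp[OF _ lin_adj_b])

lemmas B_intros = linear_adj_w linear_adj_b B_intros0

lemma adj_adj: "adjB (adjB b v) w = adjB b (v * w)"
proof -
  have "adjB b (v * w) = sw H v (\<lambda>v1 v2. sw H w (\<lambda>w1 w2. io (H.S (v1 * w1)) * b * io (v2 * w2)))"
    unfolding adj_eq by (rule H.sw_mult[where t = sB]) (intro B_intros)+
  also have "\<dots> = sw H w (\<lambda>w1 w2. sw H v (\<lambda>v1 v2. io (H.S w1) * (io (H.S v1) * b * io v2) * io w2))"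
    unfolding sw_swap[of H v] by (simp add: H.S_mult io_mult[symmetric] mult.assoc)
  also have "\<dots> = adjB (adjB b v) w"
    by (simp only: adj_eq sw_mult_left sw_mult_right)
  finally show ?thesis ..
qed

lemma adj_one: "adjB b H.one = b"
proof -
  have "adjB b H.one = io (H.S H.one) * b * io H.one"
    unfolding adj_eq by (rule H.sw_one[where t = sB]) (intro B_intros)+
  then show ?thesis by (simp add: H.S_one sm_unit B.unit_left B.unit_right)
qed

text \<open>On the right the inner factors \<open>w\<^sub>2 S(w\<^sub>3)\<close> cancel; this is why
  multiplication is an equivariant cochain.\<close>

lemma adj_mult: "adjB (b * c) w = sw H w (\<lambda>p q. adjB b p * adjB c q)"
proof -
  have "sw H w (\<lambda>p q. adjB b p * adjB c q)
    = sw H w (\<lambda>p q. sw H p (\<lambda>p1 p2. sw H q (\<lambda>q1 q2. io (H.S p1) * b * io (p2 * H.S q1) * c * io q2)))"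
    unfolding adj_eq sw_mult_left[symmetric] sw_mult_right[symmetric]
    by (simp add: io_mult[symmetric] mult.assoc) (rule sw_cong, rule HOL.refl, rule sw_swap)
  also have "\<dots> = sw H w (\<lambda>p1 r. sw H r (\<lambda>p2 q. sw H q (\<lambda>q1 q2. io (H.S p1) * b * io (p2 * H.S q1) * c * io q2)))"
    by (rule H.sw_coassoc[where t = sB]) (intro B_intros)+
  also have "\<dots> = sw H w (\<lambda>p1 r. sw H r (\<lambda>m q2. sw H m (\<lambda>p2 q1. io (H.S p1) * b * io (p2 * H.S q1) * c * io q2)))"
    by (intro sw_cong HOL.refl H.sw_coassoc[where t = sB, symmetric]) (intro B_intros)+
  also have "\<dots> = sw H w (\<lambda>p1 r. sw H r (\<lambda>m q2. sB (H.ep m) (io (H.S p1) * b * c * io q2)))"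
    by (intro sw_cong HOL.refl, subst H.sw_antipode_right[where t = sB])
      (intro B_intros, simp add: sm_unit B.unit_right)
  also have "\<dots> = sw H w (\<lambda>p1 r. io (H.S p1) * b * c * io r)"
    by (intro sw_cong HOL.refl H.sw_counit_left'[where t = sB]) (intro B_intros)
  finally show ?thesis by (simp add: adj_eq mult.assoc)
qed

section \<open>The diagonal action\<close>

definition mlin :: "('b list \<Rightarrow> 'b) \<Rightarrow> bool" where
  "mlin f \<longleftrightarrow> madd f \<and> mscale sB f"

lemma mlin_linear: "mlin f \<Longrightarrow> Vector_Spaces.linear sB sB (\<lambda>b. f (us @ b # vs))"
  by (simp add: mlin_def madd_def mscale_def Vector_Spaces.linear_iff B.vector_space_axioms)

lemma mlinI: "(\<And>us vs. Vector_Spaces.linear sB sB (\<lambda>b. f (us @ b # vs))) \<Longrightarrow> mlin f"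
  by (simp add: mlin_def madd_def mscale_def Vector_Spaces.linear_iff)

lemma mlin_hd: "mlin f \<Longrightarrow> Vector_Spaces.linear sB sB (\<lambda>b. f (b # vs))"
  using mlin_linear[of f "[]"] by simp

lemma linear_slot: "mlin f \<Longrightarrow> Vector_Spaces.linear s sB g \<Longrightarrow> Vector_Spaces.linear s sB (\<lambda>x. f (us @ g x # vs))"
  by (rule linear_comp[OF _ mlin_linear])

lemma linear_hd: "mlin f \<Longrightarrow> Vector_Spaces.linear s sB g \<Longrightarrow> Vector_Spaces.linear s sB (\<lambda>x. f (g x # vs))"
  by (rule linear_comp[OF _ mlin_hd])

lemma mlin_append: "mlin f \<Longrightarrow> mlin (\<lambda>cs. f (us @ cs))"
proof (rule mlinI)
  fix us' vs
  assume "mlin f"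
  then show "Vector_Spaces.linear sB sB (\<lambda>b. f (us @ us' @ b # vs))"
    using mlin_linear[of f "us @ us'" vs] by simp
qed

lemma mlin_Cons: "mlin f \<Longrightarrow> mlin (\<lambda>cs. f (b # cs))"
  using mlin_append[of f "[b]"] by simp

lemma ev_Cons: "ev (b # bs) f w = sw H w (\<lambda>u v. ev bs (\<lambda>cs. f (adjB b u # cs)) v)"
  by (simp add: sw_def)

declare eval_diag.simps(2) [simp del]

lemma linear_ev_fun:
  "(\<And>cs. Vector_Spaces.linear s sB (\<lambda>y. F y cs)) \<Longrightarrow> Vector_Spaces.linear s sB (\<lambda>y. ev bs (F y) w)"
  by (induction bs arbitrary: F w) (auto simp: ev_Cons intro!: linear_scB H.linear_sw_param)

lemma lin_ev: "mlin f \<Longrightarrow> H.lin sB (\<lambda>w. ev bs f w)"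
proof (induction bs arbitrary: f)
  case Nil
  then show ?case by (simp, intro B_intros)
next
  case (Cons b bs)
  show ?case
    unfolding ev_Cons
    by (intro H.lin_sw linear_ev_fun linear_hd[OF Cons.prems] Cons.IH mlin_Cons[OF Cons.prems] B_intros)
qed

lemma linear_ev: "mlin f \<Longrightarrow> Vector_Spaces.linear s H.sc g \<Longrightarrow> Vector_Spaces.linear s sB (\<lambda>x. ev bs f (g x))"
  by (rule linear_comp[OF _ lin_ev])

lemma ev_cong:
  "(\<And>cs. length cs = length bs \<Longrightarrow> f cs = g cs) \<Longrightarrow> ev bs f w = ev bs g w"
proof (induction bs arbitrary: f g w)
  case (Cons b bs)
  show ?case unfolding ev_Cons by (intro sw_cong HOL.refl Cons.IH) (simp add: Cons.prems)
qed simp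

lemma ev_apply:
  "Vector_Spaces.linear sB sB g \<Longrightarrow> ev bs (\<lambda>cs. g (f cs)) w = g (ev bs f w)"
  by (induction bs arbitrary: f w) (simp_all add: ev_Cons linearD(2) linear_sw[of sB sB g])

lemma ev_zero: "ev bs (\<lambda>cs. 0) w = 0"
  by (induction bs arbitrary: w) (simp_all add: ev_Cons sw_zero)

lemma ev_add: "ev bs (\<lambda>cs. f cs + g cs) w = ev bs f w + ev bs g w"
  by (induction bs arbitrary: f g w) (simp_all add: ev_Cons sw_add B.scale_right_distrib)

lemma ev_diff: "ev bs (\<lambda>cs. f cs - g cs) w = ev bs f w - ev bs g w"
  using ev_add[of bs "\<lambda>cs. f cs - g cs" g w] by (simp add: algebra_simps)

lemma ev_ksign: "ev bs (\<lambda>cs. ksign p (f cs)) w = ksign p (ev bs f w)"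
  using ev_diff[of bs "\<lambda>cs. 0" f w] by (simp add: ksign_def ev_zero)

lemma ev_sw: "ev bs (\<lambda>cs. sw H x (\<lambda>u v. F u v cs)) w = sw H x (\<lambda>u v. ev bs (F u v) w)"
proof (induction bs arbitrary: F w)
  case Nil
  then show ?case by (simp add: linear_sw[OF B.linear_scale_self])
next
  case (Cons b bs)
  show ?case unfolding ev_Cons Cons.IH by (rule sw_swap)
qed

lemma mlin_ev: "mlin f \<Longrightarrow> mlin (\<lambda>cs. ev bs (\<lambda>ds. f (cs @ ds)) w)"
proof (rule mlinI)
  fix us vs assume "mlin f"
  then have "Vector_Spaces.linear sB sB (\<lambda>b. ev bs (\<lambda>ds. f (us @ b # (vs @ ds))) w)"
    by (intro linear_ev_fun mlin_linear)
  then show "Vector_Spaces.linear sB sB (\<lambda>b. ev bs (\<lambda>ds. f ((us @ b # vs) @ ds)) w)"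
    by simp
qed

lemma ev_append:
  "mlin f \<Longrightarrow> ev (xs @ ys) f w = sw H w (\<lambda>p q. ev xs (\<lambda>cs. ev ys (\<lambda>ds. f (cs @ ds)) q) p)"
proof (induction xs arbitrary: f w)
  case Nil
  then show ?case by (simp add: H.sw_counit_left'[OF lin_ev])
next
  case (Cons b xs)
  note li = linear_ev_fun linear_hd[OF Cons.prems] linear_ev[OF mlin_ev[OF mlin_Cons[OF Cons.prems], simplified]]
    linear_ev[OF mlin_append[OF mlin_Cons[OF Cons.prems]]] B_intros
  have "ev ((b # xs) @ ys) f w
      = sw H w (\<lambda>u v. sw H v (\<lambda>p q. ev xs (\<lambda>cs. ev ys (\<lambda>ds. f (adjB b u # cs @ ds)) q) p))"
    by (simp add: ev_Cons Cons.IH[OF mlin_Cons[OF Cons.prems]])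
  also have "\<dots> = sw H w (\<lambda>r q. sw H r (\<lambda>u p. ev xs (\<lambda>cs. ev ys (\<lambda>ds. f (adjB b u # cs @ ds)) q) p))"
    by (rule H.sw_coassoc[where t = sB, symmetric]) (intro li)+
  finally show ?case by (simp add: ev_Cons)
qed

lemma ev_one: "mlin f \<Longrightarrow> ev bs f H.one = f bs"
proof (induction bs arbitrary: f)
  case Nil
  then show ?case by (simp add: H.counit_unit)
next
  case (Cons b bs)
  note li = linear_ev_fun linear_hd[OF Cons.prems] linear_ev[OF mlin_Cons[OF Cons.prems]] B_intros
  have "ev (b # bs) f H.one = ev bs (\<lambda>cs. f (adjB b H.one # cs)) H.one"
    unfolding ev_Cons by (rule H.sw_one[where t = sB]) (intro li)+
  then show ?case by (simp add: adj_one Cons.IH[OF mlin_Cons[OF Cons.prems]])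
qed

text \<open>The adjoint action is a right action, so the outer argument \<open>w\<close> acts first
  and stands on the left of the product.\<close>

lemma ev_ev: "mlin f \<Longrightarrow> ev bs (\<lambda>cs. ev cs f v) w = ev bs f (w * v)"
proof (induction bs arbitrary: f w v)
  case Nil
  then show ?case by (simp add: H.counit_mult)
next
  case (Cons b bs)
  note li = linear_ev_fun linear_hd[OF Cons.prems] linear_ev[OF mlin_Cons[OF Cons.prems]] B_intros
  have "ev (b # bs) (\<lambda>cs. ev cs f v) w
      = sw H w (\<lambda>p q. sw H v (\<lambda>u s. ev bs (\<lambda>cs. f (adjB b (p * u) # cs)) (q * s)))"
    by (simp add: ev_Cons ev_sw adj_adj Cons.IH[OF mlin_Cons[OF Cons.prems]])
  also have "\<dots> = sw H (w * v) (\<lambda>x y. ev bs (\<lambda>cs. f (adjB b x # cs)) y)"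
    by (rule H.sw_mult[where t = sB, symmetric]) (intro li)+
  finally show ?case by (simp add: ev_Cons)
qed

section \<open>Equivariant cochains\<close>

text \<open>Linearity for the adjoint action. This form avoids the inverse antipode of
  \<open>cochain_act\<close> and is stable under insertion; \<open>invariant_iff_eqv\<close>
  identifies it with invariance.\<close>

definition eqv :: "('b list \<Rightarrow> 'b) \<Rightarrow> bool" where
  "eqv f \<longleftrightarrow> (\<forall>bs w. ev bs f w = adjB (f bs) w)"

lemma eqv_lincomb:
  assumes "eqv f" "eqv g"
  shows "eqv (\<lambda>bs. f bs + g bs)" "eqv (\<lambda>bs. f bs - g bs)" "eqv (\<lambda>bs. ksign p (f bs))"
    "eqv (\<lambda>bs. sB c (f bs))"
  using assms linearD[OF lin_adj_b]
  by (auto simp: eqv_def ev_add ev_diff ev_ksign ev_apply[OF B.linear_scale_self]) (simp add: ksign_def)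

lemma mlin_ins_arg:
  assumes "mlin f" "mlin g"
  shows "mlin (\<lambda>cs. f (g (take n cs) # drop n cs))"
proof (rule mlinI)
  fix us vs
  show "Vector_Spaces.linear sB sB (\<lambda>b. f (g (take n (us @ b # vs)) # drop n (us @ b # vs)))"
  proof (cases "n \<le> length us")
    case True
    then show ?thesis
      using mlin_linear[OF assms(1), of "g (take n us) # drop n us" vs] by simp
  next
    case False
    then obtain k where k: "n - length us = Suc k" by (cases "n - length us") auto
    have "Vector_Spaces.linear sB sB (\<lambda>b. f (g (us @ b # take k vs) # drop k vs))"
      by (intro linear_hd[OF assms(1)] mlin_linear[OF assms(2)])
    then show ?thesis using False k by simp
  qed
qed

text \<open>The diagonal action splits into a part on the block of \<open>g\<close> and a part on
  the rest; equivariance turns the former into the action on the value of \<open>g\<close>.\<close>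

lemma ev_ins_arg:
  assumes "mlin f" "mlin g" "eqv g" "arity n g"
  shows "ev bs (\<lambda>cs. f (g (take n cs) # drop n cs)) w = ev (g (take n bs) # drop n bs) f w"
proof (cases "n \<le> length bs")
  case False
  then have "ev bs (\<lambda>cs. f (g (take n cs) # drop n cs)) w = ev bs (\<lambda>cs. 0) w"
    using linearD(3)[OF mlin_hd[OF assms(1)]] by (intro ev_cong) (simp add: arity_eq_0[OF assms(4)])
  moreover have "ev (0 # cs) f w = 0" for cs
    by (simp add: ev_Cons linearD(3)[OF lin_adj_b] linearD(3)[OF mlin_hd[OF assms(1)]] ev_zero sw_zero)
  ultimately show ?thesis
    using False by (simp add: ev_zero arity_eq_0[OF assms(4)])
next
  case True
  have "ev bs (\<lambda>cs. f (g (take n cs) # drop n cs)) w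
    = sw H w (\<lambda>p q. ev (take n bs) (\<lambda>cs. ev (drop n bs) (\<lambda>ds. f (g (take n (cs @ ds)) # drop n (cs @ ds))) q) p)"
    using ev_append[OF mlin_ins_arg[OF assms(1,2)], of "take n bs" "drop n bs" n w] by simp
  also have "\<dots> = sw H w (\<lambda>p q. ev (take n bs) (\<lambda>cs. ev (drop n bs) (\<lambda>ds. f (g cs # ds)) q) p)"
    using True by (intro sw_cong HOL.refl ev_cong) simp
  also have "\<dots> = sw H w (\<lambda>p q. ev (drop n bs) (\<lambda>ds. f (ev (take n bs) g p # ds)) q)"
    by (intro sw_cong HOL.refl ev_apply linear_ev_fun mlin_hd[OF assms(1)])
  finally show ?thesis using assms(3) by (simp add: ev_Cons eqv_def)
qed

lemma ins_sw: "ins n g (\<lambda>cs. sw H w (\<lambda>u v. F u v cs)) bs = sw H w (\<lambda>u v. ins n g (F u v) bs)"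
  by (induction bs arbitrary: F) (simp_all add: sw_ksign sw_add)

lemma ins_apply: "Vector_Spaces.linear sB sB h \<Longrightarrow> ins n g (\<lambda>cs. h (f cs)) bs = h (ins n g f bs)"
  by (induction bs arbitrary: f) (simp_all add: linearD(1,4) ksign_def)

lemma ev_ins:
  assumes "mlin f" "mlin g" "eqv g" "arity n g"
  shows "ev bs (ins n g f) w = ins n g (\<lambda>cs. ev cs f w) bs"
  using assms(1)
proof (induction bs arbitrary: f w)
  case Nil
  have "sB (H.ep w) (f [g []]) = ev [g []] f w"
    using ev_ins_arg[OF Nil assms(2-4), of "[]" w] by simp
  then show ?case by simp
next
  case (Cons b bs)
  have 1: "ev (b # bs) (\<lambda>cs. f (g (take n cs) # drop n cs)) w = ev (g (take n (b # bs)) # drop n (b # bs)) f w"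
    by (rule ev_ins_arg[OF Cons.prems assms(2-4)])
  have "ev (b # bs) (ins n g f) w
    = ev (b # bs) (\<lambda>cs. f (g (take n cs) # drop n cs)) w
      + ksign (n + 1) (sw H w (\<lambda>u v. ev bs (ins n g (\<lambda>cs. f (adjB b u # cs))) v))"
    unfolding ev_Cons ins.simps ev_add ev_ksign sw_add sw_ksign ..
  also have "sw H w (\<lambda>u v. ev bs (ins n g (\<lambda>cs. f (adjB b u # cs))) v)
      = ins n g (\<lambda>cs. ev (b # cs) f w) bs"
    unfolding ev_Cons ins_sw Cons.IH[OF mlin_Cons[OF Cons.prems]] ..
  finally show ?case unfolding 1 by simp
qed

lemma eqv_ins:
  assumes "mlin f" "mlin g" "eqv f" "eqv g" "arity n g"
  shows "eqv (ins n g f)"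
  using assms(3) ev_ins[OF assms(1,2,4,5)] by (simp add: eqv_def ins_apply[OF lin_adj_b])

lemma eqv_mult_cochain: "eqv mult_cochain"
  unfolding eqv_def
proof (intro allI)
  fix bs w
  show "ev bs mult_cochain w = adjB (mult_cochain bs) w"
  proof (cases "length bs = 2")
    case False
    then have "ev bs mult_cochain w = ev bs (\<lambda>cs. 0) w"
      by (intro ev_cong) (simp add: arity_eq_0[OF arity_mult_cochain])
    then show ?thesis
      using False by (simp add: ev_zero arity_eq_0[OF arity_mult_cochain] linearD(3)[OF lin_adj_b])
  next
    case True
    then obtain a b where bs: "bs = [a, b]" by (auto simp: length_Suc_conv numeral_2_eq_2)
    have "sw H v (\<lambda>p q. sB (H.ep q) (adjB a u * adjB b p)) = adjB a u * adjB b v" for u v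
      by (rule H.sw_counit_right'[where t = sB]) (intro B_intros)
    then show ?thesis by (simp add: bs ev_Cons adj_mult)
  qed
qed

lemma eqv_bracket:
  assumes f: "f \<in> cochains sB m" "eqv f" and g: "g \<in> cochains sB n" "eqv g"
  shows "eqv (gerstenhaber_bracket m n f g)"
  unfolding B.bracket_eq_ins[OF f(1) g(1)]
  using B.cochainsD[OF f(1)] B.cochainsD[OF g(1)] f(2) g(2)
  by (intro eqv_lincomb eqv_ins) (simp_all add: mlin_def)

lemma eqv_hochschild_d:
  assumes "f \<in> cochains sB n" "eqv f"
  shows "eqv (hochschild_d n f)"
  using eqv_bracket[OF B.mult_cochain_mem eqv_mult_cochain assms]
  by (simp add: hochschild_d_eq_bracket B.cochainsD[OF assms(1)])

lemma eqv_delta: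
  assumes "f \<in> cochains sB n" "eqv f"
  shows "eqv (delta f)"
proof -
  have "delta f = (\<lambda>bs. ksign (n + 1) (hochschild_d n f bs))"
    by (simp add: hochschild_d_eq_delta B.cochainsD[OF assms(1)]) (simp add: ksign_def)
  then show ?thesis using eqv_lincomb(3)[OF eqv_hochschild_d[OF assms] eqv_hochschild_d[OF assms]] by simp
qed

section \<open>Invariant cochains and the braided differential\<close>

context
  assumes S4: "\<And>z. H.S (H.S (H.S (H.S z))) = z"
begin

lemma inv_S: "inv H.S v = H.S (H.S (H.S v))"
  by (rule inv_f_eq) (metis S4 injI, rule S4)

text \<open>Image of the antipode axiom under \<open>S\<^sup>3\<close>, which is the inverse of
  \<open>S\<close> here and reverses products.\<close>

lemma sw_inv_S_left: "H.lin t f \<Longrightarrow> sw H w (\<lambda>u v. f (inv H.S v * u)) = t (H.ep w) (f H.one)"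
proof -
  assume f: "H.lin t f"
  have "inv H.S v * u = H.S (H.S (H.S (H.S u * v)))" for u v
    by (simp add: H.S_mult S4 inv_S)
  then show ?thesis
    using H.sw_antipode_left[where f = "\<lambda>x. f (H.S (H.S (H.S x)))" and t = t and x = w]
    by (simp add: H.S_one linear_comp[OF _ f] H.lin_intros)
qed

lemma sw_inv_S_right: "H.lin t f \<Longrightarrow> sw H w (\<lambda>u v. f (v * inv H.S u)) = t (H.ep w) (f H.one)"
proof -
  assume f: "H.lin t f"
  have "v * inv H.S u = H.S (H.S (H.S (u * H.S v)))" for u v
    by (simp add: H.S_mult S4 inv_S)
  then show ?thesis
    using H.sw_antipode_right[where f = "\<lambda>x. f (H.S (H.S (H.S x)))" and t = t and x = w]
    by (simp add: H.S_one linear_comp[OF _ f] H.lin_intros)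
qed

lemma linear_inv_S: "Vector_Spaces.linear s H.sc f \<Longrightarrow> Vector_Spaces.linear s H.sc (\<lambda>x. inv H.S (f x))"
  unfolding inv_S by (intro H.lin_intros)

lemma cochain_act_eq: "cochain_act H uA sB sm w f bs = sw H w (\<lambda>u v. adjB (ev bs f (inv H.S v)) u)"
  by (simp add: cochain_act_def sw_def)

text \<open>Invariants of an internal Hom are the module maps. One direction cancels the inverse
  antipode of \<open>w\<^sub>2\<close> against \<open>w\<^sub>1\<close> on its right, the other that
  of \<open>w\<^sub>1\<close> against \<open>w\<^sub>2\<close> on its left.\<close>

lemma invariant_iff_eqv:
  assumes "mlin f"
  shows "(\<forall>w. cochain_act H uA sB sm w f = fscale sB (H.ep w) f) \<longleftrightarrow> eqv f"
proof
  assume f: "eqv f"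
  show "\<forall>w. cochain_act H uA sB sm w f = fscale sB (H.ep w) f"
  proof (intro allI ext)
    fix w bs
    have "cochain_act H uA sB sm w f bs = sw H w (\<lambda>u v. adjB (f bs) (inv H.S v * u))"
      using f by (simp add: cochain_act_eq eqv_def adj_adj)
    also have "\<dots> = sB (H.ep w) (adjB (f bs) H.one)"
      by (rule sw_inv_S_left[OF lin_adj_w])
    finally show "cochain_act H uA sB sm w f bs = fscale sB (H.ep w) f bs"
      by (simp add: adj_one fscale_def)
  qed
next
  assume "\<forall>w. cochain_act H uA sB sm w f = fscale sB (H.ep w) f"
  then have f: "sB (H.ep w) (f bs) = sw H w (\<lambda>u v. adjB (ev bs f (inv H.S v)) u)" for w bs
    by (simp add: fscale_def fun_eq_iff cochain_act_eq)
  note li = linear_ev[OF assms] linear_inv_S B_intros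
  show "eqv f"
    unfolding eqv_def
  proof (intro allI)
    fix bs w
    have "ev bs f w = sw H w (\<lambda>p q. sB (H.ep p) (ev bs f q))"
      by (rule H.sw_counit_left'[OF lin_ev[OF assms], symmetric])
    also have "\<dots> = sw H w (\<lambda>p q. sw H p (\<lambda>u v. adjB (ev bs f (q * inv H.S v)) u))"
      unfolding ev_apply[OF B.linear_scale_self, symmetric] f ev_sw ev_apply[OF lin_adj_b] ev_ev[OF assms] ..
    also have "\<dots> = sw H w (\<lambda>u r. sw H r (\<lambda>v q. adjB (ev bs f (q * inv H.S v)) u))"
      by (rule H.sw_coassoc[where t = sB]) (intro li)+
    also have "\<dots> = sw H w (\<lambda>u r. sB (H.ep r) (adjB (ev bs f H.one) u))"
      by (intro sw_cong HOL.refl sw_inv_S_right) (intro li)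
    also have "\<dots> = adjB (ev bs f H.one) w"
      by (rule H.sw_counit_right'[OF lin_adj_w])
    finally show "ev bs f w = adjB (f bs) w" by (simp add: ev_one[OF assms])
  qed
qed

lemma invariant_cochains_eq:
  "invariant_cochains H uA sB uB sm n = {f \<in> normalized_cochains sB uB n. eqv f}"
proof -
  have "mlin f" if "f \<in> normalized_cochains sB uB n" for f
    using that B.cochainsD by (auto simp: normalized_cochains_def mlin_def)
  then show ?thesis using invariant_iff_eqv by (auto simp: invariant_cochains_def)
qed

end

text \<open>Whatever expression of \<open>b\<close> the choice operator picks, applying the counit
  to its coaction recovers its sum, which is \<open>b\<close>.\<close>

lemma dual_act_counit: "dual_act H sB sm H.ep b = b"
proof -
  let ?M = "SOME M. b = (\<Sum>(a, w)\<in>#M. sm a w)"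
  have l: "H.lin sB (sm a)" for a
    using sm_bilinear by (simp add: bilinear_map_def)
  have "b = (\<Sum>(a, w)\<in>#?M. sm a w)"
    by (rule someI_ex[OF sm_surj])
  also have "\<dots> = (\<Sum>(a, w)\<in>#?M. sw H w (\<lambda>u v. sB (H.ep v) (sm a u)))"
    by (simp add: H.sw_counit_right'[OF l])
  also have "\<dots> = dual_act H sB sm H.ep b"
    by (simp add: dual_act_def coaction_def sum_mset_sum_mset case_prod_unfold image_mset.compositionality o_def sw_def)
  finally show ?thesis ..
qed

text \<open>On an invariant cochain \<open>r\<^sub>j\<close> acts by the scalar
  \<open>\<epsilon>(r\<^sub>j)\<close>, and the sum of
  \<open>\<epsilon>(r\<^sub>j) r\<^sup>j\<close> over the dual bases is the counit, which fixes the
  first entry.\<close>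

lemma braided_d_invariant:
  assumes R: "finite_dimensional_vector_space H.sc R"
    and f: "\<And>w. cochain_act H uA sB sm w f = fscale sB (H.ep w) f"
  shows "braided_d H R uA sB sm n f = hochschild_d n f"
proof -
  interpret R: finite_dimensional_vector_space H.sc R by fact
  let ?r = "H.representation R"
  have ep: "(\<Sum>r\<in>R. ?r x r * H.ep r) = H.ep x" for x
  proof -
    interpret e: Vector_Spaces.linear H.sc "(*)" H.ep by (rule H.counit_linear)
    have "H.ep x = H.ep (\<Sum>r\<in>R. H.sc (?r x r) r)"
      by (subst H.sum_representation_eq[OF R.independent_Basis]) (auto simp: R.span_Basis R.finite_Basis)
    then show ?thesis by (simp add: e.sum e.scale)
  qed
  have "(\<Sum>r\<in>R. dual_act H sB sm (\<lambda>x. ?r x r) b * cochain_act H uA sB sm r f bs) = b * f bs" for b bs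
  proof -
    have "(\<Sum>r\<in>R. dual_act H sB sm (\<lambda>x. ?r x r) b * cochain_act H uA sB sm r f bs)
      = (\<Sum>r\<in>R. \<Sum>(x, v)\<in>#coaction H sm b. sB (?r v r * H.ep r) x * f bs)"
      by (simp add: f fscale_def dual_act_def sum_mset_distrib_right case_prod_unfold
        B.scale_mult_left B.scale_mult_right linear_sum_mset_aux[OF B.linear_scale_self] mult.commute)
    also have "\<dots> = (\<Sum>(x, v)\<in>#coaction H sm b. (\<Sum>r\<in>R. sB (?r v r * H.ep r) x * f bs))"
    proof -
      have "(\<Sum>r\<in>A. \<Sum>z\<in>#M. g r z) = (\<Sum>z\<in>#M. \<Sum>r\<in>A. g r z)" for M :: "('b \<times> 'e) multiset" and A :: "'e set" and g :: "'e \<Rightarrow> 'b \<times> 'e \<Rightarrow> 'b"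
        by (induction A rule: infinite_finite_induct) (simp_all add: sum_mset.distrib)
      then show ?thesis unfolding case_prod_unfold .
    qed
    also have "\<dots> = dual_act H sB sm H.ep b * f bs"
      by (simp add: sum_distrib_right[symmetric] B.scale_sum_left[symmetric] ep dual_act_def
        sum_mset_distrib_right case_prod_unfold)
    finally show ?thesis by (simp add: dual_act_counit)
  qed
  then show ?thesis by (simp add: braided_d_def hochschild_d_def fun_eq_iff)
qed

end

section \<open>Splitting the differential at a slot\<close>

text \<open>Products of adjacent entries inside the list only. With \<open>delta_pre\<close> it
  collects the terms of \<open>delta\<close> that leave a marked slot and everything behind it
  untouched.\<close>

fun merges :: "('b::ring list \<Rightarrow> 'b) \<Rightarrow> 'b list \<Rightarrow> 'b" where
  "merges g (u # c # us) = - g ((u * c) # us) - merges (\<lambda>cs. g (u # cs)) (c # us)"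
| "merges g _ = 0"

fun delta_pre :: "('b::ring list \<Rightarrow> 'b) \<Rightarrow> 'b list \<Rightarrow> 'b" where
  "delta_pre g [] = 0"
| "delta_pre g (u # us) = u * g us + merges g (u # us)"

text \<open>The face between two halves of a list: \<open>v\<close> multiplies the last entry of the
  left half or, if that is empty, the value from the left. Joining both cases lets slot 0 share the
  formulas of the other slots.\<close>

fun act_end :: "('b::ring list \<Rightarrow> 'b) \<Rightarrow> 'b list \<Rightarrow> 'b \<Rightarrow> 'b list \<Rightarrow> 'b" where
  "act_end f [] v vs = v * f vs"
| "act_end f [c] v vs = f ((c * v) # vs)"
| "act_end f (a # c # us) v vs = act_end (\<lambda>cs. f (a # cs)) (c # us) v vs"

lemma act_end_snoc [simp]: "act_end f (us @ [c]) v vs = f (us @ (c * v) # vs)"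
proof (induction us arbitrary: f)
  case (Cons a us)
  then show ?case by (cases us) auto
qed simp

lemma d_tail_split:
  "us \<noteq> [] \<Longrightarrow> d_tail f (us @ v # vs) = merges (\<lambda>cs. f (cs @ v # vs)) us
    + ksign (length us) (act_end f us v vs + d_tail (\<lambda>cs. f (us @ cs)) (v # vs))"
proof (induction us arbitrary: f)
  case (Cons u us)
  show ?case
  proof (cases us)
    case Nil
    then show ?thesis by (simp add: ksign_def)
  next
    case (Cons c us')
    then show ?thesis using Cons.IH[of "\<lambda>cs. f (u # cs)"]
      by (simp add: ksign_def)
  qed
qed simp

lemma delta_split:
  "delta f (us @ v # vs) = delta_pre (\<lambda>cs. f (cs @ v # vs)) us
    + ksign (length us) (act_end f us v vs + d_tail (\<lambda>cs. f (us @ cs)) (v # vs))"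
proof (cases us)
  case Nil
  then show ?thesis by (simp add: ksign_def)
next
  case (Cons u us')
  then show ?thesis using d_tail_split[of us f v vs] by simp
qed

lemma merges_cong: "(\<And>cs. length cs + 1 = length us \<Longrightarrow> g cs = g' cs) \<Longrightarrow> merges g us = merges g' us"
proof (induction g us arbitrary: g' rule: merges.induct)
  case (1 g u c us)
  then show ?case by simp
qed simp_all

lemma delta_pre_cong:
  assumes "\<And>cs. length cs + 1 = length us \<Longrightarrow> g cs = g' cs"
  shows "delta_pre g us = delta_pre g' us"
proof (cases us)
  case (Cons u us')
  have "merges g us = merges g' us" by (rule merges_cong) (rule assms)
  then show ?thesis using assms[of us'] Cons by simp
qed simp

lemma merges_zero: "merges (\<lambda>cs. 0) us = 0"
proof (induction us)
  case (Cons u us)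
  then show ?case by (cases us) simp_all
qed simp

lemma delta_pre_eq_0:
  assumes "\<And>cs. length cs + 1 = length us \<Longrightarrow> g cs = 0"
  shows "delta_pre g us = 0"
proof -
  have "delta_pre g us = delta_pre (\<lambda>cs. 0) us"
    by (rule delta_pre_cong) (rule assms)
  then show ?thesis by (cases us) (simp_all add: merges_zero)
qed

lemma merges_sw: "merges (\<lambda>cs. sw H x (\<lambda>u v. F u v cs)) us = sw H x (\<lambda>u v. merges (F u v) us)"
proof (induction us arbitrary: F)
  case (Cons u us)
  show ?case
  proof (cases us)
    case (Cons c us')
    then show ?thesis
      using Cons.IH[of "\<lambda>a b cs. F a b (u # cs)"]
      by (simp add: sw_minus sw_diff)
  qed (simp add: sw_zero)
qed (simp add: sw_zero)

lemma delta_pre_sw: "delta_pre (\<lambda>cs. sw H x (\<lambda>u v. F u v cs)) us = sw H x (\<lambda>u v. delta_pre (F u v) us)"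
  by (cases us) (simp_all add: sw_zero merges_sw sw_add sw_mult_left)

lemma d_tail_sw: "d_tail (\<lambda>cs. sw H x (\<lambda>u v. F u v cs)) us = sw H x (\<lambda>u v. d_tail (F u v) us)"
proof (induction us arbitrary: F)
  case (Cons u us)
  show ?case
  proof (cases us)
    case Nil
    then show ?thesis by (simp add: sw_minus sw_mult_right)
  next
    case (Cons c us')
    then show ?thesis
      using Cons.IH[of "\<lambda>a b cs. F a b (u # cs)"]
      by (simp add: sw_minus sw_diff)
  qed
qed (simp add: sw_zero)

lemma d_tail_cong: "(\<And>cs. length cs + 1 = length us \<Longrightarrow> g cs = g' cs) \<Longrightarrow> d_tail g us = d_tail g' us"
proof (induction g us arbitrary: g' rule: d_tail.induct)
  case (3 g u c us)
  then show ?case by simp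
qed simp_all

lemma delta_cong:
  assumes "\<And>cs. length cs + 1 = length us \<Longrightarrow> g cs = g' cs"
  shows "delta g us = delta g' us"
proof (cases us)
  case (Cons u us')
  have "d_tail g us = d_tail g' us" by (rule d_tail_cong) (rule assms)
  then show ?thesis using assms[of us'] Cons by simp
qed simp

context smash_product
begin

lemma linear_act_end_fun:
  "(\<And>cs. Vector_Spaces.linear s sB (\<lambda>y. F y cs)) \<Longrightarrow> Vector_Spaces.linear s sB (\<lambda>y. act_end (F y) us v vs)"
proof (induction us arbitrary: F)
  case Nil
  show ?case by (simp, intro linear_multB_right Nil)
next
  case (Cons a us)
  then show ?case by (cases us) simp_all
qed

lemma linear_act_end_mid: "mlin f \<Longrightarrow> Vector_Spaces.linear s sB g \<Longrightarrow> Vector_Spaces.linear s sB (\<lambda>x. act_end f us (g x) vs)"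
  by (cases us rule: rev_cases) (auto intro!: linear_multB_left linear_multB_right linear_slot)

lemma linear_act_end_right: "mlin f \<Longrightarrow> Vector_Spaces.linear s sB g
    \<Longrightarrow> Vector_Spaces.linear s sB (\<lambda>x. act_end f us v (as @ g x # vs))"
  using linear_slot[of f s g "butlast us @ (last us * v) # as" vs] linear_slot[of f s g as vs]
  by (cases us rule: rev_cases) (simp_all add: linear_multB_right)

lemma linear_act_end_left: "mlin f \<Longrightarrow> Vector_Spaces.linear sB sB (\<lambda>b. act_end f (as @ b # us) v vs)"
proof (induction as arbitrary: f)
  case Nil
  show ?case
  proof (cases us)
    case Nil
    then show ?thesis using mlin_hd[OF \<open>mlin f\<close>] by (simp, intro linear_hd \<open>mlin f\<close> B_intros)
  next
    case (Cons c us')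
    then show ?thesis using linear_act_end_fun[OF mlin_hd[OF \<open>mlin f\<close>]] by simp
  qed
next
  case (Cons a as)
  from Cons.IH[OF mlin_Cons[OF Cons.prems], of a] show ?case by (cases as) simp_all
qed

section \<open>Inserting the separability idempotent\<close>

text \<open>The contracting homotopy: the idempotent goes behind the first \<open>i\<close> entries,
  its first factor absorbed by \<open>act_end\<close>, so the arity drops by one. On lists shorter
  than \<open>i\<close> the value 0 is a default.\<close>

definition cins :: "'e \<Rightarrow> nat \<Rightarrow> ('b list \<Rightarrow> 'b) \<Rightarrow> 'b list \<Rightarrow> 'b" where
  "cins t i f bs = (if length bs < i then 0
     else H.sep t (\<lambda>x y. act_end f (take i bs) (io x) (io y # drop i bs)))"

lemma cins_append: "cins t (length us) f (us @ vs) = H.sep t (\<lambda>x y. act_end f us (io x) (io y # vs))"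
  by (simp add: cins_def)

lemma cins_short: "length bs < i \<Longrightarrow> cins t i f bs = 0"
  by (simp add: cins_def)

lemma sep_cong: "(\<And>x y. \<beta> x y = \<gamma> x y) \<Longrightarrow> H.sep t \<beta> = H.sep t \<gamma>"
  by (simp add: H.sep_def)

lemma sep_zero: "H.sep t (\<lambda>x y. 0) = 0"
  by (simp add: H.sep_def sw_zero)

lemma sep_add: "H.sep t (\<lambda>x y. \<beta> x y + \<gamma> x y) = H.sep t \<beta> + H.sep t \<gamma>"
  by (simp add: H.sep_def sw_add)

lemma sep_diff: "H.sep t (\<lambda>x y. \<beta> x y - \<gamma> x y) = H.sep t \<beta> - H.sep t (\<gamma> :: 'e \<Rightarrow> 'e \<Rightarrow> 'x::ab_group_add)"
  using sep_add[of t "\<lambda>x y. \<beta> x y - \<gamma> x y" \<gamma>] by (simp add: algebra_simps)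

lemma sep_ksign: "H.sep t (\<lambda>x y. ksign p (\<beta> x y)) = ksign p (H.sep t \<beta>)"
  by (simp add: H.sep_def sw_ksign)

lemma sep_sw: "H.sep t (\<lambda>x y. sw H w (\<lambda>u v. F x y u v)) = sw H w (\<lambda>u v. H.sep t (\<lambda>x y. F x y u v))"
  unfolding H.sep_def by (rule sw_swap)

lemma linear_sep: "Vector_Spaces.linear s r f \<Longrightarrow> f (H.sep t \<beta>) = H.sep t (\<lambda>x y. f (\<beta> x y))"
  unfolding H.sep_def by (rule linear_sw)

lemma linear_sep_param: "(\<And>u v. Vector_Spaces.linear r s (\<lambda>y. f y u v)) \<Longrightarrow> Vector_Spaces.linear r s (\<lambda>y. H.sep t (f y))"
  unfolding H.sep_def by (rule H.linear_sw_param)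

lemma cins_Suc_Suc: "cins t (Suc (Suc i)) f (b # bs) = cins t (Suc i) (\<lambda>cs. f (b # cs)) bs"
proof (cases bs)
  case (Cons c bs')
  show ?thesis unfolding cins_def Cons take_Suc_Cons act_end.simps by simp
qed (simp add: cins_def)

lemma cins_Suc_0: "cins t (Suc 0) f (b # bs) = H.sep t (\<lambda>x y. f ((b * io x) # io y # bs))"
  by (simp add: cins_def)

lemma cins_0: "cins t 0 f bs = H.sep t (\<lambda>x y. io x * f (io y # bs))"
  by (simp add: cins_def)

lemma mlin_cins:
  assumes "mlin f"
  shows "mlin (cins t i f)"
proof (rule mlinI)
  fix us vs
  show "Vector_Spaces.linear sB sB (\<lambda>b. cins t i f (us @ b # vs))"
  proof (cases "length us + length vs + 1 < i")
    case True
    then show ?thesis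
      by (simp add: cins_def Vector_Spaces.linear_iff B.vector_space_axioms)
  next
    case F: False
    show ?thesis
    proof (cases "i \<le> length us")
      case True
      have "Vector_Spaces.linear sB sB (\<lambda>b. H.sep t (\<lambda>x y. act_end f (take i us) (io x) ((io y # drop i us) @ b # vs)))"
        by (intro linear_sep_param linear_act_end_right[OF assms] B.linear_ident)
      then show ?thesis using True by (simp add: cins_def)
    next
      case False
      then obtain k where k: "i - length us = Suc k" by (cases "i - length us") auto
      have "Vector_Spaces.linear sB sB (\<lambda>b. H.sep t (\<lambda>x y. act_end f (us @ b # take k vs) (io x) (io y # drop k vs)))"
        by (intro linear_sep_param linear_act_end_left[OF assms])
      then show ?thesis using False F k by (simp add: cins_def)
    qed
  qed
qed

lemma act_end_eq_0:
  assumes "\<And>cs. length cs = (if us = [] then 0 else length us) + length vs \<Longrightarrow> f cs = 0"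
  shows "act_end f us v vs = 0"
  using assms by (cases us rule: rev_cases) simp_all

lemma cins_eq_0:
  assumes "arity n f" "length bs + 1 \<noteq> n"
  shows "cins t i f bs = 0"
proof (cases "length bs < i")
  case False
  have "act_end f (take i bs) (io x) (io y # drop i bs) = 0" for x y
    using False assms by (intro act_end_eq_0 arity_eq_0[OF assms(1)]) (auto split: if_splits)
  then show ?thesis by (simp add: cins_def sep_zero)
qed (simp add: cins_def)

text \<open>Used for \<open>f\<close> and \<open>delta f\<close> together, which encodes
  E-relativity in the first \<open>i\<close> slots. The projections pass both conditions on because
  they commute with \<open>delta\<close>.\<close>

definition van :: "nat \<Rightarrow> ('b list \<Rightarrow> 'b) \<Rightarrow> bool" where
  "van i f \<longleftrightarrow> (\<forall>us w vs. length us < i \<longrightarrow> f (us @ io w # vs) = 0)"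

definition nrm :: "('b list \<Rightarrow> 'b) \<Rightarrow> bool" where
  "nrm f \<longleftrightarrow> (\<forall>bs. uB \<in> set bs \<longrightarrow> f bs = 0)"

lemma normalized_cochains_iff: "f \<in> normalized_cochains sB uB n \<longleftrightarrow> f \<in> cochains sB n \<and> nrm f"
  by (auto simp: normalized_cochains_def nrm_def)

lemma nrm_delta:
  assumes "nrm f"
  shows "nrm (delta f)"
  unfolding nrm_def
proof (intro allI impI)
  fix bs assume "uB \<in> set bs"
  then obtain us vs where bs: "bs = us @ uB # vs" by (auto simp: in_set_conv_decomp)
  have z: "f cs = 0" if "uB \<in> set cs" for cs using that assms by (simp add: nrm_def)
  have "act_end f us uB vs + d_tail (\<lambda>cs. f (us @ cs)) (uB # vs) = 0"
    using z by (cases us rule: rev_cases; cases vs) (simp_all add: B.unit_left B.unit_right d_tail_zero z)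
  then show "delta f bs = 0"
    unfolding bs delta_split by (simp add: z delta_pre_eq_0)
qed

lemma nrm_cins:
  assumes "nrm f" "van i f"
  shows "nrm (cins t i f)"
  unfolding nrm_def
proof (intro allI impI)
  fix bs assume u: "uB \<in> set bs"
  have z: "f cs = 0" if "uB \<in> set cs" for cs using assms(1) that by (simp add: nrm_def)
  show "cins t i f bs = 0"
  proof (cases "length bs < i")
    case False
    define us vs where "us = take i bs" and "vs = drop i bs"
    have bs: "bs = us @ vs" "length us = i" using False by (simp_all add: us_def vs_def)
    have "act_end f us (io x) (io y # vs) = 0" for x y
    proof (cases us rule: rev_cases)
      case Nil
      then show ?thesis using u bs by (simp add: z)
    next
      case (snoc us' c)
      \<comment> \<open>A unit in front of the insertion disappears into \<open>io x\<close>, so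
        normalization no longer applies. That entry lies in E at a slot before \<open>i\<close>,
        where \<open>f\<close> vanishes already; this is one reason to treat the slots in increasing
        order.\<close>
      then have "f (us' @ (c * io x) # io y # vs) = 0" if "c = uB"
        using assms(2) bs(2) that by (simp add: van_def B.unit_left)
      then show ?thesis using u bs(1) snoc by (cases "c = uB") (auto simp: z)
    qed
    then show ?thesis unfolding bs(1) using cins_append[of t us f vs] bs(2) by (simp add: sep_zero)
  qed (simp add: cins_def)
qed

section \<open>Equivariance of the insertion\<close>

lemma ev_cins_aux: "ev bs (\<lambda>cs. H.sep t (\<lambda>x y. F x y cs)) w = H.sep t (\<lambda>x y. ev bs (F x y) w)"
  unfolding H.sep_def by (rule ev_sw)

lemma io_adj: "adjB (io x) w = io (sw H w (\<lambda>u v. H.S u * x * v))"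
  by (simp add: adj_eq io_mult linear_sw[OF lin_io])

context
  fixes t
  assumes t: "H.integral t" "H.ep t = 1" and S4: "\<And>z. H.S (H.S (H.S (H.S z))) = z"
begin

text \<open>Four pieces of \<open>w\<close> frame the two factors. The inner pair is removed by
  \<open>sep_inner_invariant\<close>; then centrality carries \<open>S(w\<^sub>1)\<close> across to
  meet the last piece.\<close>

lemma sep_adj:
  assumes b: "\<And>v. H.lin s (\<lambda>u. \<beta> u v)" "\<And>u. H.lin s (\<lambda>v. \<beta> u v)"
  shows "sw H w (\<lambda>p q. H.sep t (\<lambda>x y. \<beta> (sw H p (\<lambda>u v. H.S u * x * v)) (sw H q (\<lambda>u v. H.S u * y * v))))
    = s (H.ep w) (H.sep t \<beta>)"
proof -
  have b1: "Vector_Spaces.linear r s (\<lambda>x. \<beta> (f x) v)" if "Vector_Spaces.linear r H.sc f" for r f v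
    by (rule linear_comp[OF that b(1)])
  have b2: "Vector_Spaces.linear r s (\<lambda>x. \<beta> u (f x))" if "Vector_Spaces.linear r H.sc f" for r f u
    by (rule linear_comp[OF that b(2)])
  note li = linear_sep_param linear_comp[OF _ vector_space.linear_scale_self[OF linearD(7)[OF b(1)]]] b1 b2 H.lin_intros
  let ?X = "\<lambda>w1 w2 w3 w4. H.sep t (\<lambda>x y. \<beta> (H.S w1 * x * w2) (H.S w3 * y * w4))"
  have "sw H w (\<lambda>p q. H.sep t (\<lambda>x y. \<beta> (sw H p (\<lambda>u v. H.S u * x * v)) (sw H q (\<lambda>u v. H.S u * y * v))))
    = sw H w (\<lambda>p q. sw H p (\<lambda>w1 w2. sw H q (\<lambda>w3 w4. ?X w1 w2 w3 w4)))"
    by (simp add: linear_sw[OF b(1)] linear_sw[OF b(2)] sep_sw) (rule sw_cong, rule HOL.refl, rule sw_swap)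
  also have "\<dots> = sw H w (\<lambda>w1 r. sw H r (\<lambda>w2 q. sw H q (\<lambda>w3 w4. ?X w1 w2 w3 w4)))"
    by (rule H.sw_coassoc[where t = s]) (intro li)+
  also have "\<dots> = sw H w (\<lambda>w1 r. sw H r (\<lambda>m w4. sw H m (\<lambda>w2 w3. ?X w1 w2 w3 w4)))"
    by (intro sw_cong HOL.refl H.sw_coassoc[where t = s, symmetric]) (intro li)+
  also have "\<dots> = sw H w (\<lambda>w1 r. sw H r (\<lambda>m w4. s (H.ep m) (H.sep t (\<lambda>x y. \<beta> (H.S w1 * x) (y * w4)))))"
  proof (intro sw_cong HOL.refl)
    fix w1 w4 m
    show "sw H m (\<lambda>w2 w3. ?X w1 w2 w3 w4) = s (H.ep m) (H.sep t (\<lambda>x y. \<beta> (H.S w1 * x) (y * w4)))"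
      unfolding mult.assoc[of _ _ w4] mult.assoc[of "H.S w1"]
      using H.sep_inner_invariant[OF t S4, of s "\<lambda>x y. \<beta> (H.S w1 * x) (y * w4)" m]
      by (simp add: li mult.assoc)
  qed
  also have "\<dots> = sw H w (\<lambda>w1 r. H.sep t (\<lambda>x y. \<beta> (H.S w1 * x) (y * r)))"
    by (intro sw_cong HOL.refl H.sw_counit_left'[where t = s]) (intro li)
  also have "\<dots> = sw H w (\<lambda>w1 r. H.sep t (\<lambda>x y. \<beta> x (y * (H.S w1 * r))))"
  proof (intro sw_cong HOL.refl)
    fix w1 r
    show "H.sep t (\<lambda>x y. \<beta> (H.S w1 * x) (y * r)) = H.sep t (\<lambda>x y. \<beta> x (y * (H.S w1 * r)))"
      using H.sep_central[OF t, of s "\<lambda>x y. \<beta> x (y * r)" "H.S w1"]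
      by (simp add: li mult.assoc)
  qed
  also have "\<dots> = s (H.ep w) (H.sep t (\<lambda>x y. \<beta> x (y * H.one)))"
    by (rule H.sw_antipode_left) (intro li)
  finally show ?thesis by (simp add: H.unit_right)
qed

text \<open>Coassociativity isolates the two pieces of \<open>w\<close> that act on the inserted
  factors, and \<open>sep_adj\<close> removes them. Slot 0 is left to \<open>eqv_cins\<close>, since
  there the first factor multiplies the value rather than an entry.\<close>

lemma ev_cins_Suc:
  assumes "mlin f"
  shows "ev bs (cins t (Suc i) f) w = cins t (Suc i) (\<lambda>cs. ev cs f w) bs"
  using assms
proof (induction i arbitrary: bs f w)
  case 0
  show ?case
  proof (cases bs)
    case Nil
    then show ?thesis by (simp add: cins_short)
  next
    case (Cons c vs)
    note li = linear_ev_fun linear_hd[OF 0] linear_slot[OF 0, of _ _ "[_]", simplified]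
      linear_ev[OF mlin_Cons[OF mlin_Cons[OF 0]]] linear_sep_param B_intros
    let ?Y = "\<lambda>a b r s x y. ev vs (\<lambda>ds. f ((adjB c a * adjB (io x) b) # adjB (io y) r # ds)) s"
    have "cins t (Suc 0) (\<lambda>cs. ev cs f w) bs
      = sw H w (\<lambda>p z. sw H p (\<lambda>a b. sw H z (\<lambda>r s. H.sep t (?Y a b r s))))"
    proof -
      have "ev ((c * io x) # io y # vs) f w = sw H w (\<lambda>p z. sw H p (\<lambda>a b. sw H z (\<lambda>r s. ?Y a b r s x y)))" for x y
      proof -
        have "sw H z (\<lambda>r s. ev vs (\<lambda>ds. f (adjB (c * io x) p # adjB (io y) r # ds)) s)
          = sw H p (\<lambda>a b. sw H z (\<lambda>r s. ?Y a b r s x y))" for p z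
        proof -
          have "ev vs (\<lambda>ds. f (adjB (c * io x) p # adjB (io y) r # ds)) s = sw H p (\<lambda>a b. ?Y a b r s x y)" for r s
            unfolding adj_mult
            by (rule linear_sw[where s = sB and t = sB and f = "\<lambda>z. ev vs (\<lambda>ds. f (z # adjB (io y) r # ds)) s"])
              (intro linear_ev_fun mlin_hd[OF 0])
          then show ?thesis by (simp add: sw_swap[of H z])
        qed
        then show ?thesis by (simp add: ev_Cons)
      qed
      then show ?thesis by (simp add: Cons cins_Suc_0 sep_sw)
    qed
    also have "\<dots> = sw H w (\<lambda>a q. sw H q (\<lambda>b z. sw H z (\<lambda>r s. H.sep t (?Y a b r s))))"
      by (rule H.sw_coassoc[where t = sB]) (intro li)+
    also have "\<dots> = sw H w (\<lambda>a q. sw H q (\<lambda>m s. sw H m (\<lambda>b r. H.sep t (?Y a b r s))))"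
      by (intro sw_cong HOL.refl H.sw_coassoc[where t = sB, symmetric]) (intro li)+
    also have "\<dots> = sw H w (\<lambda>a q. sw H q (\<lambda>m s. sB (H.ep m) (H.sep t (\<lambda>x y. ev vs (\<lambda>ds. f ((adjB c a * io x) # io y # ds)) s))))"
      unfolding io_adj by (intro sw_cong HOL.refl sep_adj) (intro li)+
    also have "\<dots> = sw H w (\<lambda>a q. H.sep t (\<lambda>x y. ev vs (\<lambda>ds. f ((adjB c a * io x) # io y # ds)) q))"
      by (intro sw_cong HOL.refl H.sw_counit_left'[where t = sB]) (intro li)
    also have "\<dots> = ev bs (cins t (Suc 0) f) w"
      by (simp add: Cons ev_Cons cins_Suc_0 ev_cins_aux)
    finally show ?thesis ..
  qed
next
  case (Suc i)
  show ?case
  proof (cases bs)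
    case Nil
    then show ?thesis by (simp add: cins_short)
  next
    case (Cons b bs')
    have "cins t (Suc i) (\<lambda>cs. sw H w (\<lambda>u v. G u v cs)) bs' = sw H w (\<lambda>u v. cins t (Suc i) (G u v) bs')" for G
    proof -
      have "act_end (\<lambda>cs. sw H w (\<lambda>u v. G u v cs)) us v vs = sw H w (\<lambda>a b. act_end (G a b) us v vs)" for us v vs
        by (cases us rule: rev_cases) (simp_all add: sw_mult_left)
      then show ?thesis by (simp add: cins_def sep_sw sw_zero)
    qed
    then show ?thesis
      by (simp add: Cons ev_Cons cins_Suc_Suc Suc.IH[OF mlin_Cons[OF Suc.prems]])
  qed
qed

lemma eqv_cins:
  assumes "mlin f" "eqv f"
  shows "eqv (cins t i f)"
  unfolding eqv_def
proof (intro allI)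
  fix bs w
  show "ev bs (cins t i f) w = adjB (cins t i f bs) w"
  proof (cases i)
    case (Suc j)
    have e: "act_end (\<lambda>cs. adjB (f cs) w) us v vs = adjB (act_end f us v vs) w" if "us \<noteq> []" for us v vs
      using that by (cases us rule: rev_cases) simp_all
    have "cins t i (\<lambda>cs. adjB (f cs) w) bs = adjB (cins t i f bs) w"
    proof (cases "length bs < i")
      case False
      then have "take i bs \<noteq> []" using Suc by auto
      then show ?thesis using False e by (simp add: cins_def linear_sep[OF lin_adj_b])
    qed (simp add: cins_def linearD(3)[OF lin_adj_b])
    then show ?thesis
      using assms(2) ev_cins_Suc[OF assms(1), of bs j w] Suc by (simp add: eqv_def)
  next
    case 0
    note li = linear_ev_fun linear_hd[OF assms(1)] linear_ev[OF mlin_Cons[OF assms(1)]] linear_sep_param B_intros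
    have "adjB (cins t i f bs) w = sw H w (\<lambda>p q. H.sep t (\<lambda>x y. adjB (io x) p * ev (io y # bs) f q))"
      using assms(2) unfolding 0 cins_0 linear_sep[OF lin_adj_b] adj_mult by (simp add: sep_sw eqv_def)
    also have "\<dots> = sw H w (\<lambda>p q. sw H q (\<lambda>r s. H.sep t (\<lambda>x y. adjB (io x) p * ev bs (\<lambda>cs. f (adjB (io y) r # cs)) s)))"
      by (simp add: ev_Cons sw_mult_left[symmetric] sep_sw)
    also have "\<dots> = sw H w (\<lambda>m s. sw H m (\<lambda>p r. H.sep t (\<lambda>x y. adjB (io x) p * ev bs (\<lambda>cs. f (adjB (io y) r # cs)) s)))"
      by (rule H.sw_coassoc[where t = sB, symmetric]) (intro li)+
    also have "\<dots> = sw H w (\<lambda>m s. sB (H.ep m) (H.sep t (\<lambda>x y. io x * ev bs (\<lambda>cs. f (io y # cs)) s)))"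
      unfolding io_adj by (intro sw_cong HOL.refl sep_adj) (intro li)+
    also have "\<dots> = H.sep t (\<lambda>x y. io x * ev bs (\<lambda>cs. f (io y # cs)) w)"
      by (rule H.sw_counit_left'[where t = sB]) (intro li)
    also have "\<dots> = ev bs (cins t i f) w"
      unfolding 0 cins_0 ev_cins_aux
      by (intro sep_cong ev_apply[symmetric] linear_multB_right B.linear_ident)
    finally show ?thesis ..
  qed
qed

end

end

section \<open>Cohomology of a dg Lie subalgebra\<close>

context dg_lie_algebra
begin

lemma comp_diff: "x \<in> comp L q \<Longrightarrow> y \<in> comp L q \<Longrightarrow> x - y \<in> comp L q"
  by (rule subspace_diff[OF comp_subspace])

lemma diff_minus: "x \<in> comp L q \<Longrightarrow> y \<in> comp L q \<Longrightarrow> diff L q (x - y) = diff L q x - diff L q y"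
  using diff_add[OF comp_diff, of x q y y] by (simp add: algebra_simps)

lemma cocycles_diff: "x \<in> cocycles L p \<Longrightarrow> y \<in> cocycles L p \<Longrightarrow> x - y \<in> cocycles L p"
  by (simp add: cocycles_def comp_diff diff_minus)

lemma coboundaries_diff:
  assumes "x \<in> coboundaries L p" "y \<in> coboundaries L p"
  shows "x - y \<in> coboundaries L p"
proof -
  obtain a b where "a \<in> comp L (p - 1)" "b \<in> comp L (p - 1)" "x = diff L (p - 1) a" "y = diff L (p - 1) b"
    using assms by (auto simp: coboundaries_def)
  then have "x - y = diff L (p - 1) (a - b)" "a - b \<in> comp L (p - 1)"
    by (simp_all add: diff_minus comp_diff)
  then show ?thesis unfolding coboundaries_def by (rule image_eqI)
qed

lemma coboundaries_zero: "0 \<in> coboundaries L p"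
proof -
  have "0 \<in> comp L (p - 1)" by (rule subspace_0[OF comp_subspace])
  then have "diff L (p - 1) 0 \<in> coboundaries L p" by (simp add: coboundaries_def)
  from coboundaries_diff[OF this this] show ?thesis by simp
qed

lemma equiv_cohomologous: "equiv (cocycles L p) (cohomologous L p)"
proof (rule equivI)
  have neg: "y - x \<in> coboundaries L p" if "x - y \<in> coboundaries L p" for x y
    using coboundaries_diff[OF coboundaries_zero that] by simp
  show "cohomologous L p \<subseteq> cocycles L p \<times> cocycles L p" by (auto simp: cohomologous_def)
  show "refl_on (cocycles L p) (cohomologous L p)"
    using coboundaries_zero by (auto simp: refl_on_def cohomologous_def)
  show "Relation.sym (cohomologous L p)"
    using neg by (auto simp: Relation.sym_def cohomologous_def)
  show "Relation.trans (cohomologous L p)"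
  proof (rule transI)
    fix x y z assume "(x, y) \<in> cohomologous L p" "(y, z) \<in> cohomologous L p"
    then show "(x, z) \<in> cohomologous L p"
      using coboundaries_diff[of "x - y" p "z - y"] neg[of y z] by (auto simp: cohomologous_def)
  qed
qed

end

lemma cohomology_subcomplex_bij:
  assumes L: "dg_lie_algebra s L" and M: "dg_lie_algebra s M"
    and sub: "\<And>p. comp L p \<subseteq> comp M p" "\<And>p x. x \<in> comp L p \<Longrightarrow> diff L p x = diff M p x"
    and surj: "\<And>x. x \<in> cocycles M p \<Longrightarrow> \<exists>y\<in>cocycles L p. x - y \<in> coboundaries M p"
    and inj: "\<And>x. x \<in> cocycles L p \<Longrightarrow> x \<in> coboundaries M p \<Longrightarrow> x \<in> coboundaries L p"
  shows "bij_betw (cohomology_map M p (\<lambda>x. x)) (cohomology L p) (cohomology M p)"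
proof -
  interpret L: dg_lie_algebra s L by fact
  interpret M: dg_lie_algebra s M by fact
  note eL = L.equiv_cohomologous[of p] and eM = M.equiv_cohomologous[of p]
  have cy: "cocycles L p \<subseteq> cocycles M p"
    using sub by (auto simp: cocycles_def)
  have cb: "coboundaries L p \<subseteq> coboundaries M p"
    using sub by (force simp: coboundaries_def)
  have co: "cohomologous L p \<subseteq> cohomologous M p"
    using cy cb by (auto simp: cohomologous_def)
  have cm: "cohomology_map M p (\<lambda>x. x) (cohomologous L p `` {x}) = cohomologous M p `` {x}"
    if x: "x \<in> cocycles L p" for x
  proof -
    have xx: "x \<in> cohomologous L p `` {x}" using x eL by (auto simp: equiv_def refl_on_def)
    have "cohomologous M p `` {y} = cohomologous M p `` {x}" if "y \<in> cohomologous L p `` {x}" for y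
      using that co equiv_class_eq[OF eM] by blast
    then have "cohomologous M p `` (cohomologous L p `` {x}) = (\<Union>y\<in>cohomologous L p `` {x}. cohomologous M p `` {x})"
      unfolding Image_eq_UN[of "cohomologous M p" "cohomologous L p `` {x}"] by simp
    also have "\<dots> = cohomologous M p `` {x}" using xx by blast
    finally show ?thesis by (simp add: cohomology_map_def)
  qed
  show ?thesis
  proof (rule bij_betw_imageI)
    show "inj_on (cohomology_map M p (\<lambda>x. x)) (cohomology L p)"
    proof (rule inj_onI)
      fix X Y assume XY: "X \<in> cohomology L p" "Y \<in> cohomology L p"
        "cohomology_map M p (\<lambda>x. x) X = cohomology_map M p (\<lambda>x. x) Y"
      then obtain x y where x: "x \<in> cocycles L p" "X = cohomologous L p `` {x}"
        and y: "y \<in> cocycles L p" "Y = cohomologous L p `` {y}"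
        by (auto simp: cohomology_def quotient_def)
      have "cohomologous M p `` {x} = cohomologous M p `` {y}"
        using XY(3) cm x y by simp
      then have "(x, y) \<in> cohomologous M p"
        using eq_equiv_class[OF _ eM] y(1) cy by blast
      then have "(x, y) \<in> cohomologous L p"
        using inj[OF L.cocycles_diff[OF x(1) y(1)]] x(1) y(1) by (simp add: cohomologous_def)
      then show "X = Y" using x y equiv_class_eq[OF eL] by simp
    qed
    show "cohomology_map M p (\<lambda>x. x) ` cohomology L p = cohomology M p"
    proof (intro equalityI subsetI)
      fix Y assume "Y \<in> cohomology_map M p (\<lambda>x. x) ` cohomology L p"
      then show "Y \<in> cohomology M p"
        using cm cy by (auto simp: cohomology_def quotient_def)
    next
      fix Y assume "Y \<in> cohomology M p"
      then obtain y where y: "y \<in> cocycles M p" "Y = cohomologous M p `` {y}"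
        by (auto simp: cohomology_def quotient_def)
      obtain x where x: "x \<in> cocycles L p" "y - x \<in> coboundaries M p"
        using surj[OF y(1)] by blast
      then have "(y, x) \<in> cohomologous M p" using y cy by (auto simp: cohomologous_def)
      then have "Y = cohomology_map M p (\<lambda>x. x) (cohomologous L p `` {x})"
        using y equiv_class_eq[OF eM] cm[OF x(1)] by simp
      then show "Y \<in> cohomology_map M p (\<lambda>x. x) ` cohomology L p"
        using x(1) by (auto simp: cohomology_def quotient_def)
    qed
  qed
qed

section \<open>The deformation onto relative cochains\<close>

context smash_product
begin

context
  fixes t
  assumes t: "H.integral t" "H.ep t = 1"
begin

text \<open>The terms of the differential up to the face at \<open>v\<close> see the inserted pair
  only as fixed entries, so they are terms of \<open>delta f\<close>; the later ones stay as a tail,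
  which will cancel against that of \<open>cins_delta\<close>.\<close>

lemma delta_cins:
  assumes f: "mlin f"
  shows "delta (cins t (length us) f) (us @ v # vs) =
    H.sep t (\<lambda>x y. delta f (us @ (v * io x) # io y # vs)
        - ksign (length us) (d_tail (\<lambda>cs. f (us @ cs)) ((v * io x) # io y # vs)))
    + ksign (length us) (d_tail (\<lambda>cs. cins t (length us) f (us @ cs)) (v # vs))"
proof -
  let ?i = "length us" and ?g = "cins t (length us) f"
  have 1: "delta_pre (\<lambda>cs. ?g (cs @ v # vs)) us
    = H.sep t (\<lambda>x y. delta_pre (\<lambda>cs. f (cs @ (v * io x) # io y # vs)) us)"
  proof -
    have "?g (cs @ v # vs) = H.sep t (\<lambda>x y. f (cs @ (v * io x) # io y # vs))" if "length cs + 1 = ?i" for cs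
      using cins_append[of t "cs @ [v]" f vs] that by simp
    then have "delta_pre (\<lambda>cs. ?g (cs @ v # vs)) us
        = delta_pre (\<lambda>cs. H.sep t (\<lambda>x y. f (cs @ (v * io x) # io y # vs))) us"
      by (intro delta_pre_cong) simp
    then show ?thesis by (simp add: H.sep_def delta_pre_sw)
  qed
  have 2: "act_end ?g us v vs = H.sep t (\<lambda>x y. act_end f us (v * io x) (io y # vs))"
  proof (cases us rule: rev_cases)
    case Nil
    then show ?thesis by (simp add: cins_0 linear_sep[OF linear_multB_right[OF B.linear_ident]] mult.assoc)
  next
    case (snoc us' c)
    then show ?thesis using cins_append[of t "us' @ [c * v]" f vs] by (simp add: mult.assoc)
  qed
  show ?thesis
    unfolding delta_split[of _ us] 1 2 by (simp add: sep_add sep_ksign)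
qed

text \<open>The face joining the two inserted factors produces \<open>x y\<close>, which sums to 1,
  and hence \<open>f\<close> itself. The terms to the left vanish by \<open>van\<close>, since they
  leave \<open>io y\<close> in a slot before \<open>length us\<close>.\<close>

lemma cins_delta:
  assumes f: "mlin f" "van (length us) f"
  shows "cins t (length us) (delta f) (us @ v # vs) = ksign (length us)
    (f (us @ v # vs) - H.sep t (\<lambda>x y. act_end f us (io x) ((io y * v) # vs))
      - d_tail (\<lambda>cs. cins t (length us) f (us @ cs)) (v # vs))"
proof (cases us rule: rev_cases)
  case Nil
  have "H.sep t (\<lambda>x y. io x * io y * f (v # vs)) = f (v # vs)"
    using H.sep_mult[OF t, of sB "\<lambda>z. io z * f (v # vs)"]
    by (simp add: io_mult linear_multB_left lin_io sm_unit B.unit_left)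
  moreover have "io x * delta f (io y # v # vs)
    = io x * io y * f (v # vs) - io x * f ((io y * v) # vs) - d_tail (\<lambda>cs. io x * f (io y # cs)) (v # vs)" for x y
    by (simp add: d_tail_lmult algebra_simps)
  moreover have "H.sep t (\<lambda>x y. d_tail (\<lambda>cs. io x * f (io y # cs)) (v # vs)) = d_tail (\<lambda>cs. cins t 0 f cs) (v # vs)"
    by (simp only: H.sep_def d_tail_sw cins_0)
  ultimately show ?thesis
    by (simp add: Nil cins_0 ksign_def sep_diff del: delta.simps)
next
  case (snoc us' c)
  let ?us = "\<lambda>x. us' @ [c * io x]"
  have "H.sep t (\<lambda>x y. f (us' @ (c * (io x * io y)) # v # vs)) = f (us' @ (c * io H.one) # v # vs)"
    using H.sep_mult[OF t, of sB "\<lambda>z. f (us' @ (c * io z) # v # vs)"]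
    by (simp add: io_mult linear_slot[OF f(1)] linear_multB_right lin_io)
  then have 1: "H.sep t (\<lambda>x y. f (us' @ (c * (io x * io y)) # v # vs)) = f (us @ v # vs)"
    by (simp add: snoc sm_unit B.unit_right)
  have 2: "delta f (us' @ (c * io x) # io y # v # vs)
    = ksign (length us) (f (us' @ (c * (io x * io y)) # v # vs)
        - f (us' @ (c * io x) # (io y * v) # vs) - d_tail (\<lambda>cs. f (us' @ (c * io x) # io y # cs)) (v # vs))" for x y
  proof -
    have "delta_pre (\<lambda>cs. f (cs @ io y # v # vs)) (?us x) = 0"
      using f(2) snoc by (intro delta_pre_eq_0) (simp add: van_def)
    then show ?thesis
      using delta_split[of f "?us x" "io y" "v # vs"] snoc by (simp add: mult.assoc)
  qed
  have "cins t (length us) (delta f) (us @ v # vs) = H.sep t (\<lambda>x y. delta f (us' @ (c * io x) # io y # v # vs))"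
    unfolding cins_append by (simp add: snoc)
  also have "\<dots> = ksign (length us) (f (us @ v # vs)
      - H.sep t (\<lambda>x y. f (us' @ (c * io x) # (io y * v) # vs))
      - H.sep t (\<lambda>x y. d_tail (\<lambda>cs. f (us' @ (c * io x) # io y # cs)) (v # vs)))"
    unfolding 2 sep_ksign sep_diff 1 ..
  also have "H.sep t (\<lambda>x y. d_tail (\<lambda>cs. f (us' @ (c * io x) # io y # cs)) (v # vs))
      = d_tail (\<lambda>cs. cins t (length us) f (us @ cs)) (v # vs)"
    unfolding cins_append by (simp only: H.sep_def d_tail_sw snoc act_end_snoc)
  finally show ?thesis by (simp add: snoc)
qed

text \<open>Identity minus a homotopy term, hence a chain map homotopic to the identity; the sign is
  the one that \<open>delta\<close> attaches to the face at slot \<open>i\<close>.\<close>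

definition proj_step :: "nat \<Rightarrow> ('b list \<Rightarrow> 'b) \<Rightarrow> 'b list \<Rightarrow> 'b" where
  "proj_step i f = (\<lambda>bs. f bs - ksign i (cins t i (delta f) bs + delta (cins t i f) bs))"

text \<open>For \<open>w\<close> in slot \<open>i\<close> the two insertion formulas add up to
  \<open>f\<close>, up to the sign of the slot, once centrality has moved \<open>w\<close> across
  the idempotent. For \<open>w\<close> in an earlier slot all terms vanish separately; the other
  cases are lists too short to have a slot \<open>i\<close>.\<close>

lemma van_proj_step:
  assumes f: "mlin f" "van i f" "van i (delta f)"
  shows "van (Suc i) (proj_step i f)"
  unfolding van_def
proof (intro allI impI)
  fix as zs :: "'b list" and w assume as: "length as < Suc i"
  let ?bs = "as @ io w # zs" and ?g = "cins t i f"
  \<comment> \<open>If \<open>w\<close> is the last entry before the insertion, it absorbs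
    \<open>io x\<close> and stays in E; otherwise it is untouched. Either way a slot before
    \<open>i\<close> holds an element of E.\<close>
  have cd0: "cins t i (delta f) (us @ rs) = 0" if us: "length us = i" "us = ps @ io w # qs" for us rs ps qs
  proof -
    have "act_end (delta f) us (io x) (io y # rs) = 0" for x y
    proof (cases qs rule: rev_cases)
      case Nil
      have "delta f (ps @ io (w * x) # io y # rs) = 0"
        using f(3) us by (simp add: van_def)
      then show ?thesis using us Nil by (simp add: io_mult)
    next
      case (snoc qs' c)
      then have e: "us = (ps @ io w # qs') @ [c]" using us by simp
      have "delta f (ps @ io w # qs' @ (c * io x) # io y # rs) = 0"
        using f(3) us by (simp add: van_def)
      then show ?thesis unfolding e act_end_snoc by simp
    qed
    then show ?thesis using cins_append[of t us "delta f" rs] us(1) by (simp add: sep_zero)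
  qed
  consider "length ?bs < i" | "length ?bs = i" | "length ?bs > i" "length as < i" | "length as = i"
    using as by fastforce
  then show "proj_step i f ?bs = 0"
  proof cases
    case 1
    then have "delta ?g ?bs = delta (\<lambda>cs. 0) ?bs"
      by (intro delta_cong) (simp add: cins_short)
    moreover have "f ?bs = 0" using f(2) 1 by (simp add: van_def)
    ultimately show ?thesis
      using 1 by (simp add: proj_step_def delta_zero cins_short)
  next
    case 2
    then have "delta ?g ?bs = delta (\<lambda>cs. 0) ?bs"
      by (intro delta_cong) (simp add: cins_short)
    moreover have "f ?bs = 0" using f(2) 2 by (simp add: van_def)
    moreover have "cins t i (delta f) ?bs = 0"
      using cd0[of ?bs as zs "[]"] 2 by simp
    ultimately show ?thesis
      by (simp add: proj_step_def delta_zero)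
  next
    case 3
    define us where "us = take i ?bs"
    define v where "v = ?bs ! i"
    define vs where "vs = drop (Suc i) ?bs"
    have bs: "?bs = us @ v # vs" unfolding us_def v_def vs_def by (rule id_take_nth_drop[OF 3(1)])
    obtain qs where us: "length us = i" "us = as @ io w # qs"
      using 3 by (auto simp: us_def take_Cons')
    have fz: "f (us @ cs) = 0" "delta f (us @ cs) = 0" for cs
      using f(2,3) 3(2) by (simp_all add: us(2) van_def)
    have gz: "?g (us @ cs) = 0" for cs
    proof -
      have "act_end f us (io x) (io y # cs) = 0" for x y
      proof (cases qs rule: rev_cases)
        case Nil
        have "f (as @ io (w * x) # io y # cs) = 0"
          using f(2) 3 by (simp add: van_def)
        then show ?thesis using us(2) Nil by (simp add: io_mult)
      next
        case (snoc qs' c)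
        then have e: "us = (as @ io w # qs') @ [c]" using us by simp
        have "f (as @ io w # qs' @ (c * io x) # io y # cs) = 0"
          using f(2) 3 by (simp add: van_def)
        then show ?thesis unfolding e act_end_snoc by simp
      qed
      then show ?thesis using cins_append[of t us f cs] us(1) by (simp add: sep_zero)
    qed
    have "delta ?g ?bs = 0"
      using delta_cins[OF f(1), of us v vs] unfolding bs us(1)
      by (simp add: fz gz d_tail_zero sep_zero del: d_tail.simps)
    moreover have "cins t i (delta f) ?bs = 0"
      using cd0[OF us] unfolding bs by simp
    moreover have "f ?bs = 0" unfolding bs by (rule fz)
    ultimately show ?thesis by (simp add: proj_step_def)
  next
    case 4
    have pre: "delta_pre (\<lambda>cs. f (cs @ io z # rs)) as = 0" for z rs
      using f(2) 4 by (intro delta_pre_eq_0) (simp add: van_def)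
    have 1: "delta f (as @ (io w * io x) # io y # zs)
        - ksign i (d_tail (\<lambda>cs. f (as @ cs)) ((io w * io x) # io y # zs))
      = ksign i (act_end f as (io w * io x) (io y # zs))" for x y
      unfolding delta_split io_mult using pre 4 by simp
    have 2: "H.sep t (\<lambda>x y. act_end f as (io w * io x) (io y # zs))
        = H.sep t (\<lambda>x y. act_end f as (io x) ((io y * io w) # zs))"
      using H.sep_central[OF t, of sB "\<lambda>x y. act_end f as (io x) (io y # zs)" w]
      by (simp add: io_mult linear_act_end_mid[OF f(1)] lin_io
        linear_act_end_right[OF f(1), where as = "[]", simplified])
    have "delta ?g ?bs = ksign i (H.sep t (\<lambda>x y. act_end f as (io x) ((io y * io w) # zs)))
        + ksign i (d_tail (\<lambda>cs. ?g (as @ cs)) (io w # zs))"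
      using delta_cins[OF f(1), of as "io w" zs] unfolding 4 1 2 sep_ksign .
    moreover have "cins t i (delta f) ?bs = ksign i (f ?bs
        - H.sep t (\<lambda>x y. act_end f as (io x) ((io y * io w) # zs))
        - d_tail (\<lambda>cs. ?g (as @ cs)) (io w # zs))"
      using cins_delta[of f as "io w" zs] f 4 by simp
    ultimately have "cins t i (delta f) ?bs + delta ?g ?bs = ksign i (f ?bs)"
      by simp
    then have "proj_step i f ?bs = f ?bs - ksign i (ksign i (f ?bs))"
      by (simp only: proj_step_def)
    then show ?thesis by (simp add: ksign_def)
  qed
qed

lemma delta_proj_step: "delta (proj_step i f) = proj_step i (delta f)"
proof
  fix bs
  have "cins t i (\<lambda>bs. 0) = (\<lambda>bs. 0)"
    using cins_eq_0[of n "\<lambda>bs. 0" _ t i for n] cins_eq_0[of 0 "\<lambda>bs. 0" _ t i] by (auto simp: arity_def)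
  then show "delta (proj_step i f) bs = proj_step i (delta f) bs"
    by (simp add: proj_step_def delta_diff delta_ksign delta_add delta_delta[abs_def])
qed

primrec proj :: "nat \<Rightarrow> ('b list \<Rightarrow> 'b) \<Rightarrow> 'b list \<Rightarrow> 'b" where
  "proj 0 f = f"
| "proj (Suc i) f = proj_step i (proj i f)"

lemma delta_proj: "delta (proj i f) = proj i (delta f)"
  by (induction i) (simp_all add: delta_proj_step)

lemma proj_zero: "proj i (\<lambda>bs. 0) = (\<lambda>bs. 0)"
proof (induction i)
  case (Suc i)
  have "cins t i (\<lambda>bs. 0) = (\<lambda>bs. 0)"
    using cins_eq_0[of 0 "\<lambda>bs. 0" _ t i] by (auto simp: arity_def)
  then show ?case using Suc by (simp add: proj_step_def delta_zero[abs_def])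
qed simp

definition van_cochains :: "nat \<Rightarrow> nat \<Rightarrow> ('b list \<Rightarrow> 'b) set" where
  "van_cochains i n = {f \<in> normalized_cochains sB uB n. van i f \<and> van i (delta f)}"

lemma van_cochainsD:
  assumes "f \<in> van_cochains i n"
  shows "f \<in> cochains sB n" "mlin f" "arity n f" "nrm f" "van i f" "van i (delta f)"
  using assms B.cochainsD[of f n] by (auto simp: van_cochains_def normalized_cochains_iff mlin_def)

lemma delta_van_cochains:
  assumes "f \<in> van_cochains i n"
  shows "delta f \<in> van_cochains i (n + 1)"
proof -
  have "van i (delta (delta f))" by (simp add: van_def delta_delta)
  then show ?thesis
    using van_cochainsD[OF assms] B.delta_mem_cochains[of f n] nrm_delta
    by (simp add: van_cochains_def normalized_cochains_iff)
qed

text \<open>The truncation \<open>n - 1\<close> hides that a 0-cochain has no slot for the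
  idempotent, so the second claim records the bottom degree.\<close>

lemma cins_van_cochains:
  assumes "f \<in> van_cochains i n"
  shows "cins t i f \<in> normalized_cochains sB uB (n - 1)" "n = 0 \<Longrightarrow> cins t i f = (\<lambda>bs. 0)"
proof -
  note f = van_cochainsD[OF assms]
  have "arity (n - 1) (cins t i f)"
    unfolding arity_def by (intro allI impI cins_eq_0[OF f(3)]) auto
  then show "cins t i f \<in> normalized_cochains sB uB (n - 1)"
    using mlin_cins[OF f(2)] nrm_cins[OF f(4,5)]
    by (simp add: normalized_cochains_iff mlin_def B.cochainsI)
  show "cins t i f = (\<lambda>bs. 0)" if "n = 0"
    using cins_eq_0[OF f(3)] that by auto
qed

lemma delta_cins_van_cochains:
  assumes "f \<in> van_cochains i n"
  shows "delta (cins t i f) \<in> normalized_cochains sB uB n"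
proof (cases n)
  case 0
  have "(\<lambda>bs. 0) \<in> normalized_cochains sB uB n"
    using B.lincomb_mem_cochains(5) B.mult_cochain_mem van_cochainsD(1)[OF assms]
    by (auto simp: normalized_cochains_def)
  then show ?thesis using cins_van_cochains(2)[OF assms 0] by (simp add: delta_zero[abs_def])
next
  case (Suc m)
  then show ?thesis
    using cins_van_cochains(1)[OF assms] B.delta_mem_cochains[of "cins t i f" m] nrm_delta
    by (simp add: normalized_cochains_iff)
qed

lemma proj_step_van_cochains:
  assumes "f \<in> van_cochains i n"
  shows "proj_step i f \<in> van_cochains (Suc i) n"
proof -
  note f = van_cochainsD[OF assms] and df = van_cochainsD[OF delta_van_cochains[OF assms]]
  have "cins t i (delta f) \<in> normalized_cochains sB uB n"
    using cins_van_cochains(1)[OF delta_van_cochains[OF assms]] by simp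
  moreover note delta_cins_van_cochains[OF assms]
  ultimately have "proj_step i f \<in> normalized_cochains sB uB n"
    using f(1,4) unfolding proj_step_def
    by (auto simp: normalized_cochains_iff nrm_def intro!: B.lincomb_mem_cochains)
  moreover have "van (Suc i) (proj_step i f)"
    by (rule van_proj_step[OF f(2,5,6)])
  moreover have "van (Suc i) (delta (proj_step i f))"
    unfolding delta_proj_step by (rule van_proj_step[OF df(2,5,6)])
  ultimately show ?thesis by (simp add: van_cochains_def)
qed

lemma proj_van_cochains: "f \<in> normalized_cochains sB uB n \<Longrightarrow> proj i f \<in> van_cochains i n"
  by (induction i) (auto simp: proj_step_van_cochains, simp add: van_cochains_def van_def)

context
  assumes S4: "\<And>z. H.S (H.S (H.S (H.S z))) = z"
begin

text \<open>All \<open>proj i f\<close> are again cocycles, so each step subtracts just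
  \<open>delta\<close> of an insertion, and the signed insertions add up to \<open>g\<close>. Each
  of them keeps equivariance, so the same \<open>g\<close> serves the invariant complex.\<close>

lemma proj_homotopy:
  assumes f: "f \<in> normalized_cochains sB uB n" and df: "delta f = (\<lambda>bs. 0)"
  shows "\<exists>g\<in>normalized_cochains sB uB (n - 1). (n = 0 \<longrightarrow> g = (\<lambda>bs. 0)) \<and>
    (\<forall>bs. f bs - proj i f bs = delta g bs) \<and> (eqv f \<longrightarrow> eqv g \<and> eqv (proj i f))"
proof (induction i)
  case 0
  have "(\<lambda>bs. 0) \<in> cochains sB (n - 1)"
    by (intro B.cochainsI) (simp_all add: arity_def madd_def mscale_def)
  then have "(\<lambda>bs. 0) \<in> normalized_cochains sB uB (n - 1)"
    by (simp add: normalized_cochains_def)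
  then show ?case
    by (intro bexI[of _ "\<lambda>bs. 0"]) (simp_all add: delta_zero eqv_def ev_zero linearD(3)[OF lin_adj_b])
next
  case (Suc i)
  then obtain g where g: "g \<in> normalized_cochains sB uB (n - 1)" "n = 0 \<longrightarrow> g = (\<lambda>bs. 0)"
    "\<And>bs. f bs - proj i f bs = delta g bs" "eqv f \<Longrightarrow> eqv g" "eqv f \<Longrightarrow> eqv (proj i f)" by blast
  note P = proj_van_cochains[OF f, of i]
  let ?c = "cins t i (proj i f)"
  have dP: "delta (proj i f) = (\<lambda>bs. 0)"
    by (simp add: delta_proj df proj_zero)
  have c0: "cins t i (\<lambda>bs. 0) bs = 0" for bs
    using cins_eq_0[of "length bs" "\<lambda>bs. 0" bs t i] by (simp add: arity_def)
  have step: "proj (Suc i) f bs = proj i f bs - ksign i (delta ?c bs)" for bs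
    by (simp add: proj_step_def dP c0)
  let ?h = "\<lambda>bs. g bs + ksign i (?c bs)"
  have "?h \<in> normalized_cochains sB uB (n - 1)"
    using g(1) cins_van_cochains(1)[OF P]
    by (auto simp: normalized_cochains_iff nrm_def intro!: B.lincomb_mem_cochains)
  moreover have "n = 0 \<longrightarrow> ?h = (\<lambda>bs. 0)"
    using g(2) cins_van_cochains(2)[OF P] by simp
  moreover have "f bs - proj (Suc i) f bs = delta ?h bs" for bs
    unfolding step delta_add delta_ksign using g(3)[of bs] by (simp add: algebra_simps)
  moreover have "eqv ?h \<and> eqv (proj (Suc i) f)" if "eqv f"
  proof -
    have c: "eqv ?c" using eqv_cins[OF t S4 van_cochainsD(2)[OF P] g(5)[OF that]] .
    have dc: "eqv (delta ?c)"
    proof (rule eqv_delta[OF _ c])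
      show "?c \<in> cochains sB (n - 1)"
        using cins_van_cochains(1)[OF P] by (simp add: normalized_cochains_def)
    qed
    have "proj (Suc i) f = (\<lambda>bs. proj i f bs - ksign i (delta ?c bs))"
      using step by auto
    then show ?thesis
      using eqv_lincomb(1)[OF g(4)[OF that] eqv_lincomb(3)[where p = i, OF c c]]
        eqv_lincomb(2)[OF g(5)[OF that] eqv_lincomb(3)[where p = i, OF dc dc]] by simp
  qed
  ultimately show ?case by (intro bexI[of _ ?h]) auto
qed

end

end

text \<open>A cochain that vanishes on \<open>E\<close> in each slot and whose differential does so, too, is left and right \<open>E\<close>-linear and
  \<open>E\<close>-balanced between adjacent slots.\<close>

lemma relative_cochain_eqv:
  assumes f: "f \<in> cochains sB n" "van (Suc n) f" "van (Suc n) (delta f)"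
  shows "eqv f"
proof -
  have ml: "mlin f" and ar: "arity n f" using B.cochainsD[OF f(1)] by (simp_all add: mlin_def)
  \<comment> \<open>A slot beyond the bound needs a list longer than the arity, so the vanishing
    holds at every slot.\<close>
  have v: "f (us @ io w # vs) = 0" for us w vs
    using f(2) arity_eq_0[OF ar, of "us @ io w # vs"] by (cases "length us < Suc n") (auto simp: van_def)
  have "arity (n + 1) (delta f)" using B.cochainsD[OF f(1)] by (intro arity_delta)
  then have dv: "delta f (us @ io w # vs) = 0" for us w vs
    using f(3) arity_eq_0[of "n + 1" "delta f" "us @ io w # vs"] by (cases "length us < Suc n") (auto simp: van_def)
  have "act_end f us (io w) vs + d_tail (\<lambda>cs. f (us @ cs)) (io w # vs) = 0" for us w vs
  proof -
    have "delta_pre (\<lambda>cs. f (cs @ io w # vs)) us = 0" by (rule delta_pre_eq_0) (rule v)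
    then have "ksign (length us) (act_end f us (io w) vs + d_tail (\<lambda>cs. f (us @ cs)) (io w # vs)) = 0"
      using dv[of us w vs] unfolding delta_split by simp
    then show ?thesis by (simp only: ksign_def neg_equal_0_iff_equal split: if_splits)
  qed
  note rel = this
  \<comment> \<open>With nothing behind the slot this is right linearity, or, for empty
    \<open>us\<close>, commutation of \<open>f []\<close> with E. Then \<open>rel2\<close> is
    balancedness between neighbours, or left linearity for empty \<open>us\<close>.\<close>
  have rel1: "act_end f us (io w) [] = f us * io w" for us w
    using rel[of us w "[]"] by simp
  have rel2: "act_end f us (io w) (v # vs) = f (us @ (io w * v) # vs)" for us w v vs
    using rel[of us w "v # vs"] by (simp add: v d_tail_zero)
  \<comment> \<open>\<open>w\<close> travels rightwards: balancedness moves \<open>p\<close> onto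
    the next entry, where it cancels the \<open>S(u\<^sub>1)\<close> of the adjoint action and
    leaves \<open>u\<^sub>2\<close> to be carried on; behind the last entry it leaves
    \<open>f\<close> by right linearity.\<close>
  have claim: "sw H w (\<lambda>p q. ev bs (\<lambda>cs. f (us @ (c * io p) # cs)) q) = f (us @ c # bs) * io w" for us c bs w
  proof (induction bs arbitrary: us c w)
    case Nil
    have "f (us @ [c * io p]) = f (us @ [c]) * io p" for p
      using rel1[of "us @ [c]" p] by simp
    then have "sw H w (\<lambda>p q. ev [] (\<lambda>cs. f (us @ (c * io p) # cs)) q) = sw H w (\<lambda>p q. sB (H.ep q) (f (us @ [c]) * io p))"
      by simp
    also have "\<dots> = f (us @ [c]) * io w"
      by (rule H.sw_counit_right'[where t = sB]) (intro B_intros)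
    finally show ?case .
  next
    case (Cons b bs)
    let ?X = "\<lambda>p u1 u2 v. ev bs (\<lambda>cs. f (us @ c # (io (p * H.S u1) * b * io u2) # cs)) v"
    note li = linear_ev_fun linear_slot[OF ml, of _ _ "us @ [c]", simplified]
      linear_ev[OF mlin_append[OF ml, of "us @ [c, _]", simplified]] B_intros
    have 1: "f (us @ (c * io p) # d # cs) = f (us @ c # (io p * d) # cs)" for p d cs
      using rel2[of "us @ [c]" p d cs] by simp
    have "ev bs (\<lambda>cs. f (us @ (c * io p) # adjB b u # cs)) v = sw H u (\<lambda>u1 u2. ?X p u1 u2 v)" for p u v
    proof -
      have "io p * adjB b u = sw H u (\<lambda>u1 u2. io (p * H.S u1) * b * io u2)"
        by (simp add: adj_eq sw_mult_left[symmetric] io_mult[symmetric] mult.assoc)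
      then show ?thesis
        unfolding 1
        using linear_sw[where s = sB and t = sB and f = "\<lambda>z. ev bs (\<lambda>cs. f (us @ c # z # cs)) v", of H u]
        by (simp add: linear_ev_fun mlin_linear[OF ml, of "us @ [c]", simplified])
    qed
    then have "sw H w (\<lambda>p q. ev (b # bs) (\<lambda>cs. f (us @ (c * io p) # cs)) q)
        = sw H w (\<lambda>p q. sw H q (\<lambda>u v. sw H u (\<lambda>u1 u2. ?X p u1 u2 v)))"
      by (simp add: ev_Cons)
    also have "\<dots> = sw H w (\<lambda>p q. sw H q (\<lambda>u1 z. sw H z (\<lambda>u2 v. ?X p u1 u2 v)))"
      by (intro sw_cong HOL.refl H.sw_coassoc[where t = sB]) (intro li)+
    also have "\<dots> = sw H w (\<lambda>m z. sw H m (\<lambda>p u1. sw H z (\<lambda>u2 v. ?X p u1 u2 v)))"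
      by (rule H.sw_coassoc[where t = sB, symmetric]) (intro li)+
    also have "\<dots> = sw H w (\<lambda>m z. sB (H.ep m) (sw H z (\<lambda>u2 v. ev bs (\<lambda>cs. f (us @ c # (io H.one * b * io u2) # cs)) v)))"
      by (intro sw_cong HOL.refl H.sw_antipode_right) (intro li)
    also have "\<dots> = sw H w (\<lambda>u2 v. ev bs (\<lambda>cs. f ((us @ [c]) @ (b * io u2) # cs)) v)"
      unfolding sm_unit B.unit_left append_assoc append.simps
      by (rule H.sw_counit_left'[where t = sB]) (intro li)
    also have "\<dots> = f (us @ c # b # bs) * io w"
      unfolding Cons.IH by simp
    finally show ?case .
  qed
  have "ev bs f w = adjB (f bs) w" for bs w
  proof (cases bs)
    case Nil
    have "f [] * io q = io q * f []" for q using rel1[of "[]" q] by simp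
    then have "adjB (f []) w = sw H w (\<lambda>u v. io (H.S u * v) * f [])"
      by (simp add: adj_eq io_mult[symmetric] mult.assoc)
    also have "\<dots> = sB (H.ep w) (io H.one * f [])"
      by (rule H.sw_antipode_left) (intro B_intros)
    finally show ?thesis by (simp add: Nil sm_unit B.unit_left)
  next
    case (Cons b bs')
    note li = linear_ev_fun linear_hd[OF ml] linear_ev[OF mlin_Cons[OF ml]] B_intros
    have "ev bs' (\<lambda>cs. f (adjB b u # cs)) v = sw H u (\<lambda>u1 u2. io (H.S u1) * ev bs' (\<lambda>cs. f ((b * io u2) # cs)) v)" for u v
    proof -
      have "f ((io p * d) # cs) = io p * f (d # cs)" for p d cs
        using rel2[of "[]" p d cs] by simp
      then have "io p * ev bs' (\<lambda>cs. f (d # cs)) v = ev bs' (\<lambda>cs. f ((io p * d) # cs)) v" for p d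
        using ev_apply[of "\<lambda>x. io p * x"] by (simp add: linear_multB_right B.linear_ident)
      then show ?thesis
        unfolding adj_eq
        using linear_sw[where s = sB and t = sB and f = "\<lambda>z. ev bs' (\<lambda>cs. f (z # cs)) v", of H u]
        by (simp add: linear_ev_fun mlin_hd[OF ml] mult.assoc)
    qed
    then have "ev bs f w = sw H w (\<lambda>u v. sw H u (\<lambda>u1 u2. io (H.S u1) * ev bs' (\<lambda>cs. f ((b * io u2) # cs)) v))"
      by (simp add: Cons ev_Cons)
    also have "\<dots> = sw H w (\<lambda>u1 z. sw H z (\<lambda>u2 v. io (H.S u1) * ev bs' (\<lambda>cs. f ((b * io u2) # cs)) v))"
      by (rule H.sw_coassoc[where t = sB]) (intro li)+
    also have "\<dots> = adjB (f bs) w"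
      using claim[of _ bs' "[]" b] by (simp add: adj_eq sw_mult_left Cons mult.assoc)
    finally show ?thesis .
  qed
  then show ?thesis by (simp add: eqv_def)
qed

section \<open>Comparison of the complexes\<close>

lemma normalized_bracket:
  assumes "f \<in> normalized_cochains sB uB m" "g \<in> normalized_cochains sB uB n"
  shows "gerstenhaber_bracket m n f g \<in> normalized_cochains sB uB (m + n - 1)"
proof -
  have f: "f \<in> cochains sB m" "nrm f" and g: "g \<in> cochains sB n" "nrm g"
    using assms by (simp_all add: normalized_cochains_iff)
  have ins: "nrm (ins n g f)" if f: "madd f" "nrm f" and g: "nrm g" for f g n
    unfolding nrm_def
  proof (intro allI impI)
    fix bs assume u: "uB \<in> set bs"
    have "f (take i bs @ g (take n (drop i bs)) # drop (i + n) bs) = 0" for i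
    proof (cases "uB \<in> set (take n (drop i bs))")
      case True
      then show ?thesis using g madd_zero[OF f(1)] by (simp add: nrm_def)
    next
      case False
      have "bs = take i bs @ take n (drop i bs) @ drop (i + n) bs"
        by (metis append_take_drop_id drop_drop add.commute)
      then have "uB \<in> set (take i bs) \<or> uB \<in> set (drop (i + n) bs)"
        using u False by (metis Un_iff set_append)
      then show ?thesis using f(2) by (auto simp: nrm_def)
    qed
    then show "ins n g f bs = 0" by (simp add: ins_sum)
  qed
  have "nrm (gerstenhaber_bracket m n f g)"
    unfolding B.bracket_eq_ins[OF f(1) g(1)]
    using ins[OF _ f(2) g(2), of n] ins[OF _ g(2) f(2), of m] B.cochainsD[OF f(1)] B.cochainsD[OF g(1)]
    by (simp add: nrm_def)
  then show ?thesis
    using B.bracket_mem_cochains[OF f(1) g(1)] by (simp add: normalized_cochains_iff)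
qed

lemma normalized_hochschild_d:
  assumes "f \<in> normalized_cochains sB uB n"
  shows "hochschild_d n f \<in> normalized_cochains sB uB (n + 1)"
proof -
  have f: "f \<in> cochains sB n" "nrm f" using assms by (simp_all add: normalized_cochains_iff)
  then have "nrm (hochschild_d n f)"
    using nrm_delta[OF f(2)] by (simp add: hochschild_d_eq_delta B.cochainsD[OF f(1)] nrm_def)
  then show ?thesis using B.hochschild_d_mem_cochains[OF f(1)] by (simp add: normalized_cochains_iff)
qed

lemma subspace_normalized: "module.subspace (fscale sB) (normalized_cochains sB uB n)"
proof -
  interpret F: vector_space "fscale sB" by (rule vector_space_fscale[OF B.vector_space_axioms])
  have "(\<lambda>bs. 0) \<in> cochains sB n"
    by (intro B.cochainsI) (simp_all add: arity_def madd_def mscale_def)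
  then show ?thesis
    by (auto simp: F.subspace_def normalized_cochains_def fscale_def plus_fun_def zero_fun_def
      intro: B.lincomb_mem_cochains)
qed

lemma subspace_eqv: "module.subspace (fscale sB) {f. eqv f}"
proof -
  interpret F: vector_space "fscale sB" by (rule vector_space_fscale[OF B.vector_space_axioms])
  have "eqv (\<lambda>bs. 0)" by (simp add: eqv_def ev_zero linearD(3)[OF lin_adj_b])
  then show ?thesis
    by (auto simp: F.subspace_def fscale_def plus_fun_def zero_fun_def intro: eqv_lincomb)
qed

theorem L_invariant_quasi_iso:
  assumes R: "finite_dimensional_vector_space H.sc R"
    and t: "H.integral t" "H.ep t = 1" and S4: "\<And>z. H.S (H.S (H.S (H.S z))) = z"
  shows "dg_lie_quasi_iso (fscale sB) (L_invariant H R uA sB uB sm)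
    (fscale sB) (L_Hochschild sB uB) (\<lambda>p f. f)"
proof -
  interpret F: vector_space "fscale sB" by (rule vector_space_fscale[OF B.vector_space_axioms])
  let ?N = "normalized_cochains sB uB" and ?I = "invariant_cochains H uA sB uB sm"
  let ?L = "L_invariant H R uA sB uB sm" and ?M = "L_Hochschild sB uB"
  note I = invariant_cochains_eq[OF S4]
  have Nc: "?N n \<subseteq> cochains sB n" for n by (auto simp: normalized_cochains_def)
  have d: "braided_d H R uA sB sm n f = hochschild_d n f" if "f \<in> ?I n" for n f
    using that by (intro braided_d_invariant[OF R]) (simp add: invariant_cochains_def)
  interpret M: dg_lie_algebra "fscale sB" ?M
    unfolding L_Hochschild_def
    by (rule B.shifted_dgl_dg_lie[OF subspace_normalized Nc HOL.refl normalized_hochschild_d normalized_bracket])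
  interpret L: dg_lie_algebra "fscale sB" ?L
    unfolding L_invariant_def
  proof (rule B.shifted_dgl_dg_lie)
    show "F.subspace (?I n)" for n
      using F.subspace_inter[OF subspace_normalized subspace_eqv, of n] by (simp add: I Int_def)
    show "?I n \<subseteq> cochains sB n" for n using Nc[of n] by (auto simp: I)
    show "hochschild_d n f \<in> ?I (n + 1)" if "f \<in> ?I n" for n f
      using that normalized_hochschild_d[of f n] eqv_hochschild_d[of f n] Nc[of n] by (auto simp: I)
    show "gerstenhaber_bracket m n f g \<in> ?I (m + n - 1)" if "f \<in> ?I m" "g \<in> ?I n" for m n f g
      using that normalized_bracket[of f m g n] eqv_bracket[of f m g n] Nc[of n] Nc[of m] by (auto simp: I)
  qed (rule d)
  have cL: "f \<in> comp ?L p \<longleftrightarrow> f \<in> comp ?M p \<and> eqv f" for f p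
    using F.subspace_0[OF subspace_eqv] by (auto simp: L_invariant_def L_Hochschild_def shifted_dgl_def I)
  have dL: "diff ?L p f = diff ?M p f" if "f \<in> comp ?L p" for f p
  proof (cases "p < - 1")
    case True
    then have f0: "f = 0" using that by (simp add: L_invariant_def shifted_dgl_def)
    have "0 \<in> ?I (nat (p + 1))"
      using F.subspace_0[OF subspace_normalized] F.subspace_0[OF subspace_eqv] by (simp add: I)
    from d[OF this] show ?thesis by (simp add: f0 L_invariant_def L_Hochschild_def shifted_dgl_def)
  next
    case False
    then show ?thesis using that d by (simp add: L_invariant_def L_Hochschild_def shifted_dgl_def)
  qed
  have dM: "diff ?M p f = (\<lambda>bs. ksign (nat (p + 1) + 1) (delta f bs))" if "f \<in> ?N (nat (p + 1))" for f p
    using B.cochainsD[OF subsetD[OF Nc that]]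
    by (simp add: L_Hochschild_def shifted_dgl_def hochschild_d_eq_delta)
  have cM: "f \<in> comp ?M p \<longleftrightarrow> (if p < - 1 then f = 0 else f \<in> ?N (nat (p + 1)))" for f p
    by (simp add: L_Hochschild_def shifted_dgl_def)
  \<comment> \<open>Degree \<open>p\<close> means arity \<open>n = p + 1\<close>, so
    \<open>p + 2\<close> is the bound \<open>Suc n\<close> on the slots that
    \<open>relative_cochain_eqv\<close> asks for.\<close>
  have P: "\<exists>g\<in>comp ?M (p - 1). f - proj t (nat (p + 2)) f = diff ?M (p - 1) g \<and> (eqv f \<longrightarrow> eqv g)"
    if f: "f \<in> cocycles ?M p" "p \<ge> - 1" for f p
  proof -
    let ?n = "nat (p + 1)"
    have fN: "f \<in> ?N ?n" and df: "delta f = (\<lambda>bs. 0)"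
      using f dM[of f p] by (auto simp: cocycles_def cM fun_eq_iff ksign_def split: if_splits)
    from proj_homotopy[OF t S4 fN df, of "nat (p + 2)"]
    obtain g where g1: "g \<in> ?N (?n - 1)" and g2: "(?n = 0 \<longrightarrow> g = (\<lambda>bs. 0)) \<and>
      (\<forall>bs. f bs - proj t (nat (p + 2)) f bs = delta g bs) \<and> (eqv f \<longrightarrow> eqv g \<and> eqv (proj t (nat (p + 2)) f))"
      by (rule bexE)
    have g: "g \<in> ?N (?n - 1)" "?n = 0 \<longrightarrow> g = (\<lambda>bs. 0)"
      "\<And>bs. f bs - proj t (nat (p + 2)) f bs = delta g bs" "eqv f \<longrightarrow> eqv g"
      using g1 g2 by simp_all
    \<comment> \<open>The overall sign by which the differential in degree \<open>p - 1\<close>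
      differs from \<open>delta\<close>.\<close>
    let ?g = "\<lambda>bs. ksign (nat p + 1) (g bs)"
    have "nat (p - 1 + 1) = ?n - 1" by linarith
    then have gN: "?g \<in> ?N (nat (p - 1 + 1))"
      using g(1) B.lincomb_mem_cochains(3)[of g "?n - 1" g] by (simp add: normalized_cochains_def)
    have "?g \<in> comp ?M (p - 1)"
      using gN g(2) f(2) by (auto simp: cM fun_eq_iff)
    moreover have "f - proj t (nat (p + 2)) f = diff ?M (p - 1) ?g"
      unfolding dM[OF gN] by (simp add: fun_eq_iff g(3) delta_ksign) (simp add: ksign_def)
    moreover have "eqv f \<longrightarrow> eqv ?g" using g(4) eqv_lincomb(3) by blast
    ultimately show ?thesis by blast
  qed
  have E: "proj t i f \<in> ?N n" "i > n \<Longrightarrow> eqv (proj t i f)" if "f \<in> ?N n" for f n i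
  proof -
    note P = van_cochainsD[OF t proj_van_cochains[OF t that, of i]]
    show "proj t i f \<in> ?N n" using P by (simp add: normalized_cochains_iff)
    show "eqv (proj t i f)" if "i > n"
      using P(1,5,6) that by (intro relative_cochain_eqv[of _ n]) (auto simp: van_def)
  qed
  have bij: "bij_betw (cohomology_map ?M p (\<lambda>f. f)) (cohomology ?L p) (cohomology ?M p)" for p
  proof (rule cohomology_subcomplex_bij[OF L.dg_lie_algebra_axioms M.dg_lie_algebra_axioms])
    show "comp ?L p \<subseteq> comp ?M p" for p using cL by blast
    show "diff ?L p f = diff ?M p f" if "f \<in> comp ?L p" for p f using dL[OF that] .
    show "\<exists>y\<in>cocycles ?L p. x - y \<in> coboundaries ?M p" if x: "x \<in> cocycles ?M p" for x
    proof (cases "p \<ge> - 1")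
      case False
      then have "x = 0" using x by (simp add: cocycles_def cM)
      then show ?thesis
        using L.coboundaries_zero M.coboundaries_zero[of p] F.subspace_0[OF L.comp_subspace, of p]
          L.diff_minus[of 0 p 0]
        by (intro bexI[of _ 0]) (auto simp: cocycles_def)
    next
      case True
      let ?y = "proj t (nat (p + 2)) x"
      obtain g where g: "g \<in> comp ?M (p - 1)" "x - ?y = diff ?M (p - 1) g" using P[OF x True] by blast
      have cb: "x - ?y \<in> coboundaries ?M p" unfolding g(2) coboundaries_def using g(1) by (rule imageI)
      have "x \<in> ?N (nat (p + 1))" using x True by (simp add: cocycles_def cM)
      then have y: "?y \<in> comp ?L p" using E[of x "nat (p + 1)" "nat (p + 2)"] True by (simp add: cL cM)
      have "diff ?M p (x - ?y) = 0" unfolding g(2) using M.diff_diff[OF g(1)] by simp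
      then have "diff ?M p ?y = 0"
        using x y M.diff_minus[of x p ?y] by (simp add: cocycles_def cL)
      then have "?y \<in> cocycles ?L p" using y dL by (simp add: cocycles_def)
      then show ?thesis using cb by blast
    qed
    \<comment> \<open>A cochain \<open>h\<close> bounding \<open>x\<close> may fail to be invariant.
      So \<open>x\<close> minus its projection is bounded by the invariant homotopy term, and the
      projection of \<open>x\<close> by the projection of \<open>h\<close>, which is relative and
      hence invariant.\<close>
    show "x \<in> coboundaries ?L p" if x: "x \<in> cocycles ?L p" "x \<in> coboundaries ?M p" for x
    proof (cases "p \<ge> - 1")
      case False
      then have "x = 0" using x(1) by (simp add: cocycles_def cM cL)
      then show ?thesis using L.coboundaries_zero by simp
    next
      case True
      have xM: "x \<in> cocycles ?M p" "eqv x" using x(1) dL by (auto simp: cocycles_def cL)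
      obtain g where g: "g \<in> comp ?M (p - 1)" "x - proj t (nat (p + 2)) x = diff ?M (p - 1) g" "eqv g"
        using P[OF xM(1) True] xM(2) by blast
      obtain h where h: "h \<in> comp ?M (p - 1)" "x = diff ?M (p - 1) h"
        using x(2) by (auto simp: coboundaries_def)
      have "\<exists>h'\<in>comp ?L (p - 1). proj t (nat (p + 2)) x = diff ?M (p - 1) h'"
      proof (cases "p = - 1")
        \<comment> \<open>In degree -1 the only coboundary is 0, and \<open>nat\<close> would
          misread the degree of \<open>h\<close> as arity 0.\<close>
        case True
        then have "h = 0" using h(1) by (simp add: cM)
        then have "x = 0" using h(2) M.diff_minus[of 0 "p - 1" 0] F.subspace_0[OF M.comp_subspace] by simp
        then have "proj t (nat (p + 2)) x = diff ?M (p - 1) 0"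
          using proj_zero[OF t] M.diff_minus[of 0 "p - 1" 0] F.subspace_0[OF M.comp_subspace]
          by (simp add: zero_fun_def)
        then show ?thesis using F.subspace_0[OF L.comp_subspace] by blast
      next
        case False
        then have p: "p \<ge> 0" "nat (p - 1 + 1) = nat p" using \<open>p \<ge> - 1\<close> by auto
        have hN: "h \<in> ?N (nat (p - 1 + 1))" using h(1) p by (simp add: cM)
        let ?s = "\<lambda>f bs. ksign (nat p + 1) (f bs :: 'b)"
        have sN: "?s f \<in> ?N n" if "f \<in> ?N n" for f n
          using that by (auto simp: normalized_cochains_def intro!: B.lincomb_mem_cochains)
        have "x = delta (?s h)"
          unfolding h(2) dM[OF hN] by (simp add: fun_eq_iff delta_ksign p)
        then have "proj t (nat (p + 2)) x = delta (proj t (nat (p + 2)) (?s h))"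
          by (simp only: delta_proj[OF t])
        moreover have hp: "proj t (nat (p + 2)) (?s h) \<in> ?N (nat (p - 1 + 1))" "eqv (proj t (nat (p + 2)) (?s h))"
          using E[OF sN[OF hN], of "nat (p + 2)"] p(1) by auto
        ultimately have "proj t (nat (p + 2)) x = diff ?M (p - 1) (?s (proj t (nat (p + 2)) (?s h)))"
          unfolding dM[OF sN[OF hp(1)]] by (simp add: fun_eq_iff delta_ksign p) (simp add: ksign_def)
        moreover have "?s (proj t (nat (p + 2)) (?s h)) \<in> comp ?L (p - 1)"
          using sN[OF hp(1)] eqv_lincomb(3)[OF hp(2) hp(2)] p(1) by (simp add: cL cM)
        ultimately show ?thesis by blast
      qed
      then obtain h' where h': "h' \<in> comp ?L (p - 1)" "proj t (nat (p + 2)) x = diff ?M (p - 1) h'" by blast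
      have "x = diff ?M (p - 1) (g + h')"
        using g(2) h'(2) M.diff_add[OF g(1), of h'] h'(1) by (simp add: cL algebra_simps)
      moreover have gh: "g + h' \<in> comp ?L (p - 1)"
        using g(1,3) h'(1) F.subspace_add[OF L.comp_subspace] by (simp add: cL)
      ultimately have "x = diff ?L (p - 1) (g + h')" using dL[OF gh] by simp
      then show ?thesis unfolding coboundaries_def using gh by (rule image_eqI)
    qed
  qed
  show ?thesis
    by unfold_locales (use cL dL bij in \<open>auto simp: L_invariant_def L_Hochschild_def shifted_dgl_def\<close>)
qed

end

theorem theorem4p8:
  fixes H :: "('k::field, 'e::ring) hopf" and R :: "'e set"
    and sA :: "'k \<Rightarrow> 'a::ring \<Rightarrow> 'a" and uA :: 'a and act :: "'e \<Rightarrow> 'a \<Rightarrow> 'a"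
    and sB :: "'k \<Rightarrow> 'b::ring \<Rightarrow> 'b" and uB :: 'b and sm :: "'a \<Rightarrow> 'e \<Rightarrow> 'b"
  assumes "hopf_algebra H"
    and "finite_dimensional_vector_space (hscale H) R"
    and "semisimple_algebra (hscale H)"
    and "cosemisimple_coalgebra H"
    and "module_algebra H sA uA act"
    and "smash_product H sA uA act sB uB sm"
  shows "dg_lie_quasi_iso (fscale sB) (L_invariant H R uA sB uB sm)
           (fscale sB) (L_Hochschild sB uB) (\<lambda>p f. f)"
proof -
  interpret smash_product H sA uA act sB uB sm by fact
  obtain t where t: "H.integral t" "H.ep t = 1"
    using H.semisimple_integral[OF assms(3)] by blast
  show ?thesis
    by (rule L_invariant_quasi_iso[OF assms(2) t H.S4[OF assms(2,3,4)]])
qed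

end
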